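(* Let $p$ be a probability distribution on $\nabla'$ with exponential decay. Let $y=(y_1,y_2,\dots)$ be a random vector with law $p$, let $\sigma=(\sigma_n)_{n\ge1}$ be the random virtual permutation generated by $y$, with permutation matrices $(M_n)_{n\ge 1}$, let $(u_j)_{j\geq 1}$ be i.i.d. uniform random variables on the unit circle, independent of $\sigma$ (that is, of $y$ and of the points $(x_k)_{k\ge1}$ generating $\sigma$), and let $(\widetilde M_n)_{n\ge1}$ be the random modified virtual permutation generated by $\sigma$ and $(u_j)_{j\ge 1}$. For $z\in\mathbb{C}$ and $\alpha\in(0,1)$ irrational put $$\widetilde{\xi}_n(z)=\frac{\det(e^{2i\pi z/n}I-\widetilde M_n)}{\det(I-\widetilde M_n)},\qquad \xi_{n,\alpha}(z)=\frac{\det\left(e^{2i\pi(\frac zn+\alpha)}I-M_n\right)}{\det\left(e^{2i\pi\alpha}I-M_n\right)}.$$ Then: (i) Almost surely, $\widetilde\xi_n$ converges, as $n\to\infty$, uniformly on every compact subset of $\mathbb{C}$ to the entire function $\widetilde\xi_\infty$ defined by $$\widetilde\xi_\infty(z)=\prod_{j=1}^{+\infty}\frac{e^{2i\pi z y_j}-u_j}{1-u_j}.$$ (ii) Assume that $\alpha\in(0,1)$ is an irrational number of finite type. Then, as $n\to\infty$, $\xi_{n,\alpha}$ converges in law to the same random entire function $\widetilde\xi_\infty$, on the space of continuous functions from $\mathbb{C}$ to $\mathbb{C}$ equipped with the topology of uniform convergence on compact sets.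
   Context: **Simplices.** $\nabla=\{(\lambda_1,\lambda_2,\dots)\in[0,1]^\infty:\lambda_1\ge\lambda_2\ge\cdots,\ \sum_{j\ge1}\lambda_j\le1\}$ and $\nabla'=\{\lambda\in\nabla:\sum_{j\ge1}\lambda_j=1\}$. A probability measure $p$ on $\nabla$ has exponential decay if there exist $r\in(0,1)$ and $\nabla_1\subset\nabla$ with $p(\nabla_1)=1$ such that for all $\lambda\in\nabla_1$ there exists $C>0$ with $\lambda_j\le Cr^j$ for all $j\ge1$. **Virtual permutations.** A virtual permutation is a sequence $(\sigma_n)_{n\ge1}$, $\sigma_n\in\mathfrak{S}_n$ (the symmetric group on $\{1,\dots,n\}$), such that $\sigma_n$ is obtained from $\sigma_{n+1}$ by removing the element $n+1$ from its decomposition into disjoint cycles. Generation from $y\in\nabla'$: let $E_y=\bigsqcup_{j\ge1}\mathcal{C}_j$ be a disjoint union of circles, $\mathcal{C}_j$ having perimeter $y_j$; conditionally on $y$ let $(x_k)_{k\ge1}$ be i.i.d. uniform on $E_y$. For $1\le k\le n$ with $x_k\in\mathcal{C}_j$, $\sigma_n(k)$ is the index of the first point of $\{x_1,\dots,x_n\}$ met strictly after $x_k$ when following $\mathcal{C}_j$ counterclockwise from $x_k$ (with $\sigma_n(k)=k$ if $x_k$ is the only such point on $\mathcal{C}_j$). Thus the cycles of $\sigma_n$ are indexed by those $j$ with $\ell_{n,j}:=\#\{k\in\{1,\dots,n\}:x_k\in\mathcal{C}_j\}>0$. This $(\sigma_n)$ is a virtual permutation. **Matrices.** $M_n$ is the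 $n\times n$ matrix with entries $(M_n)_{i,j}=1$ if $i=\sigma_n(j)$ and $0$ otherwise. A modified permutation matrix is a permutation matrix in which the entries equal to $1$ are replaced by complex numbers of modulus one; $\mathcal{T}_n$ is the set of $n\times n$ modified permutation matrices not having $1$ as an eigenvalue. The random modified virtual permutation generated by $\sigma$ and $(u_j)$ is a random sequence $(\widetilde M_n)_{n\ge1}$ such that almost surely, for all $n$: $\widetilde M_n\in\mathcal{T}_n$; the non-zero entries of $\widetilde M_n$ are located where those of $M_n$ are; $\mathrm{rank}(\widetilde M_{n+1}-\mathrm{diag}(\widetilde M_n,1))=1$; for each $j$ with $\ell_{n,j}>0$ the product of the non-zero entries of $\widetilde M_n$ corresponding to the cycle of $\sigma_n$ attached to $\mathcal{C}_j$ equals $u_j$; and for each $n$ the non-zero entries of $\widetilde M_n$ are i.i.d. uniform on the unit circle. **Type.** For real $x$ let $\Vert x\Vert$ be the distance from $x$ to the nearest integer. The type of $x$ is $\eta=\sup\{\gamma\in\mathbb{R}:\liminf_{n\to+\infty}n^\gamma\Vert nx\Vert=0\}\in[0,+\infty]$; $x$ is of finite type if $\eta<\infty$.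
   Formalization: Part (ii) is proved assuming that almost surely all y_j are positive; without this it is false, e.g. for y=(1,0,0,...), where ξ_{n,α}(1/2) is deterministic and does not converge. Part (i) needs no such assumption. *)

theory Defs
  imports
    "HOL-Probability.Probability"
    "HOL-Complex_Analysis.Complex_Analysis"
    "Jordan_Normal_Form.DL_Rank"
    "Jordan_Normal_Form.Char_Poly"
begin

text \<open>
  All labels are shifted by one: coordinates, circles and points are numbered from \<open>0\<close>,
  and \<open>\<sigma>\<^sub>n\<close> acts on \<open>{..<n}\<close>. This agrees with the indexing of matrices.
\<close>

section \<open>Simplices\<close>

definition nabla :: "(nat \<Rightarrow> real) set" where
  "nabla = {l. (\<forall>j. l j \<in> {0..1}) \<and> decseq l \<and> summable l \<and> suminf l \<le> 1}"

definition nabla' :: "(nat \<Rightarrow> real) set" where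
  "nabla' = {l \<in> nabla. suminf l = 1}"

definition seq_borel :: "(nat \<Rightarrow> real) measure" where
  "seq_borel = (\<Pi>\<^sub>M j\<in>UNIV. borel)"

text \<open>A law on \<open>nabla'\<close> is a probability measure on the space of real sequences which is
  concentrated on \<open>nabla'\<close>.\<close>

definition law_on_nabla' :: "(nat \<Rightarrow> real) measure \<Rightarrow> bool" where
  "law_on_nabla' p \<longleftrightarrow> prob_space p \<and> sets p = sets seq_borel \<and> (AE l in p. l \<in> nabla')"

definition exponential_decay :: "(nat \<Rightarrow> real) measure \<Rightarrow> bool" where
  "exponential_decay p \<longleftrightarrow>
     (\<exists>r\<in>{0<..<1}. \<exists>N\<in>sets p. N \<subseteq> nabla \<and> measure p N = 1 \<and>
        (\<forall>l\<in>N. \<exists>C>0. \<forall>j. l j \<le> C * r ^ Suc j))"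


section \<open>Virtual permutation generated by points on circles\<close>

text \<open>The circle of perimeter \<open>y j\<close> is \<open>[0, y j)\<close>, with the increasing direction as the
  counterclockwise one; a point on one of the circles is a pair (circle, position).\<close>

definition circles :: "(nat \<Rightarrow> real) \<Rightarrow> (nat \<times> real) set" where
  "circles y = (SIGMA j:UNIV. {0..<y j})"

definition uniform_on_circles :: "(nat \<Rightarrow> real) \<Rightarrow> (nat \<times> real) measure" where
  "uniform_on_circles y = uniform_measure (count_space UNIV \<Otimes>\<^sub>M lborel) (circles y)"

text \<open>Conditionally on \<open>Y\<close>, the points \<open>X 0, X 1, \<dots>\<close> are i.i.d. uniform on \<open>circles Y\<close>.\<close>

definition cond_iid_uniform ::
    "'a measure \<Rightarrow> ('a \<Rightarrow> nat \<Rightarrow> real) \<Rightarrow> (nat \<Rightarrow> 'a \<Rightarrow> nat \<times> real) \<Rightarrow> bool" where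
  "cond_iid_uniform P Y X \<longleftrightarrow>
     (\<forall>k. X k \<in> P \<rightarrow>\<^sub>M (count_space UNIV \<Otimes>\<^sub>M borel)) \<and>
     (\<forall>n B. (\<forall>k<n. B k \<in> sets (count_space UNIV \<Otimes>\<^sub>M borel)) \<longrightarrow>
        (AE \<omega> in P.
           real_cond_exp P (vimage_algebra (space P) Y seq_borel)
             (indicat_real {\<omega>'\<in>space P. \<forall>k<n. X k \<omega>' \<in> B k}) \<omega>
           = (\<Prod>k<n. measure (uniform_on_circles (Y \<omega>)) (B k))))"

text \<open>Distance covered when going counterclockwise from \<open>s\<close> to the next visit of \<open>t\<close> on a
  circle of perimeter \<open>L\<close>; it lies in \<open>(0, L]\<close>.\<close>

definition ccw_dist :: "real \<Rightarrow> real \<Rightarrow> real \<Rightarrow> real" where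
  "ccw_dist L s t = (if s < t then t - s else L + t - s)"

text \<open>\<open>gen_perm y x n\<close> is the permutation \<open>\<sigma>\<^sub>n\<close> generated by the points \<open>x 0, \<dots>, x (n - 1)\<close>. Ties in
  the minimum only occur when two points coincide, which is a null event.\<close>

definition gen_perm :: "(nat \<Rightarrow> real) \<Rightarrow> (nat \<Rightarrow> nat \<times> real) \<Rightarrow> nat \<Rightarrow> nat \<Rightarrow> nat" where
  "gen_perm y x n k =
     (let S = {l. l < n \<and> l \<noteq> k \<and> fst (x l) = fst (x k)}
      in if S = {} then k
         else arg_min_on (\<lambda>l. ccw_dist (y (fst (x k))) (snd (x k)) (snd (x l))) S)"

definition on_circle :: "(nat \<Rightarrow> nat \<times> real) \<Rightarrow> nat \<Rightarrow> nat \<Rightarrow> nat set" where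
  "on_circle x n j = {k. k < n \<and> fst (x k) = j}"


section \<open>Matrices\<close>

definition perm_matrix :: "nat \<Rightarrow> (nat \<Rightarrow> nat) \<Rightarrow> complex mat" where
  "perm_matrix n \<sigma> = Matrix.mat n n (\<lambda>(i, j). if i = \<sigma> j then 1 else 0)"

definition modified_perm_matrix :: "nat \<Rightarrow> complex mat \<Rightarrow> bool" where
  "modified_perm_matrix n A \<longleftrightarrow>
     (\<exists>\<pi> c. \<pi> permutes {..<n} \<and> (\<forall>j<n. cmod (c j) = 1) \<and>
        A = Matrix.mat n n (\<lambda>(i, j). if i = \<pi> j then c j else 0))"

definition T_set :: "nat \<Rightarrow> complex mat set" where
  "T_set n = {A. modified_perm_matrix n A \<and> \<not> eigenvalue A 1}"

definition diag_one :: "nat \<Rightarrow> complex mat \<Rightarrow> complex mat" where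
  "diag_one n A = four_block_mat A (0\<^sub>m n 1) (0\<^sub>m 1 n) (1\<^sub>m 1)"

definition uniform_unit_circle :: "complex measure" where
  "uniform_unit_circle = distr (uniform_measure lborel {0..<1}) borel (\<lambda>t. cis (2 * pi * t))"

definition iid_uniform_unit_circle :: "'a measure \<Rightarrow> (nat \<Rightarrow> 'a \<Rightarrow> complex) \<Rightarrow> nat set \<Rightarrow> bool" where
  "iid_uniform_unit_circle P V I \<longleftrightarrow>
     prob_space.indep_vars P (\<lambda>_. borel) V I \<and>
     (\<forall>k\<in>I. distr P borel (V k) = uniform_unit_circle)"

text \<open>Independence of two random variables with values in spaces of different types, which
  \<^const>\<open>prob_space.indep_var\<close> does not cover.\<close>

definition independent_rvs ::
    "'a measure \<Rightarrow> 'b measure \<Rightarrow> ('a \<Rightarrow> 'b) \<Rightarrow> 'c measure \<Rightarrow> ('a \<Rightarrow> 'c) \<Rightarrow> bool" where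
  "independent_rvs P N f N' g \<longleftrightarrow>
     f \<in> P \<rightarrow>\<^sub>M N \<and> g \<in> P \<rightarrow>\<^sub>M N' \<and>
     prob_space.indep_set P (sets (vimage_algebra (space P) f N)) (sets (vimage_algebra (space P) g N'))"

text \<open>The non-zero entry of the \<open>k\<close>-th column of the \<open>n\<close>-th matrix is the one in row
  \<open>\<sigma>\<^sub>n k\<close>.\<close>

definition modified_virtual_permutation ::
    "'a measure \<Rightarrow> ('a \<Rightarrow> nat \<Rightarrow> real) \<Rightarrow> (nat \<Rightarrow> 'a \<Rightarrow> nat \<times> real) \<Rightarrow> (nat \<Rightarrow> 'a \<Rightarrow> complex)
     \<Rightarrow> (nat \<Rightarrow> 'a \<Rightarrow> complex mat) \<Rightarrow> bool" where
  "modified_virtual_permutation P Y X U Mt \<longleftrightarrow>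
     (let \<sigma> = (\<lambda>n \<omega>. gen_perm (Y \<omega>) (\<lambda>k. X k \<omega>) n) in
       (\<forall>n\<ge>1. \<forall>i<n. \<forall>j<n. (\<lambda>\<omega>. Mt n \<omega> $$ (i, j)) \<in> borel_measurable P) \<and>
       (AE \<omega> in P. \<forall>n\<ge>1.
          Mt n \<omega> \<in> T_set n \<and>
          (\<forall>i<n. \<forall>j<n. Mt n \<omega> $$ (i, j) \<noteq> 0 \<longleftrightarrow> perm_matrix n (\<sigma> n \<omega>) $$ (i, j) \<noteq> 0) \<and>
          vec_space.rank (Suc n) (Mt (Suc n) \<omega> - diag_one n (Mt n \<omega>)) = 1 \<and>
          (\<forall>j. on_circle (\<lambda>k. X k \<omega>) n j \<noteq> {} \<longrightarrow>
             (\<Prod>k\<in>on_circle (\<lambda>k. X k \<omega>) n j. Mt n \<omega> $$ (\<sigma> n \<omega> k, k)) = U j \<omega>)) \<and>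
       (\<forall>n\<ge>1. iid_uniform_unit_circle P (\<lambda>k \<omega>. Mt n \<omega> $$ (\<sigma> n \<omega> k, k)) {..<n}))"


section \<open>Renormalised characteristic polynomials\<close>

definition xi_tilde :: "nat \<Rightarrow> complex mat \<Rightarrow> complex \<Rightarrow> complex" where
  "xi_tilde n A z =
     Determinant.det (exp (2 * \<i> * of_real pi * z / of_nat n) \<cdot>\<^sub>m 1\<^sub>m n - A)
     / Determinant.det (1\<^sub>m n - A)"

definition xi_alpha :: "nat \<Rightarrow> real \<Rightarrow> complex mat \<Rightarrow> complex \<Rightarrow> complex" where
  "xi_alpha n \<alpha> A z =
     Determinant.det (exp (2 * \<i> * of_real pi * (z / of_nat n + of_real \<alpha>)) \<cdot>\<^sub>m 1\<^sub>m n - A)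
     / Determinant.det (exp (2 * \<i> * of_real pi * of_real \<alpha>) \<cdot>\<^sub>m 1\<^sub>m n - A)"

definition xi_factor :: "(nat \<Rightarrow> real) \<Rightarrow> (nat \<Rightarrow> complex) \<Rightarrow> complex \<Rightarrow> nat \<Rightarrow> complex" where
  "xi_factor y u z j = (exp (2 * \<i> * of_real pi * z * of_real (y j)) - u j) / (1 - u j)"

definition xi_infinity :: "(nat \<Rightarrow> real) \<Rightarrow> (nat \<Rightarrow> complex) \<Rightarrow> complex \<Rightarrow> complex" where
  "xi_infinity y u z = (\<Prod>j. xi_factor y u z j)"


section \<open>Type of a real number\<close>

definition dist_nearest_int :: "real \<Rightarrow> real" where
  "dist_nearest_int x = \<bar>x - of_int (round x)\<bar>"

definition diophantine_type :: "real \<Rightarrow> ereal" where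
  "diophantine_type x =
     Sup (ereal ` {\<gamma>. liminf (\<lambda>n. ereal (real n powr \<gamma> * dist_nearest_int (real n * x))) = 0})"

definition finite_type :: "real \<Rightarrow> bool" where
  "finite_type x \<longleftrightarrow> diophantine_type x < \<infinity>"


section \<open>Convergence in law\<close>

text \<open>The space of continuous functions on the complex plane with the topology of uniform
  convergence on compact sets. The generating sets are indeed open for that topology, as a
  continuous function attains its maximum on a non-empty compact set.\<close>

definition compact_convergence_topology :: "(complex \<Rightarrow> complex) topology" where
  "compact_convergence_topology =
     topology_generated_by
       {{g. continuous_on UNIV g \<and> (\<forall>z\<in>K. dist (g z) (f z) < e)} | f K e.
          continuous_on UNIV f \<and> compact K \<and> 0 < e}"

lemma topspace_compact_convergence_topology:
  "topspace compact_convergence_topology = {f. continuous_on UNIV f}"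
proof -
  have "{f. continuous_on UNIV f} \<in>
       {{g. continuous_on UNIV g \<and> (\<forall>z\<in>K. dist (g z) (f z) < e)} | f K e.
          continuous_on UNIV (f :: complex \<Rightarrow> complex) \<and> compact K \<and> 0 < (e :: real)}"
    by (intro CollectI exI[of _ "\<lambda>_. 0"] exI[of _ "{}"] exI[of _ 1]) simp
  then show ?thesis
    unfolding compact_convergence_topology_def topology_generated_by_topspace by blast
qed

definition borel_of :: "'b topology \<Rightarrow> 'b measure" where
  "borel_of T = sigma (topspace T) {S. openin T S}"

definition converges_in_law ::
    "'b topology \<Rightarrow> 'a measure \<Rightarrow> (nat \<Rightarrow> 'a \<Rightarrow> 'b) \<Rightarrow> ('a \<Rightarrow> 'b) \<Rightarrow> bool" where
  "converges_in_law T P V Z \<longleftrightarrow>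
     (\<forall>n. V n \<in> P \<rightarrow>\<^sub>M borel_of T) \<and> Z \<in> P \<rightarrow>\<^sub>M borel_of T \<and>
     (\<forall>F :: 'b \<Rightarrow> real. continuous_map T euclideanreal F \<longrightarrow> bounded (F ` topspace T) \<longrightarrow>
        (\<lambda>n. \<integral>\<omega>. F (V n \<omega>) \<partial>P) \<longlonglongrightarrow> (\<integral>\<omega>. F (Z \<omega>) \<partial>P))"

end

theory Submission
  imports Defs
begin

text \<open>
  The theorem rests on one exact formula and one stability estimate.

  The formula: the permutation generated by points on circles has one cycle on each circle that
  carries a point (\<open>cyclic_on_gen_perm\<close>), so every determinant involved is a product over the
  circles (\<open>det_weighted_perm_mat\<close>). As a result both normalised characteristic polynomials are
  instances of \<^term>\<open>xi_infinity\<close>: the perimeters are replaced by the frequencies \<open>l\<^sub>j / n\<close> of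
  the circles, and the phases are \<open>u\<^sub>j\<close> for the modified matrices
  (\<open>xi_tilde_eq_xi_infinity\<close>), respectively \<open>exp (- 2 \<pi> i \<alpha> l\<^sub>j)\<close> for the permutation matrices
  (\<open>xi_alpha_eq_xi_infinity\<close>). What remains is the dependence of the infinite product on its
  parameters. The estimate \<open>norm_xi_infinity_diff_le\<close> bounds the difference of two such products
  on a disc by the sum of \<open>xi_gap\<close>, which compares perimeters and the inverses of \<open>1 - u\<^sub>j\<close>.

  Part (i). By Borel-Cantelli the distances \<open>|1 - u\<^sub>j|\<close> are almost surely at least \<open>c / (j + 1)\<^sup>2\<close>
  (\<open>AE_phase_bound\<close>). With weights \<open>(j + 1)\<^sup>2\<close> the frequencies still converge to the perimeters in
  the summed norm (\<open>AE_freq_error_tendsto_0\<close>): the mean error at time \<open>n\<close> is of order \<open>n\<^bsup>-1/2\<^esup>\<close>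
  because the decay makes the square roots of the perimeters summable against the weights, and
  monotonicity of the counts fills the gaps between fourth powers.

  Part (ii). Fix the perimeters. The counts are now those of independent draws, and
  \<open>l\<^sub>j \<alpha>\<close> has to be shown to equidistribute modulo one, jointly in \<open>j\<close>, without coming too close to
  the integers. Joint equidistribution is a computation of moments: a non-constant monomial in the
  phases is a product over the draws, with mean the \<open>n\<close>-th power of a number of modulus less than one
  (\<open>large_phase_moments\<close>). Closeness to the integers is where the finite type enters. It gives
  \<open>\<parallel>h \<alpha>\<parallel> \<ge> c / h\<^sup>m\<close> (\<open>finite_type_lower_bound\<close>), so the set of \<open>k\<close> with \<open>\<parallel>k \<alpha>\<parallel>\<close> small has
  large gaps; since a binomial law hardly changes under a shift (\<open>sum_Bernstein_shift\<close>), it gives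
  little mass to a set with large gaps (\<open>sum_Bernstein_near_integer\<close>). The latter argument needs a
  perimeter of size at least a negative power of \<open>n\<close>. The other circles carry so few points that the
  lower bound \<open>c / l\<^sub>j\<^sup>m\<close> alone makes their contribution negligible (\<open>gap_sum_le\<close>).

  Outside an event of small probability the phases thus stay in a compact set on which the product
  depends continuously on the phases; a functional of the limit extends from this set to a
  continuous function on the torus, and the moments decide (\<open>quenched_limit\<close>). Averaging over the
  perimeters by dominated convergence gives the convergence in law.
\<close>

section \<open>Determinants of weighted permutation matrices\<close>

text \<open>\<open>f\<close> acts on \<open>S\<close> as a single cycle. Minimality among the invariant sets is what an extremal
  argument can verify for points on a circle, without following an orbit.\<close>

definition cyclic_on :: "('a \<Rightarrow> 'a) \<Rightarrow> 'a set \<Rightarrow> bool" where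
  "cyclic_on f S \<longleftrightarrow> inj_on f S \<and> f ` S \<subseteq> S \<and> (\<forall>T\<subseteq>S. T \<noteq> {} \<longrightarrow> f ` T \<subseteq> T \<longrightarrow> T = S)"

definition restrict_perm :: "('a \<Rightarrow> 'a) \<Rightarrow> 'a set \<Rightarrow> 'a \<Rightarrow> 'a" where
  "restrict_perm f S = (\<lambda>k. if k \<in> S then f k else k)"

lemma restrict_perm_permutes:
  assumes "finite S" "inj_on f S" "f ` S \<subseteq> S"
  shows "restrict_perm f S permutes S"
proof -
  have "f ` S = S" using assms by (meson endo_inj_surj)
  then have "bij_betw (restrict_perm f S) S S"
    using assms unfolding bij_betw_def restrict_perm_def by (auto simp: inj_on_def)
  then show ?thesis by (rule bij_imp_permutes) (auto simp: restrict_perm_def)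
qed

text \<open>Composing with the transposition of \<open>a\<close> and \<open>f a\<close> makes \<open>a\<close> a fixed point and leaves a single
  cycle on the other elements, so the sign alternates with the size.\<close>

lemma sign_restrict_perm_cyclic:
  assumes "finite S" "S \<noteq> {}" "cyclic_on f S"
  shows "sign (restrict_perm f S) = - ((- 1) ^ card S)"
  using assms
proof (induction "card S" arbitrary: S f rule: less_induct)
  case (less S f)
  obtain a where a: "a \<in> S" using less.prems by auto
  have inj: "inj_on f S" and sub: "f ` S \<subseteq> S"
    and min: "\<And>T. T \<subseteq> S \<Longrightarrow> T \<noteq> {} \<Longrightarrow> f ` T \<subseteq> T \<Longrightarrow> T = S"
    using less.prems(3) unfolding cyclic_on_def by auto
  have surj: "f ` S = S" using inj sub less.prems(1) by (meson endo_inj_surj)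
  show ?case
  proof (cases "f a = a")
    case True
    have "{a} = S" using min[of "{a}"] True a by auto
    then have S: "S = {a}" by simp
    then have "restrict_perm f S = id" using True by (auto simp: restrict_perm_def)
    then show ?thesis using S by (simp add: sign_id)
  next
    case False
    define b where "b = f a"
    define S' where "S' = S - {a}"
    define g where "g = Transposition.transpose a b \<circ> restrict_perm f S"
    have b: "b \<in> S" "b \<noteq> a" using a sub False by (auto simp: b_def)
    have ga: "g a = a" using a by (simp add: g_def restrict_perm_def b_def)
    have perm: "restrict_perm f S permutes S"
      using restrict_perm_permutes less.prems(1) inj sub by blast
    have gperm: "g permutes S"
      unfolding g_def by (intro permutes_compose perm permutes_swap_id a b)
    have g_other: "g k = f k" if "k \<in> S" "f k \<noteq> a" "k \<noteq> a" for k
    proof -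
      have "f k \<noteq> b" using that a inj unfolding b_def inj_on_def by auto
      then show ?thesis using that by (simp add: g_def restrict_perm_def transpose_apply_other)
    qed
    have g_pre: "g k = b" if "k \<in> S" "f k = a" for k
      using that by (simp add: g_def restrict_perm_def)
    have gS': "g ` S' \<subseteq> S'"
    proof
      fix x assume "x \<in> g ` S'"
      then obtain k where k: "k \<in> S" "k \<noteq> a" "x = g k" by (auto simp: S'_def)
      have "g k \<in> S" using gperm k by (simp add: permutes_in_image)
      moreover have "g k \<noteq> a" using ga k gperm by (metis permutes_inj injD)
      ultimately show "x \<in> S'" using k by (simp add: S'_def)
    qed
    have cyc: "cyclic_on g S'"
      unfolding cyclic_on_def
    proof (intro conjI allI impI)
      show "inj_on g S'" using gperm by (meson inj_on_subset permutes_inj subset_UNIV)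
      show "g ` S' \<subseteq> S'" by fact
      fix T assume T: "T \<subseteq> S'" "T \<noteq> {}" "g ` T \<subseteq> T"
      show "T = S'"
      proof (cases "\<exists>k\<in>T. f k = a")
        case True
        then obtain k where k: "k \<in> T" "f k = a" by auto
        then have "g k = b" using g_pre T by (auto simp: S'_def)
        then have bT: "b \<in> T" using T(3) k(1) by auto
        have "f ` insert a T \<subseteq> insert a T"
        proof
          fix x assume "x \<in> f ` insert a T"
          then obtain t where t: "t = a \<or> t \<in> T" "x = f t" by auto
          show "x \<in> insert a T"
          proof (cases "t = a \<or> f t = a")
            case True then show ?thesis using t bT b_def by auto
          next
            case False
            then have "g t = f t" using t T g_other by (auto simp: S'_def)
            then show ?thesis using t T False by (metis image_subset_iff insertCI)
          qed
        qed
        then have "insert a T = S" using min[of "insert a T"] T a by (auto simp: S'_def)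
        then show ?thesis using T by (auto simp: S'_def)
      next
        case False
        have "f ` T \<subseteq> T"
        proof
          fix x assume "x \<in> f ` T"
          then obtain t where t: "t \<in> T" "x = f t" by auto
          then have "g t = f t" using False T g_other by (auto simp: S'_def)
          then show "x \<in> T" using t T by auto
        qed
        then have "T = S" using min T by (auto simp: S'_def)
        then show ?thesis using T a by (auto simp: S'_def)
      qed
    qed
    have S'ne: "S' \<noteq> {}" using b by (auto simp: S'_def)
    have card: "card S = Suc (card S')"
      using a less.prems(1) unfolding S'_def by (metis card.remove)
    have IH: "sign (restrict_perm g S') = - ((-1) ^ card S')"
      using less.hyps[of S' g] card cyc S'ne less.prems(1) by (auto simp: S'_def)
    have "restrict_perm g S' = g"
      using ga permutes_not_in[OF gperm] by (auto simp: restrict_perm_def S'_def fun_eq_iff)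
    then have sg: "sign g = - ((-1) ^ card S')" using IH by simp
    have "restrict_perm f S = Transposition.transpose a b \<circ> g"
      unfolding g_def by (simp add: fun_eq_iff)
    moreover have "permutation g" using gperm less.prems(1) permutes_imp_permutation by blast
    ultimately have "sign (restrict_perm f S) = sign (Transposition.transpose a b) * sign g"
      by (simp add: sign_compose permutation_swap_id)
    then show ?thesis using sg card b by (simp add: sign_swap_id)
  qed
qed

definition weighted_perm_mat :: "nat \<Rightarrow> (nat \<Rightarrow> nat) \<Rightarrow> (nat \<Rightarrow> complex) \<Rightarrow> complex mat" where
  "weighted_perm_mat n \<sigma> c = Matrix.mat n n (\<lambda>(i, j). if i = \<sigma> j then c j else 0)"

text \<open>In the Leibniz expansion a permutation contributes only if it sends each index \<open>k\<close> to \<open>k\<close> or to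
  \<open>\<sigma> k\<close>. The indices where it follows \<open>\<sigma>\<close> form an invariant set, that is a union of cycles, and the
  cycles are chosen independently: the diagonal contributes a power of \<open>x\<close>, the cycle itself the
  product of its weights, with sign \<open>- 1\<close> because \<open>(- 1)\<^bsup>l - 1\<^esup>\<close> from the cycle of length \<open>l\<close> meets
  \<open>(- 1)\<^sup>l\<close> from the entries.\<close>

lemma det_weighted_perm_mat:
  fixes x :: complex and blk :: "nat \<Rightarrow> nat" and n :: nat
  defines "S \<equiv> \<lambda>j. {k. k < n \<and> blk k = j}"
  assumes cyc: "\<And>j. j \<in> blk ` {..<n} \<Longrightarrow> cyclic_on \<sigma> (S j)"
  shows "Determinant.det (x \<cdot>\<^sub>m 1\<^sub>m n - weighted_perm_mat n \<sigma> c)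
    = (\<Prod>j\<in>blk ` {..<n}. x ^ card (S j) - (\<Prod>k\<in>S j. c k))"
proof -
  define I where "I = blk ` {..<n}"
  define A where "A = x \<cdot>\<^sub>m 1\<^sub>m n - weighted_perm_mat n \<sigma> c"
  define e where "e = (\<lambda>i j. (if i = j then x else 0) - (if i = \<sigma> j then c j else 0))"
  define U where "U = (\<lambda>K. {k. k < n \<and> blk k \<in> K})"
  define \<tau> where "\<tau> = (\<lambda>K. restrict_perm \<sigma> (U K))"
  have finI: "finite I" by (simp add: I_def)
  have finS: "finite (S j)" for j by (simp add: S_def)
  have finU: "finite (U K)" for K by (simp add: U_def)
  have inj: "inj_on \<sigma> (S j)" and sub: "\<sigma> ` S j \<subseteq> S j"
    and min: "\<And>T. T \<subseteq> S j \<Longrightarrow> T \<noteq> {} \<Longrightarrow> \<sigma> ` T \<subseteq> T \<Longrightarrow> T = S j" if "j \<in> I" for j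
    using cyc[of j] that unfolding cyclic_on_def I_def by auto
  have Sne: "S j \<noteq> {}" if "j \<in> I" for j using that by (auto simp: I_def S_def)
  have Sblk: "k \<in> S (blk k)" "blk k \<in> I" if "k < n" for k using that by (auto simp: S_def I_def)
  have \<sigma>S: "\<sigma> k < n \<and> blk (\<sigma> k) = blk k" if "k < n" for k
    using sub[of "blk k"] Sblk[OF that] by (auto simp: S_def)
  have \<sigma>inj: "k = l" if "k < n" "l < n" "\<sigma> k = \<sigma> l" for k l
  proof -
    have "blk k = blk l" using \<sigma>S[OF that(1)] \<sigma>S[OF that(2)] that(3) by simp
    then have "l \<in> S (blk k)" using Sblk(1)[OF that(2)] by simp
    then show ?thesis using inj_onD[OF inj[OF Sblk(2)[OF that(1)]] that(3) Sblk(1)[OF that(1)]] by simp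
  qed
  have Uinj: "inj_on \<sigma> (U K)" for K by (rule inj_onI) (simp add: U_def \<sigma>inj)
  have Usub: "\<sigma> ` U K \<subseteq> U K" for K using \<sigma>S by (auto simp: U_def)
  have Uperm: "\<tau> K permutes U K" for K
    unfolding \<tau>_def by (rule restrict_perm_permutes[OF finU Uinj Usub])
  have sign: "sign (\<tau> K) = (\<Prod>j\<in>K. - ((-1) ^ card (S j)))" if "K \<subseteq> I" for K
  proof -
    have "finite K" using that finI finite_subset by blast
    then show ?thesis using that
    proof (induction K)
      case empty
      have "\<tau> {} = id" by (auto simp: \<tau>_def restrict_perm_def U_def)
      then show ?case by (simp add: sign_id)
    next
      case (insert j K)
      have "\<tau> (insert j K) = restrict_perm \<sigma> (S j) \<circ> \<tau> K"
        using insert.hyps \<sigma>S by (auto simp: fun_eq_iff \<tau>_def restrict_perm_def U_def S_def)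
      moreover have "permutation (restrict_perm \<sigma> (S j))"
        by (rule permutes_imp_permutation[OF finS restrict_perm_permutes[OF finS inj sub]])
          (use insert.prems in auto)
      moreover have "permutation (\<tau> K)" by (rule permutes_imp_permutation[OF finU Uperm])
      ultimately have "sign (\<tau> (insert j K)) = sign (restrict_perm \<sigma> (S j)) * sign (\<tau> K)"
        by (simp add: sign_compose)
      also have "sign (restrict_perm \<sigma> (S j)) = - ((-1) ^ card (S j))"
        using sign_restrict_perm_cyclic[OF finS] Sne cyc insert.prems by (auto simp: I_def)
      finally show ?case using insert by simp
    qed
  qed
  have Aij: "A $$ (i, j) = e i j" if "i < n" "j < n" for i j
    using that by (auto simp: A_def e_def weighted_perm_mat_def)
  have carrier: "A \<in> carrier_mat n n" by (auto simp: A_def weighted_perm_mat_def)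
  \<comment> \<open>A block that is a fixed point is left alone by both choices, so it is treated apart.\<close>
  define I' where "I' = {j\<in>I. \<exists>k\<in>S j. \<sigma> k \<noteq> k}"
  have I'_sub: "I' \<subseteq> I" by (auto simp: I'_def)
  have moved: "\<sigma> k \<noteq> k" if "j \<in> I'" "k \<in> S j" for j k
  proof
    assume "\<sigma> k = k"
    moreover have "{k} = S j"
      by (rule min) (use that I'_sub \<open>\<sigma> k = k\<close> in auto)
    ultimately show False using that by (auto simp: I'_def)
  qed
  have \<tau>_inj: "inj_on \<tau> (Pow I')"
  proof (rule inj_onI)
    fix K L assume KL: "K \<in> Pow I'" "L \<in> Pow I'" "\<tau> K = \<tau> L"
    have "j \<in> K \<longleftrightarrow> j \<in> L" if j: "j \<in> I'" for j
    proof -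
      obtain k where k: "k \<in> S j" using Sne I'_sub j by blast
      then have "\<sigma> k \<noteq> k" using moved j by blast
      then show ?thesis using k fun_cong[OF KL(3), of k]
        by (auto simp: \<tau>_def restrict_perm_def U_def S_def split: if_splits)
    qed
    then show "K = L" using KL by blast
  qed
  have "Determinant.det A = (\<Sum>p | p permutes {0..<n}. signof p * (\<Prod>j<n. A $$ (p j, j)))"
    by (rule det_col[OF carrier])
  also have "\<dots> = (\<Sum>p | p permutes {..<n}. signof p * (\<Prod>j<n. e (p j) j))"
  proof (intro sum.cong)
    fix p assume p: "p \<in> {p. p permutes {..<n}}"
    have "(\<Prod>j<n. A $$ (p j, j)) = (\<Prod>j<n. e (p j) j)"
    proof (rule prod.cong[OF refl])
      fix j assume "j \<in> {..<n}"
      then have "p j \<in> {..<n}" "j < n" using p permutes_in_image[of p "{..<n}" j] by auto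
      then show "A $$ (p j, j) = e (p j) j" by (intro Aij) auto
    qed
    then show "signof p * (\<Prod>j<n. A $$ (p j, j)) = signof p * (\<Prod>j<n. e (p j) j)" by simp
  qed (simp add: lessThan_atLeast0)
  also have "\<dots> = (\<Sum>p\<in>\<tau> ` Pow I'. signof p * (\<Prod>j<n. e (p j) j))"
  proof (rule sum.mono_neutral_right)
    show "finite {p. p permutes {..<n}}" by (simp add: finite_permutations)
    show "\<tau> ` Pow I' \<subseteq> {p. p permutes {..<n}}"
      using Uperm by (auto simp: U_def intro!: permutes_subset[OF Uperm])
    show "\<forall>p\<in>{p. p permutes {..<n}} - \<tau> ` Pow I'. signof p * (\<Prod>j<n. e (p j) j) = 0"
    proof
      fix p assume p: "p \<in> {p. p permutes {..<n}} - \<tau> ` Pow I'"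
      then have pp: "p permutes {..<n}" by simp
      show "signof p * (\<Prod>j<n. e (p j) j) = 0"
      proof (rule ccontr)
        assume "signof p * (\<Prod>j<n. e (p j) j) \<noteq> 0"
        then have nz: "e (p j) j \<noteq> 0" if "j < n" for j using that by auto
        then have dich: "p j = j \<or> p j = \<sigma> j" if "j < n" for j
          using that by (force simp: e_def split: if_splits)
        define T where "T = {k. k < n \<and> p k = \<sigma> k}"
        have pinj: "p a = p b \<Longrightarrow> a = b" for a b using pp permutes_inj injD by metis
        \<comment> \<open>If p fixed the successor of a k with p k = \<sigma> k, injectivity of p would make k a fixed point of \<sigma>.\<close>
        have closed: "\<sigma> k \<in> T" if "k \<in> T" for k
        proof -
          have k: "k < n" "p k = \<sigma> k" using that by (auto simp: T_def)
          have "p (\<sigma> k) = \<sigma> (\<sigma> k)"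
          proof (cases "p (\<sigma> k) = \<sigma> k")
            case True
            then have "\<sigma> k = k" using k pinj by metis
            then show ?thesis using k by simp
          next
            case False then show ?thesis using dich \<sigma>S k by blast
          qed
          then show ?thesis using \<sigma>S k by (simp add: T_def)
        qed
        define K where "K = {j\<in>I'. S j \<inter> T \<noteq> {}}"
        have full: "S j \<subseteq> T" if "j \<in> K" for j
        proof -
          have "S j \<inter> T = S j"
            by (rule min) (use that sub closed I'_sub in \<open>auto simp: K_def\<close>)
          then show ?thesis by auto
        qed
        have "p = \<tau> K"
        proof
          fix k
          show "p k = \<tau> K k"
          proof (cases "k < n")
            case True
            show ?thesis
            proof (cases "blk k \<in> K")
              case True
              then have "k \<in> T" using full Sblk \<open>k < n\<close> by blast
              then show ?thesis using True \<open>k < n\<close> by (simp add: \<tau>_def restrict_perm_def U_def T_def)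
            next
              case False
              then have "k \<notin> T \<or> \<sigma> k = k" using Sblk \<open>k < n\<close> by (auto simp: K_def I'_def)
              then show ?thesis using False \<open>k < n\<close> dich[OF \<open>k < n\<close>]
                by (auto simp: \<tau>_def restrict_perm_def U_def T_def)
            qed
          next
            case False
            then show ?thesis using permutes_not_in[OF pp] by (simp add: \<tau>_def restrict_perm_def U_def)
          qed
        qed
        then show False using p by (auto simp: K_def)
      qed
    qed
  qed
  also have "\<dots> = (\<Sum>K\<in>Pow I'. signof (\<tau> K) * (\<Prod>k<n. e (\<tau> K k) k))"
    by (subst sum.reindex[OF \<tau>_inj]) (simp only: comp_def)
  also have "\<dots> = (\<Sum>K\<in>Pow I'. (\<Prod>j\<in>K. - (\<Prod>k\<in>S j. c k)) * (\<Prod>j\<in>I'-K. x ^ card (S j))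
       * (\<Prod>j\<in>I-I'. x ^ card (S j) - (\<Prod>k\<in>S j. c k)))"
  proof (rule sum.cong[OF refl])
    fix K assume K: "K \<in> Pow I'"
    have "(\<Prod>k<n. e (\<tau> K k) k) = (\<Prod>j\<in>I. \<Prod>k\<in>S j. e (\<tau> K k) k)"
      using prod.group[of "{..<n}" I blk "\<lambda>k. e (\<tau> K k) k"] finI
      by (simp add: I_def S_def lessThan_def)
    also have "\<dots> = (\<Prod>j\<in>K. \<Prod>k\<in>S j. e (\<tau> K k) k) * (\<Prod>j\<in>I'-K. \<Prod>k\<in>S j. e (\<tau> K k) k)
        * (\<Prod>j\<in>I-I'. \<Prod>k\<in>S j. e (\<tau> K k) k)"
      using K finI finite_subset[OF I'_sub finI]
      by (subst prod.subset_diff[OF I'_sub finI], subst prod.subset_diff[of K I']) (auto simp: mult_ac)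
    also have "(\<Prod>j\<in>K. \<Prod>k\<in>S j. e (\<tau> K k) k) = (\<Prod>j\<in>K. (-1) ^ card (S j) * (\<Prod>k\<in>S j. c k))"
    proof (rule prod.cong[OF refl])
      fix j assume j: "j \<in> K"
      have "(\<Prod>k\<in>S j. e (\<tau> K k) k) = (\<Prod>k\<in>S j. - c k)"
      proof (rule prod.cong[OF refl])
        fix k assume "k \<in> S j"
        moreover have "\<sigma> k \<noteq> k" using calculation moved j K by blast
        ultimately show "e (\<tau> K k) k = - c k"
          using j by (auto simp: e_def \<tau>_def restrict_perm_def U_def S_def)
      qed
      then show "(\<Prod>k\<in>S j. e (\<tau> K k) k) = (-1) ^ card (S j) * (\<Prod>k\<in>S j. c k)"
        by (simp add: prod_uminus)
    qed
    also have "(\<Prod>j\<in>I'-K. \<Prod>k\<in>S j. e (\<tau> K k) k) = (\<Prod>j\<in>I'-K. x ^ card (S j))"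
    proof (rule prod.cong[OF refl])
      fix j assume j: "j \<in> I' - K"
      have "(\<Prod>k\<in>S j. e (\<tau> K k) k) = (\<Prod>k\<in>S j. x)"
      proof (rule prod.cong[OF refl])
        fix k assume "k \<in> S j"
        moreover have "\<sigma> k \<noteq> k" using calculation moved j K by blast
        ultimately show "e (\<tau> K k) k = x"
          using j by (auto simp: e_def \<tau>_def restrict_perm_def U_def S_def)
      qed
      then show "(\<Prod>k\<in>S j. e (\<tau> K k) k) = x ^ card (S j)" by simp
    qed
    also have "(\<Prod>j\<in>I-I'. \<Prod>k\<in>S j. e (\<tau> K k) k) = (\<Prod>j\<in>I-I'. x ^ card (S j) - (\<Prod>k\<in>S j. c k))"
    proof (rule prod.cong[OF refl])
      fix j assume j: "j \<in> I - I'"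
      obtain k where k: "k \<in> S j" using Sne j by blast
      then have sk: "\<sigma> k = k" using j by (auto simp: I'_def)
      have "{k} = S j" by (rule min) (use j k sk in auto)
      then have "S j = {k}" by simp
      then show "(\<Prod>k\<in>S j. e (\<tau> K k) k) = x ^ card (S j) - (\<Prod>k\<in>S j. c k)"
        using sk by (simp add: e_def \<tau>_def restrict_perm_def)
    qed
    finally have prod: "(\<Prod>k<n. e (\<tau> K k) k) = (\<Prod>j\<in>K. (-1) ^ card (S j) * (\<Prod>k\<in>S j. c k))
      * (\<Prod>j\<in>I'-K. x ^ card (S j)) * (\<Prod>j\<in>I-I'. x ^ card (S j) - (\<Prod>k\<in>S j. c k))" .
    have "signof (\<tau> K) = (\<Prod>j\<in>K. - ((-1) ^ card (S j)) :: complex)"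
      using sign[of K] K I'_sub by (simp add: subset_trans)
    then have "signof (\<tau> K) * (\<Prod>j\<in>K. (-1) ^ card (S j) * (\<Prod>k\<in>S j. c k))
      = (\<Prod>j\<in>K. - ((-1) ^ card (S j)) * ((-1) ^ card (S j) * (\<Prod>k\<in>S j. c k)))"
      by (simp only: prod.distrib)
    also have "\<dots> = (\<Prod>j\<in>K. - (\<Prod>k\<in>S j. c k))"
      by (intro prod.cong refl) (simp add: minus_one_power_iff)
    finally show "signof (\<tau> K) * (\<Prod>k<n. e (\<tau> K k) k) = (\<Prod>j\<in>K. - (\<Prod>k\<in>S j. c k)) * (\<Prod>j\<in>I'-K. x ^ card (S j))
       * (\<Prod>j\<in>I-I'. x ^ card (S j) - (\<Prod>k\<in>S j. c k))"
      unfolding prod by (simp add: mult.assoc)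
  qed
  also have "\<dots> = (\<Prod>j\<in>I'. - (\<Prod>k\<in>S j. c k) + x ^ card (S j))
      * (\<Prod>j\<in>I-I'. x ^ card (S j) - (\<Prod>k\<in>S j. c k))"
    by (subst prod_add[OF finite_subset[OF I'_sub finI]]) (rule sum_distrib_right[symmetric])
  also have "\<dots> = (\<Prod>j\<in>I. x ^ card (S j) - (\<Prod>k\<in>S j. c k))"
    by (subst prod.subset_diff[OF I'_sub finI, of "\<lambda>j. x ^ card (S j) - (\<Prod>k\<in>S j. c k)"])
      (simp add: mult.commute)
  finally show ?thesis unfolding A_def I_def .
qed

section \<open>Cycles of the permutation generated by points\<close>

lemma ccw_dist_props:
  assumes "s \<in> {0<..L}" "t \<in> {0<..L}" "s \<noteq> t"
  shows "0 < ccw_dist L s t" "ccw_dist L s t < L" "ccw_dist L s t + ccw_dist L t s = L"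
  using assms by (auto simp: ccw_dist_def)

lemma ccw_dist_inj:
  assumes "s \<in> {0<..L}" "t \<in> {0<..L}" "t' \<in> {0<..L}" "ccw_dist L s t = ccw_dist L s t'"
  shows "t = t'"
  using assms by (auto simp: ccw_dist_def split: if_splits)

lemma ccw_dist_between:
  assumes "s \<in> {0<..L}" "t \<in> {0<..L}" "t' \<in> {0<..L}" "s \<noteq> t'"
    "ccw_dist L s t < ccw_dist L s t'"
  shows "ccw_dist L t t' = ccw_dist L s t' - ccw_dist L s t"
  using assms by (auto simp: ccw_dist_def split: if_splits)

text \<open>The interval \<open>(0, L]\<close> parametrises the circle as well as \<open>[0, L)\<close>; its bounds are those that
  follow from countably many null events.\<close>

definition distinct_points :: "(nat \<Rightarrow> real) \<Rightarrow> (nat \<Rightarrow> nat \<times> real) \<Rightarrow> bool" where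
  "distinct_points y x \<longleftrightarrow> inj x \<and> (\<forall>k. snd (x k) \<in> {0<..y (fst (x k))})"

text \<open>Distinct points of a circle lie at distinct distances from a given one, so the successor is the
  unique minimiser.\<close>

lemma gen_perm_props:
  fixes y x n k
  defines "L \<equiv> y (fst (x k))" and "C \<equiv> on_circle x n (fst (x k))" and "m \<equiv> gen_perm y x n k"
  assumes good: "distinct_points y x" and k: "k < n"
  shows "m \<in> C" and "C = {k} \<Longrightarrow> m = k" and "C \<noteq> {k} \<Longrightarrow> m \<noteq> k"
    and "l \<in> C \<Longrightarrow> l \<noteq> k \<Longrightarrow> l \<noteq> m \<Longrightarrow>
      ccw_dist L (snd (x k)) (snd (x m)) < ccw_dist L (snd (x k)) (snd (x l))"
proof -
  define S where "S = {l. l < n \<and> l \<noteq> k \<and> fst (x l) = fst (x k)}"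
  define d where "d = (\<lambda>l. ccw_dist L (snd (x k)) (snd (x l)))"
  have C: "C = insert k S" using k by (auto simp: C_def S_def on_circle_def)
  have m: "m = (if S = {} then k else arg_min_on d S)"
    unfolding m_def gen_perm_def Let_def S_def d_def L_def by (rule refl)
  have finS: "finite S" by (simp add: S_def)
  have kS: "k \<notin> S" by (simp add: S_def)
  have mS: "m \<in> S" "\<And>l. l \<in> S \<Longrightarrow> d m \<le> d l" if "S \<noteq> {}"
    using that m arg_min_if_finite[OF finS that, of d] by (auto simp: not_less)
  show "m \<in> C" using C m mS by auto
  show "m = k" if "C = {k}" using that C kS m by auto
  show "m \<noteq> k" if "C \<noteq> {k}" using that C mS kS by auto
  show "ccw_dist L (snd (x k)) (snd (x m)) < ccw_dist L (snd (x k)) (snd (x l))"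
    if "l \<in> C" "l \<noteq> k" "l \<noteq> m"
  proof -
    have l: "l \<in> S" using that C by auto
    then have m': "m \<in> S" "d m \<le> d l" using mS by auto
    have "d m \<noteq> d l"
    proof
      assume eq: "d m = d l"
      have fst: "fst (x l) = fst (x k)" "fst (x m) = fst (x k)" using l m' by (auto simp: S_def)
      have r: "snd (x i) \<in> {0<..L}" if "fst (x i) = fst (x k)" for i
        using good that unfolding distinct_points_def L_def by metis
      have "snd (x m) = snd (x l)"
        using ccw_dist_inj[OF r r r, of k m l] fst eq by (simp add: d_def)
      then have "x m = x l" using fst by (simp add: prod_eq_iff)
      then show False using good that unfolding distinct_points_def by (auto dest: injD)
    qed
    then show ?thesis using m' by (simp add: d_def)
  qed
qed

text \<open>Two points with a common successor would each have to be met after the other one. If a proper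
  non-empty subset \<open>T\<close> of the points on a circle were invariant, consider \<open>t \<in> T\<close> and \<open>s \<notin> T\<close> at minimal
  counterclockwise distance from \<open>t\<close> to \<open>s\<close>: the successor of \<open>t\<close> lies strictly between them and
  belongs to \<open>T\<close>, a contradiction.\<close>

lemma cyclic_on_gen_perm:
  assumes good: "distinct_points y x"
  shows "cyclic_on (gen_perm y x n) (on_circle x n j)"
proof -
  define C where "C = on_circle x n j"
  define f where "f = gen_perm y x n"
  define d where "d = (\<lambda>k l. ccw_dist (y j) (snd (x k)) (snd (x l)))"
  have mem: "k < n" "fst (x k) = j" if "k \<in> C" for k using that by (auto simp: C_def on_circle_def)
  have r: "snd (x k) \<in> {0<..y j}" if "k \<in> C" for k
    using good mem[OF that] unfolding distinct_points_def by metis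
  have ne: "snd (x k) \<noteq> snd (x l)" if "k \<in> C" "l \<in> C" "k \<noteq> l" for k l
  proof
    assume "snd (x k) = snd (x l)"
    then have "x k = x l" using mem that by (simp add: prod_eq_iff)
    then show False using good that unfolding distinct_points_def by (auto dest: injD)
  qed
  have fC: "f k \<in> C" if "k \<in> C" for k
    using gen_perm_props(1)[OF good mem(1)[OF that]] mem(2)[OF that] by (simp add: f_def C_def)
  have fne: "f k \<noteq> k" if "k \<in> C" "l \<in> C" "l \<noteq> k" for k l
    using gen_perm_props(3)[OF good mem(1)[OF that(1)]] mem(2)[OF that(1)] that
    by (auto simp: f_def C_def)
  have fmin: "d k (f k) < d k l" if "k \<in> C" "l \<in> C" "l \<noteq> k" "l \<noteq> f k" for k l
    using gen_perm_props(4)[OF good mem(1)[OF that(1)], of l] mem(2)[OF that(1)] that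
    by (simp add: f_def C_def d_def)
  have between: "d t l = d k l - d k t" if "k \<in> C" "l \<in> C" "t \<in> C" "k \<noteq> l" "d k t < d k l" for k l t
    using ccw_dist_between[OF r r r, of k t l] ne that by (simp add: d_def)
  have pos: "0 < d k l" "d k l + d l k = y j" if "k \<in> C" "l \<in> C" "k \<noteq> l" for k l
    using ccw_dist_props[OF r r ne, of k l] that by (simp_all add: d_def)
  have inj: "inj_on f C"
  proof (rule inj_onI, rule ccontr)
    fix k l assume kl: "k \<in> C" "l \<in> C" "f k = f l" "k \<noteq> l"
    define m where "m = f k"
    have m: "m \<in> C" "m \<noteq> k" "m \<noteq> l" "m = f l"
      using fC fne[OF kl(1,2)] fne[OF kl(2,1)] kl by (auto simp: m_def)
    have 1: "d k m < d k l" using fmin[OF kl(1,2)] kl m by (simp add: m_def)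
    have 2: "d l m < d l k" using fmin[OF kl(2,1)] kl m by (simp add: m_def)
    have "d m l = d k l - d k m" by (rule between) (use 1 kl m in auto)
    moreover have "d m l + d l m = y j" "d k l + d l k = y j" "0 < d k m"
      using pos kl m by auto
    ultimately show False using 2 by linarith
  qed
  have min: "T = C" if T: "T \<subseteq> C" "T \<noteq> {}" "f ` T \<subseteq> T" for T
  proof (rule ccontr)
    assume "T \<noteq> C"
    then have "C - T \<noteq> {}" using T by auto
    define Q where "Q = T \<times> (C - T)"
    have "finite Q" using finite_subset[OF T(1)] by (simp add: Q_def C_def on_circle_def)
    moreover have "Q \<noteq> {}" using T \<open>C - T \<noteq> {}\<close> by (simp add: Q_def)
    ultimately obtain p where p: "p \<in> Q" "\<And>q. q \<in> Q \<Longrightarrow> d (fst p) (snd p) \<le> d (fst q) (snd q)"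
      using arg_min_if_finite[of Q "\<lambda>q. d (fst q) (snd q)"] by (metis not_less)
    define t where "t = fst p"
    define s where "s = snd p"
    have ts: "t \<in> T" "s \<in> C" "s \<notin> T" "t \<in> C" using p T by (auto simp: Q_def t_def s_def)
    have ft: "f t \<in> T" "f t \<in> C" using T ts fC by auto
    have "f t \<noteq> t" using fne[of t s] ts by auto
    have less: "d t (f t) < d t s" using fmin[of t s] ts ft by auto
    have "d (f t) s = d t s - d t (f t)" by (rule between) (use less ts ft in auto)
    moreover have "0 < d t (f t)" using pos ts ft \<open>f t \<noteq> t\<close> by metis
    moreover have "d t s \<le> d (f t) s"
      using p(2)[of "(f t, s)"] ft ts by (simp add: Q_def t_def s_def)
    ultimately show False by linarith
  qed
  show ?thesis
    unfolding cyclic_on_def using inj fC min by (auto simp: C_def f_def)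
qed

section \<open>Stability of the infinite product\<close>

lemma norm_prod_le_exp:
  fixes x :: "nat \<Rightarrow> complex"
  shows "norm (\<Prod>j<n. x j) \<le> exp (\<Sum>j<n. norm (x j - 1))"
proof -
  have "norm (\<Prod>j<n. x j) = (\<Prod>j<n. norm (x j))" by (simp add: prod_norm)
  also have "\<dots> \<le> (\<Prod>j<n. exp (norm (x j - 1)))"
  proof (rule prod_mono)
    fix j assume "j \<in> {..<n}"
    have "norm (x j) \<le> 1 + norm (x j - 1)" using norm_triangle_ineq[of 1 "x j - 1"] by simp
    also have "\<dots> \<le> exp (norm (x j - 1))" by (rule exp_ge_add_one_self)
    finally show "0 \<le> norm (x j) \<and> norm (x j) \<le> exp (norm (x j - 1))" by simp
  qed
  finally show ?thesis by (simp add: exp_sum)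
qed

text \<open>The factors are exchanged one at a time; the exponential bounds all mixed partial products, so the
  estimate survives the passage to infinitely many factors.\<close>

lemma norm_prod_diff_le_exp:
  fixes x w :: "nat \<Rightarrow> complex"
  shows "norm ((\<Prod>j<n. x j) - (\<Prod>j<n. w j))
    \<le> exp ((\<Sum>j<n. norm (x j - 1)) + (\<Sum>j<n. norm (w j - 1))) * (\<Sum>j<n. norm (x j - w j))"
proof (induction n)
  case (Suc n)
  define X where "X = (\<Prod>j<n. x j)" define W where "W = (\<Prod>j<n. w j)"
  define a where "a = (\<Sum>j<n. norm (x j - 1))" define b where "b = (\<Sum>j<n. norm (w j - 1))"
  define c where "c = (\<Sum>j<n. norm (x j - w j))"
  have nn: "0 \<le> a" "0 \<le> b" "0 \<le> c" by (auto simp: a_def b_def c_def sum_nonneg)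
  have xn: "norm (x n) \<le> exp (norm (x n - 1))"
    using norm_prod_le_exp[of "\<lambda>_. x n" 1] by simp
  have X: "norm W \<le> exp b" unfolding W_def b_def by (rule norm_prod_le_exp)
  have "norm (X * x n - W * w n) = norm ((X - W) * x n + W * (x n - w n))" by (simp add: algebra_simps)
  also have "\<dots> \<le> norm (X - W) * norm (x n) + norm W * norm (x n - w n)"
    by (metis norm_mult norm_triangle_ineq)
  also have "\<dots> \<le> (exp (a + b) * c) * exp (norm (x n - 1)) + exp b * norm (x n - w n)"
    using Suc.IH xn X nn by (intro add_mono mult_mono) (auto simp: X_def W_def a_def b_def c_def)
  also have "\<dots> \<le> exp (a + b + norm (x n - 1) + norm (w n - 1)) * c
       + exp (a + b + norm (x n - 1) + norm (w n - 1)) * norm (x n - w n)"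
  proof (intro add_mono mult_right_mono)
    have "(exp (a + b) * c) * exp (norm (x n - 1)) = exp (a + b + norm (x n - 1)) * c"
      by (simp add: exp_add)
    also have "\<dots> \<le> exp (a + b + norm (x n - 1) + norm (w n - 1)) * c"
      using nn by (intro mult_right_mono) auto
    finally show "exp (a + b) * c * exp (norm (x n - 1))
      \<le> exp (a + b + norm (x n - 1) + norm (w n - 1)) * c" .
  qed (use nn in auto)
  finally show ?case by (simp add: X_def W_def a_def b_def c_def algebra_simps)
qed simp

lemma norm_prodinf_diff_le_exp:
  fixes x w :: "nat \<Rightarrow> complex"
  assumes sx: "summable (\<lambda>j. norm (x j - 1))" and sw: "summable (\<lambda>j. norm (w j - 1))"
  shows "norm ((\<Prod>j. x j) - (\<Prod>j. w j))
    \<le> exp ((\<Sum>j. norm (x j - 1)) + (\<Sum>j. norm (w j - 1))) * (\<Sum>j. norm (x j - w j))"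
proof -
  have cx: "(\<lambda>n. \<Prod>j\<le>n. x j) \<longlonglongrightarrow> (\<Prod>j. x j)"
    using sx by (intro convergent_prod_LIMSEQ abs_convergent_prod_imp_convergent_prod
        summable_imp_abs_convergent_prod)
  have cw: "(\<lambda>n. \<Prod>j\<le>n. w j) \<longlonglongrightarrow> (\<Prod>j. w j)"
    using sw by (intro convergent_prod_LIMSEQ abs_convergent_prod_imp_convergent_prod
        summable_imp_abs_convergent_prod)
  have sd: "summable (\<lambda>j. norm (x j - w j))"
  proof (rule summable_comparison_test'[OF summable_add[OF sx sw]])
    show "norm (norm (x j - w j)) \<le> norm (x j - 1) + norm (w j - 1)" for j
      using norm_triangle_ineq4[of "x j - 1" "w j - 1"] by simp
  qed
  have "norm ((\<Prod>j<Suc n. x j) - (\<Prod>j<Suc n. w j))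
    \<le> exp ((\<Sum>j. norm (x j - 1)) + (\<Sum>j. norm (w j - 1))) * (\<Sum>j. norm (x j - w j))" for n
  proof (rule order.trans[OF norm_prod_diff_le_exp], rule mult_mono)
    show "exp ((\<Sum>j<Suc n. norm (x j - 1)) + (\<Sum>j<Suc n. norm (w j - 1)))
      \<le> exp ((\<Sum>j. norm (x j - 1)) + (\<Sum>j. norm (w j - 1)))"
      by (intro exp_le_cancel_iff[THEN iffD2] add_mono sum_le_suminf sx sw) auto
    show "(\<Sum>j<Suc n. norm (x j - w j)) \<le> (\<Sum>j. norm (x j - w j))"
      by (intro sum_le_suminf sd) auto
    show "0 \<le> (\<Sum>j<Suc n. norm (x j - w j))" by (rule sum_nonneg) auto
  qed auto
  then show ?thesis
    using tendsto_le[OF _ tendsto_const tendsto_norm[OF tendsto_diff[OF cx cw]]]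
    by (auto simp: lessThan_Suc_atMost)
qed

lemma norm_exp_diff_le:
  fixes z :: complex and a b :: real
  assumes "a \<in> {0..1}" "b \<in> {0..1}" "norm z \<le> R"
  shows "norm (exp (2 * \<i> * of_real pi * z * of_real a) - exp (2 * \<i> * of_real pi * z * of_real b))
    \<le> 2 * pi * R * exp (2 * pi * R) * \<bar>a - b\<bar>"
proof -
  define c where "c = 2 * \<i> * of_real pi * z"
  have nc: "norm c \<le> 2 * pi * R" using assms by (simp add: c_def norm_mult)
  have "norm (exp (c * of_real a) - exp (c * of_real b))
    \<le> (norm c * exp (norm c)) * norm (complex_of_real a - of_real b)"
  proof (rule field_differentiable_bound[of "closed_segment (of_real b) (of_real a)"
        "\<lambda>t. exp (c * t)" "\<lambda>t. c * exp (c * t)"])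
    fix t assume t: "t \<in> closed_segment (complex_of_real b) (complex_of_real a)"
    show "((\<lambda>t. exp (c * t)) has_field_derivative c * exp (c * t))
      (at t within closed_segment (of_real b) (of_real a))"
      by (auto intro!: derivative_eq_intros)
    have "closed_segment (complex_of_real b) (complex_of_real a) \<subseteq> cball 0 1"
      using assms by (intro closed_segment_subset) auto
    then have "norm t \<le> 1" using t by auto
    then have "norm (c * t) \<le> norm c" by (simp add: norm_mult mult_left_le)
    then show "norm (c * exp (c * t)) \<le> norm c * exp (norm c)"
      using norm_exp[of "c * t"] by (simp add: norm_mult mult_left_mono order.trans)
  qed auto
  also have "\<dots> \<le> (2 * pi * R * exp (2 * pi * R)) * \<bar>a - b\<bar>"
    using nc order.trans[OF norm_ge_zero nc] by (intro mult_mono) (auto simp flip: of_real_diff)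
  finally show ?thesis by (simp add: c_def)
qed

lemma xi_factor_0 [simp]: "y j = 0 \<Longrightarrow> u j \<noteq> 1 \<Longrightarrow> xi_factor y u z j = 1"
  by (simp add: xi_factor_def)

lemma xi_factor_minus_1:
  "u j \<noteq> 1 \<Longrightarrow> xi_factor y u z j - 1 = (exp (2 * \<i> * of_real pi * z * of_real (y j)) - 1) / (1 - u j)"
  by (simp add: xi_factor_def field_simps)

lemma norm_xi_factor_minus_1:
  assumes "y j \<in> {0..1}" "norm z \<le> R" "u j \<noteq> 1"
  shows "norm (xi_factor y u z j - 1) \<le> 2 * pi * R * exp (2 * pi * R) * (y j / norm (1 - u j))"
  using norm_exp_diff_le[of "y j" 0 z R] assms
  by (simp add: xi_factor_minus_1 norm_divide divide_right_mono)

text \<open>Up to a constant depending on \<open>z\<close>, an upper bound for the distance of the \<open>j\<close>-th factor to \<open>1\<close>.\<close>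

definition xi_mass :: "(nat \<Rightarrow> real) \<Rightarrow> (nat \<Rightarrow> complex) \<Rightarrow> nat \<Rightarrow> real" where
  "xi_mass y u j = y j / norm (1 - u j)"

text \<open>Up to a constant depending on \<open>z\<close>, an upper bound for the distance between the \<open>j\<close>-th factors
  for the parameters \<open>(a, v)\<close> and \<open>(y, u)\<close>. The weight \<open>a j\<close> of the second term makes the phase irrelevant on circles
  without points.\<close>

definition xi_gap :: "(nat \<Rightarrow> real) \<Rightarrow> (nat \<Rightarrow> complex) \<Rightarrow> (nat \<Rightarrow> real) \<Rightarrow> (nat \<Rightarrow> complex) \<Rightarrow> nat \<Rightarrow> real" where
  "xi_gap a v y u j = \<bar>a j - y j\<bar> / norm (1 - u j) + a j * norm (1 / (1 - v j) - 1 / (1 - u j))"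

definition xi_const :: "real \<Rightarrow> real" where
  "xi_const R = 2 * pi * R * exp (2 * pi * R)"

definition xi_params :: "(nat \<Rightarrow> real) \<Rightarrow> (nat \<Rightarrow> complex) \<Rightarrow> bool" where
  "xi_params y u \<longleftrightarrow> (\<forall>j. y j \<in> {0..1} \<and> u j \<noteq> 1) \<and> summable (xi_mass y u)"

lemma xi_const_nonneg: "0 \<le> R \<Longrightarrow> 0 \<le> xi_const R"
  by (simp add: xi_const_def)

lemma xi_factor_summable:
  assumes "xi_params y u"
  shows "summable (\<lambda>j. norm (xi_factor y u z j - 1))"
    and "(\<Sum>j. norm (xi_factor y u z j - 1)) \<le> xi_const (norm z) * (\<Sum>j. xi_mass y u j)"
proof -
  have b: "norm (xi_factor y u z j - 1) \<le> xi_const (norm z) * xi_mass y u j" for j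
    unfolding xi_const_def xi_mass_def
    by (rule norm_xi_factor_minus_1) (use assms in \<open>auto simp: xi_params_def\<close>)
  have s: "summable (\<lambda>j. xi_const (norm z) * xi_mass y u j)"
    using assms by (intro summable_mult) (auto simp: xi_params_def)
  show 1: "summable (\<lambda>j. norm (xi_factor y u z j - 1))"
    by (rule summable_comparison_test'[OF s]) (use b in auto)
  show "(\<Sum>j. norm (xi_factor y u z j - 1)) \<le> xi_const (norm z) * (\<Sum>j. xi_mass y u j)"
    using suminf_le[OF b 1 s] suminf_mult[of "xi_mass y u"] assms by (simp add: xi_params_def)
qed

lemma convergent_prod_xi_factor:
  assumes "xi_params y u"
  shows "convergent_prod (xi_factor y u z)"
  using xi_factor_summable(1)[OF assms]
  by (intro abs_convergent_prod_imp_convergent_prod summable_imp_abs_convergent_prod)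

text \<open>The first term of the gap comes from changing the perimeter over the denominator \<open>1 - u j\<close>, the
  second one from changing the denominator at the perimeter \<open>a j\<close>.\<close>

lemma norm_xi_factor_diff_le_gap:
  assumes "a j \<in> {0..1}" "y j \<in> {0..1}" "v j \<noteq> 1" "u j \<noteq> 1"
  shows "norm (xi_factor a v z j - xi_factor y u z j) \<le> xi_const (norm z) * xi_gap a v y u j"
proof -
  define E where "E = (\<lambda>t::real. exp (2 * \<i> * of_real pi * z * of_real t))"
  have "xi_factor a v z j - xi_factor y u z j = (xi_factor a v z j - 1) - (xi_factor y u z j - 1)"
    by simp
  also have "\<dots> = (E (a j) - 1) / (1 - v j) - (E (y j) - 1) / (1 - u j)"
    using assms by (simp add: xi_factor_minus_1 E_def)
  also have "\<dots> = (E (a j) - E (y j)) / (1 - u j) + (E (a j) - E 0) * (1 / (1 - v j) - 1 / (1 - u j))"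
    by (simp add: E_def diff_divide_distrib right_diff_distrib)
  also have "norm \<dots> \<le> norm (E (a j) - E (y j)) / norm (1 - u j)
      + norm (E (a j) - E 0) * norm (1 / (1 - v j) - 1 / (1 - u j))"
    by (rule order.trans[OF norm_triangle_ineq]) (simp add: norm_divide norm_mult)
  also have "\<dots> \<le> (xi_const (norm z) * \<bar>a j - y j\<bar>) / norm (1 - u j)
      + (xi_const (norm z) * \<bar>a j - 0\<bar>) * norm (1 / (1 - v j) - 1 / (1 - u j))"
    unfolding E_def xi_const_def using assms
    by (intro add_mono divide_right_mono mult_right_mono norm_exp_diff_le) auto
  also have "\<dots> = xi_const (norm z) * xi_gap a v y u j"
    using assms by (simp add: xi_gap_def algebra_simps)
  finally show ?thesis .
qed

lemma xi_gap_nonneg: "0 \<le> a j \<Longrightarrow> 0 \<le> xi_gap a v y u j"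
  by (simp add: xi_gap_def)

lemma xi_mass_le_gap:
  assumes "0 \<le> a j" "0 \<le> y j"
  shows "xi_mass a v j \<le> xi_mass y u j + xi_gap a v y u j"
proof -
  have "a j * norm (1 / (1 - v j)) \<le> a j * (norm (1 / (1 - u j)) + norm (1 / (1 - v j) - 1 / (1 - u j)))"
    using assms norm_triangle_sub by (intro mult_left_mono) auto
  moreover have "a j * norm (1 / (1 - u j)) \<le> (y j + \<bar>a j - y j\<bar>) * norm (1 / (1 - u j))"
    by (intro mult_right_mono) auto
  ultimately show ?thesis
    by (simp add: xi_mass_def xi_gap_def norm_divide algebra_simps add_divide_distrib)
qed

lemma xi_params_gap:
  assumes y: "xi_params y u" and g: "summable (xi_gap a v y u)"
    and av: "\<And>j. a j \<in> {0..1}" "\<And>j. v j \<noteq> 1"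
  shows "xi_params a v" "(\<Sum>j. xi_mass a v j) \<le> (\<Sum>j. xi_mass y u j) + (\<Sum>j. xi_gap a v y u j)"
proof -
  have m: "xi_mass a v j \<le> xi_mass y u j + xi_gap a v y u j" for j
    by (rule xi_mass_le_gap) (use av y in \<open>auto simp: xi_params_def\<close>)
  have s: "summable (xi_mass y u)" using y by (simp add: xi_params_def)
  have nn: "0 \<le> xi_mass a v j" for j using av(1)[of j] by (simp add: xi_mass_def)
  have sa: "summable (xi_mass a v)"
    by (rule summable_comparison_test'[OF summable_add[OF s g]]) (use m nn in auto)
  then show "xi_params a v" using av by (simp add: xi_params_def)
  show "(\<Sum>j. xi_mass a v j) \<le> (\<Sum>j. xi_mass y u j) + (\<Sum>j. xi_gap a v y u j)"
    using suminf_le[OF m sa summable_add[OF s g]] suminf_add[OF s g] by simp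
qed

lemma norm_xi_infinity_diff_le:
  assumes y: "xi_params y u" and g: "summable (xi_gap a v y u)"
    and av: "\<And>j. a j \<in> {0..1}" "\<And>j. v j \<noteq> 1" and z: "norm z \<le> R"
  shows "norm (xi_infinity a v z - xi_infinity y u z)
    \<le> exp (xi_const R * (2 * (\<Sum>j. xi_mass y u j) + (\<Sum>j. xi_gap a v y u j)))
       * (xi_const R * (\<Sum>j. xi_gap a v y u j))"
proof -
  note a = xi_params_gap[OF y g av]
  have R: "0 \<le> R" using z norm_ge_zero order.trans by blast
  have cR: "xi_const (norm z) \<le> xi_const R" "0 \<le> xi_const (norm z)"
    using z R unfolding xi_const_def by (auto intro!: mult_mono)
  have b: "norm (xi_factor a v z j - xi_factor y u z j) \<le> xi_const R * xi_gap a v y u j" for j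
  proof -
    have "norm (xi_factor a v z j - xi_factor y u z j) \<le> xi_const (norm z) * xi_gap a v y u j"
      by (rule norm_xi_factor_diff_le_gap) (use y av in \<open>auto simp: xi_params_def\<close>)
    also have "\<dots> \<le> xi_const R * xi_gap a v y u j"
      using av(1)[of j] cR by (intro mult_right_mono xi_gap_nonneg) auto
    finally show ?thesis .
  qed
  have nnm: "0 \<le> (\<Sum>j. xi_mass y u j)"
    using y by (intro suminf_nonneg) (auto simp: xi_params_def, simp add: xi_mass_def)
  have nna: "0 \<le> (\<Sum>j. xi_mass a v j)"
    using a(1) by (intro suminf_nonneg) (auto simp: xi_params_def, simp add: xi_mass_def)
  have nng: "0 \<le> (\<Sum>j. xi_gap a v y u j)"
    using av(1) g by (intro suminf_nonneg xi_gap_nonneg) auto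
  have "norm (xi_infinity a v z - xi_infinity y u z)
    \<le> exp ((\<Sum>j. norm (xi_factor a v z j - 1)) + (\<Sum>j. norm (xi_factor y u z j - 1)))
       * (\<Sum>j. norm (xi_factor a v z j - xi_factor y u z j))"
    unfolding xi_infinity_def
    by (rule norm_prodinf_diff_le_exp[OF xi_factor_summable(1)[OF a(1)] xi_factor_summable(1)[OF y]])
  also have "\<dots> \<le> exp (xi_const R * (2 * (\<Sum>j. xi_mass y u j) + (\<Sum>j. xi_gap a v y u j)))
       * (xi_const R * (\<Sum>j. xi_gap a v y u j))"
  proof (rule mult_mono)
    have "(\<Sum>j. norm (xi_factor a v z j - 1)) + (\<Sum>j. norm (xi_factor y u z j - 1))
      \<le> xi_const (norm z) * (\<Sum>j. xi_mass a v j) + xi_const (norm z) * (\<Sum>j. xi_mass y u j)"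
      by (intro add_mono xi_factor_summable a(1) y)
    also have "\<dots> \<le> xi_const R * ((\<Sum>j. xi_mass y u j) + (\<Sum>j. xi_gap a v y u j)) + xi_const R * (\<Sum>j. xi_mass y u j)"
      by (intro add_mono mult_mono a(2)) (use cR nnm nna nng in auto)
    finally show "exp ((\<Sum>j. norm (xi_factor a v z j - 1)) + (\<Sum>j. norm (xi_factor y u z j - 1)))
       \<le> exp (xi_const R * (2 * (\<Sum>j. xi_mass y u j) + (\<Sum>j. xi_gap a v y u j)))"
      by (simp add: algebra_simps)
    have sg: "summable (\<lambda>j. xi_const R * xi_gap a v y u j)" using g by (rule summable_mult)
    have "summable (\<lambda>j. norm (xi_factor a v z j - xi_factor y u z j))"
      by (rule summable_comparison_test'[OF sg]) (use b in auto)
    from suminf_le[OF b this sg]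
    show "(\<Sum>j. norm (xi_factor a v z j - xi_factor y u z j)) \<le> xi_const R * (\<Sum>j. xi_gap a v y u j)"
      using suminf_mult[OF g] by simp
    show "0 \<le> (\<Sum>j. norm (xi_factor a v z j - xi_factor y u z j))"
      using \<open>summable (\<lambda>j. norm (xi_factor a v z j - xi_factor y u z j))\<close> by (intro suminf_nonneg) auto
  qed simp
  finally show ?thesis .
qed

text \<open>The reference parameters may vary with \<open>n\<close>, as they do when the phases are those of a sample;
  only their total mass has to stay bounded.\<close>

lemma xi_infinity_dist_tendsto:
  fixes y :: "nat \<Rightarrow> nat \<Rightarrow> real" and a :: "nat \<Rightarrow> nat \<Rightarrow> real"
  assumes y: "\<And>n. xi_params (y n) (u n)" and S: "\<And>n. (\<Sum>j. xi_mass (y n) (u n) j) \<le> S"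
    and g: "\<And>n. summable (xi_gap (a n) (v n) (y n) (u n))"
    and av: "\<And>n j. a n j \<in> {0..1}" "\<And>n j. v n j \<noteq> 1"
    and lim: "(\<lambda>n. \<Sum>j. xi_gap (a n) (v n) (y n) (u n) j) \<longlonglongrightarrow> 0" and e: "0 < e"
  shows "eventually (\<lambda>n. \<forall>z\<in>cball 0 R. dist (xi_infinity (a n) (v n) z) (xi_infinity (y n) (u n) z) < e) sequentially"
proof -
  define G where "G = (\<lambda>n. \<Sum>j. xi_gap (a n) (v n) (y n) (u n) j)"
  have "(\<lambda>n. exp (xi_const R * (2 * S + G n)) * (xi_const R * G n))
      \<longlonglongrightarrow> exp (xi_const R * (2 * S + 0)) * (xi_const R * 0)"
    unfolding G_def by (intro tendsto_intros lim)
  then have "eventually (\<lambda>n. exp (xi_const R * (2 * S + G n)) * (xi_const R * G n) < e) sequentially"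
    using order_tendstoD(2) e by fastforce
  then show ?thesis
  proof eventually_elim
    case (elim n)
    show ?case
    proof
      fix z :: complex assume z: "z \<in> cball 0 R"
      then have R: "0 \<le> R" using norm_ge_zero[of z] by (auto simp del: norm_ge_zero)
      have G0: "0 \<le> G n" unfolding G_def using av g by (intro suminf_nonneg xi_gap_nonneg) auto
      have "norm (xi_infinity (a n) (v n) z - xi_infinity (y n) (u n) z)
        \<le> exp (xi_const R * (2 * (\<Sum>j. xi_mass (y n) (u n) j) + G n)) * (xi_const R * G n)"
        unfolding G_def by (rule norm_xi_infinity_diff_le) (use assms z in auto)
      also have "\<dots> \<le> exp (xi_const R * (2 * S + G n)) * (xi_const R * G n)"
        using S[of n] G0 xi_const_nonneg[OF R]
        by (intro mult_right_mono) (auto intro!: mult_left_mono)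
      finally show "dist (xi_infinity (a n) (v n) z) (xi_infinity (y n) (u n) z) < e"
        using elim by (simp add: dist_norm)
    qed
  qed
qed

lemma xi_infinity_finite:
  assumes "finite I" "\<And>j. j \<notin> I \<Longrightarrow> a j = 0 \<and> v j \<noteq> 1"
  shows "xi_infinity a v z = (\<Prod>j\<in>I. xi_factor a v z j)"
  unfolding xi_infinity_def using assms by (intro prodinf_finite) auto

text \<open>Truncating the perimeters gives finite products, and the gap to the full sequence is a tail of the
  mass.\<close>

lemma xi_infinity_holomorphic:
  assumes y: "xi_params y u"
  shows "xi_infinity y u holomorphic_on UNIV"
proof (rule holomorphic_uniform_sequence[OF open_UNIV])
  define a where "a = (\<lambda>(n::nat) j. if j < n then y j else 0)"
  have fin: "xi_infinity (a n) u = (\<lambda>z. \<Prod>j<n. xi_factor (a n) u z j)" for n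
    using y by (intro ext xi_infinity_finite) (auto simp: a_def xi_params_def)
  show "xi_infinity (a n) u holomorphic_on UNIV" for n
    unfolding fin xi_factor_def using y by (intro holomorphic_intros) (auto simp: xi_params_def)
  have gap: "xi_gap (a n) u y u = (\<lambda>j. if j < n then 0 else xi_mass y u j)" for n
    using y by (auto simp: fun_eq_iff xi_gap_def a_def xi_mass_def xi_params_def)
  have s: "summable (xi_mass y u)" using y by (simp add: xi_params_def)
  have sg: "summable (xi_gap (a n) u y u)" for n
    unfolding gap by (rule summable_comparison_test'[OF s]) (use y in \<open>auto simp: xi_mass_def xi_params_def\<close>)
  have eq: "(\<Sum>j. xi_gap (a n) u y u j) = (\<Sum>j. xi_mass y u (j + n))" for n
    using suminf_split_initial_segment[OF sg[of n], of n] by (simp add: gap)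
  have lim: "(\<lambda>n. \<Sum>j. xi_gap (a n) u y u j) \<longlonglongrightarrow> 0"
    unfolding eq using s by (rule suminf_exist_split2)
  have ul: "uniform_limit (cball 0 R) (\<lambda>n. xi_infinity (a n) u) (xi_infinity y u) sequentially" for R
    unfolding uniform_limit_iff
    by (intro allI impI xi_infinity_dist_tendsto[where S="\<Sum>j. xi_mass y u j"])
      (use y sg lim in \<open>auto simp: a_def xi_params_def\<close>)
  show "\<exists>d>0. cball z d \<subseteq> UNIV \<and> uniform_limit (cball z d) (\<lambda>n. xi_infinity (a n) u) (xi_infinity y u) sequentially" for z
  proof (intro exI[of _ 1] conjI)
    have "cball z 1 \<subseteq> cball 0 (norm z + 1)"
      by (simp add: cball_subset_cball_iff)
    then show "uniform_limit (cball z 1) (\<lambda>n. xi_infinity (a n) u) (xi_infinity y u) sequentially"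
      using ul uniform_limit_on_subset by blast
  qed auto
qed

section \<open>Characteristic polynomials as infinite products\<close>

definition circle_freq :: "nat \<Rightarrow> nat list \<Rightarrow> nat \<Rightarrow> real" where
  "circle_freq n xs j = real (count_list xs j) / real n"

text \<open>The factor of a circle without points is \<open>1\<close> for any phase; the value \<open>- 1\<close> keeps the phase of such
  a circle away from \<open>1\<close>.\<close>

definition circle_phase :: "real \<Rightarrow> nat list \<Rightarrow> nat \<Rightarrow> complex" where
  "circle_phase \<alpha> xs j = (if count_list xs j = 0 then - 1 else cis (- (2 * pi * \<alpha> * real (count_list xs j))))"

abbreviation xi_list :: "real \<Rightarrow> nat \<Rightarrow> nat list \<Rightarrow> complex \<Rightarrow> complex" where
  "xi_list \<alpha> n xs \<equiv> xi_infinity (circle_freq n xs) (circle_phase \<alpha> xs)"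

definition circle_labels :: "(nat \<Rightarrow> nat \<times> real) \<Rightarrow> nat \<Rightarrow> nat list" where
  "circle_labels x n = map (\<lambda>k. fst (x k)) [0..<n]"

lemma card_on_circle: "card (on_circle x n j) = count_list (circle_labels x n) j"
proof (induction n)
  case (Suc n)
  have "on_circle x (Suc n) j = (if fst (x n) = j then insert n (on_circle x n j) else on_circle x n j)"
    by (auto simp: on_circle_def less_Suc_eq)
  then show ?case using Suc by (simp add: circle_labels_def on_circle_def)
qed (simp add: circle_labels_def on_circle_def)

lemma count_list_le_length': "count_list xs j \<le> length xs"
  by (induction xs) auto

lemma circle_freq_unit: "length xs = n \<Longrightarrow> circle_freq n xs j \<in> {0..1}"
  using count_list_le_length'[of xs j] by (cases "n = 0") (auto simp: circle_freq_def)

lemma exp_over_n_power: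
  assumes "n > 0"
  shows "exp (2 * \<i> * of_real pi * z / of_nat n) ^ k = exp (2 * \<i> * of_real pi * z * of_real (real k / real n))"
  by (simp add: exp_of_nat_mult[symmetric] mult_ac)

lemma det_gen_perm:
  assumes good: "distinct_points y x"
  shows "Determinant.det (t \<cdot>\<^sub>m 1\<^sub>m n - weighted_perm_mat n (gen_perm y x n) c)
    = (\<Prod>j\<in>set (circle_labels x n). t ^ count_list (circle_labels x n) j - (\<Prod>k\<in>on_circle x n j. c k))"
proof -
  have img: "(\<lambda>k. fst (x k)) ` {..<n} = set (circle_labels x n)"
    by (simp add: circle_labels_def lessThan_atLeast0)
  show ?thesis
    using det_weighted_perm_mat[of "\<lambda>k. fst (x k)" n "gen_perm y x n" t c]
      cyclic_on_gen_perm[OF good, of n]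
    unfolding img on_circle_def[symmetric] card_on_circle by blast
qed

lemma prod_diff_quotient_eq_xi:
  assumes n: "n > 0" and v: "\<And>j. v j \<noteq> 1"
    and f: "\<And>j. j \<in> set xs \<Longrightarrow> f j = xi_factor (circle_freq n xs) v z j"
  shows "(\<Prod>j\<in>set xs. f j) = xi_infinity (circle_freq n xs) v z"
proof -
  have "xi_infinity (circle_freq n xs) v z = (\<Prod>j\<in>set xs. xi_factor (circle_freq n xs) v z j)"
    by (rule xi_infinity_finite) (auto simp: circle_freq_def count_list_0_iff v)
  then show ?thesis by (simp add: f)
qed

text \<open>The quotient of the two products over the circles is already the limit formula, at the frequencies
  of the circles.\<close>

lemma xi_tilde_eq_xi_infinity:
  assumes n: "n > 0" and good: "distinct_points y x" and u: "\<And>j. u j \<noteq> 1"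
    and T: "A \<in> T_set n"
    and nz: "\<forall>i<n. \<forall>j<n. A $$ (i, j) \<noteq> 0 \<longleftrightarrow> perm_matrix n (gen_perm y x n) $$ (i, j) \<noteq> 0"
    and prod: "\<forall>j. on_circle x n j \<noteq> {} \<longrightarrow> (\<Prod>k\<in>on_circle x n j. A $$ (gen_perm y x n k, k)) = u j"
  shows "xi_tilde n A z = xi_infinity (circle_freq n (circle_labels x n)) u z"
proof -
  define c where "c = (\<lambda>k. A $$ (gen_perm y x n k, k))"
  define xs where "xs = circle_labels x n"
  have dim: "dim_row A = n" "dim_col A = n"
    using T by (auto simp: T_set_def modified_perm_matrix_def)
  have A: "A = weighted_perm_mat n (gen_perm y x n) c"
  proof (rule eq_matI)
    fix i j assume ij: "i < dim_row (weighted_perm_mat n (gen_perm y x n) c)"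
      "j < dim_col (weighted_perm_mat n (gen_perm y x n) c)"
    then have ij: "i < n" "j < n" by (simp_all add: weighted_perm_mat_def)
    show "A $$ (i, j) = weighted_perm_mat n (gen_perm y x n) c $$ (i, j)"
    proof (cases "i = gen_perm y x n j")
      case True then show ?thesis using ij by (simp add: weighted_perm_mat_def c_def)
    next
      case False
      then have "A $$ (i, j) = 0" using nz[rule_format, OF ij] ij by (simp add: perm_matrix_def)
      then show ?thesis using ij False by (simp add: weighted_perm_mat_def)
    qed
  qed (simp_all add: dim weighted_perm_mat_def)
  have det: "Determinant.det (t \<cdot>\<^sub>m 1\<^sub>m n - A) = (\<Prod>j\<in>set xs. t ^ count_list xs j - u j)" for t
  proof -
    have "(\<Prod>k\<in>on_circle x n j. c k) = u j" if "j \<in> set xs" for j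
      using that prod unfolding c_def xs_def circle_labels_def on_circle_def by fastforce
    then show ?thesis unfolding A det_gen_perm[OF good] xs_def[symmetric] by (intro prod.cong) auto
  qed
  have one: "1\<^sub>m n - A = 1 \<cdot>\<^sub>m 1\<^sub>m n - A" by (intro arg_cong2[where f="(-)"]) auto
  have "xi_tilde n A z = (\<Prod>j\<in>set xs. (exp (2 * \<i> * of_real pi * z / of_nat n) ^ count_list xs j - u j) / (1 - u j))"
    unfolding xi_tilde_def by (subst one) (simp add: det prod_dividef)
  also have "\<dots> = xi_infinity (circle_freq n xs) u z"
    by (rule prod_diff_quotient_eq_xi[OF n u])
      (simp add: xi_factor_def circle_freq_def exp_over_n_power[OF n])
  finally show ?thesis by (simp add: xs_def)
qed

lemma cis_irrational_ne_1:
  assumes "\<alpha> \<notin> \<rat>" "k \<noteq> 0"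
  shows "cis (2 * pi * \<alpha> * real k) \<noteq> 1" and "cis (- (2 * pi * \<alpha> * real k)) \<noteq> 1"
proof -
  show 1: "cis (2 * pi * \<alpha> * real k) \<noteq> 1"
  proof
    assume "cis (2 * pi * \<alpha> * real k) = 1"
    then have "cos (2 * pi * \<alpha> * real k) = 1" by (simp add: complex_eq_iff)
    then obtain m :: int where "2 * pi * \<alpha> * real k = of_int m * 2 * pi"
      by (auto simp: cos_one_2pi_int)
    then have "\<alpha> = of_int m / of_nat k" using assms by (simp add: field_simps)
    then have "\<alpha> \<in> \<rat>" by (metis Rats_divide Rats_of_int Rats_of_nat)
    then show False using assms by simp
  qed
  show "cis (- (2 * pi * \<alpha> * real k)) \<noteq> 1"
    unfolding cis_inverse[symmetric] using 1 by (simp only: inverse_eq_1_iff not_False_eq_True)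
qed

lemma circle_phase_ne_1: "\<alpha> \<notin> \<rat> \<Longrightarrow> circle_phase \<alpha> xs j \<noteq> 1"
  by (simp add: circle_phase_def cis_irrational_ne_1)

text \<open>All weights are \<open>1\<close> here. Dividing the factor of a circle with \<open>k\<close> points by \<open>exp (2 \<pi> i \<alpha> k)\<close> in
  numerator and denominator turns the shift of the base point into the phase of that circle.\<close>

lemma xi_alpha_eq_xi_infinity:
  assumes n: "n > 0" and good: "distinct_points y x" and \<alpha>: "\<alpha> \<notin> \<rat>"
  shows "xi_alpha n \<alpha> (perm_matrix n (gen_perm y x n)) z
    = xi_list \<alpha> n (circle_labels x n) z"
proof -
  define xs where "xs = circle_labels x n"
  have A: "perm_matrix n (gen_perm y x n) = weighted_perm_mat n (gen_perm y x n) (\<lambda>_. 1)"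
    by (simp add: perm_matrix_def weighted_perm_mat_def)
  have det: "Determinant.det (t \<cdot>\<^sub>m 1\<^sub>m n - perm_matrix n (gen_perm y x n)) = (\<Prod>j\<in>set xs. t ^ count_list xs j - 1)" for t
    unfolding A det_gen_perm[OF good] xs_def by simp
  define e where "e = exp (2 * \<i> * of_real pi * of_real \<alpha>)"
  have e: "e ^ k = cis (2 * pi * \<alpha> * real k)" for k
    unfolding e_def by (simp add: exp_of_nat_mult[symmetric] cis_conv_exp mult_ac)
  have split: "exp (2 * \<i> * of_real pi * (z / of_nat n + of_real \<alpha>)) = exp (2 * \<i> * of_real pi * z / of_nat n) * e"
    by (simp add: e_def exp_add[symmetric] ring_distribs)
  have "xi_alpha n \<alpha> (perm_matrix n (gen_perm y x n)) z
    = (\<Prod>j\<in>set xs. ((exp (2 * \<i> * of_real pi * z / of_nat n) * e) ^ count_list xs j - 1) / (e ^ count_list xs j - 1))"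
    unfolding xi_alpha_def split e_def[symmetric] by (simp add: det prod_dividef)
  also have "\<dots> = xi_list \<alpha> n xs z"
  proof (rule prod_diff_quotient_eq_xi[OF n circle_phase_ne_1[OF \<alpha>]])
    fix j assume "j \<in> set xs"
    then have k: "count_list xs j \<noteq> 0" by (simp add: count_list_0_iff)
    define c where "c = e ^ count_list xs j"
    have v: "circle_phase \<alpha> xs j = inverse c"
      using k by (simp add: circle_phase_def c_def e)
    have c0: "c \<noteq> 0" by (simp add: c_def e_def)
    have c1: "c \<noteq> 1" using cis_irrational_ne_1(1)[OF \<alpha> k] by (simp add: c_def e)
    define E where "E = exp (2 * \<i> * of_real pi * z * of_real (circle_freq n xs j))"
    have "((exp (2 * \<i> * of_real pi * z / of_nat n) * e) ^ count_list xs j - 1) / (e ^ count_list xs j - 1)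
      = (E * c - 1) / (c - 1)"
      by (simp add: power_mult_distrib exp_over_n_power[OF n] circle_freq_def c_def E_def)
    also have "\<dots> = (E - inverse c) / (1 - inverse c)"
      using c0 c1 by (simp add: field_simps)
    also have "\<dots> = xi_factor (circle_freq n xs) (circle_phase \<alpha> xs) z j"
      by (simp add: xi_factor_def v E_def)
    finally show "((exp (2 * \<i> * of_real pi * z / of_nat n) * e) ^ count_list xs j - 1) / (e ^ count_list xs j - 1)
      = xi_factor (circle_freq n xs) (circle_phase \<alpha> xs) z j" .
  qed
  finally show ?thesis by (simp add: xs_def)
qed

section \<open>Counts of independent draws\<close>

lemma map_eq_bernoulli_pmf: "map_pmf (\<lambda>x. x = j) \<pi> = bernoulli_pmf (pmf \<pi> j)"
proof (rule pmf_eqI)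
  fix b
  have p: "pmf \<pi> j \<in> {0..1}" using pmf_nonneg pmf_le_1 by auto
  have T: "pmf (map_pmf (\<lambda>x. x = j) \<pi>) True = pmf \<pi> j"
    by (simp add: pmf_map measure_pmf_single vimage_def)
  have "pmf (map_pmf (\<lambda>x. x = j) \<pi>) True + pmf (map_pmf (\<lambda>x. x = j) \<pi>) False = 1"
    using sum_pmf_eq_1[of "{True, False}" "map_pmf (\<lambda>x. x = j) \<pi>"] by auto
  then show "pmf (map_pmf (\<lambda>x. x = j) \<pi>) b = pmf (bernoulli_pmf (pmf \<pi> j)) b"
    using T p by (cases b) auto
qed

lemma count_list_replicate_pmf:
  "map_pmf (\<lambda>xs. count_list xs j) (replicate_pmf n \<pi>) = binomial_pmf n (pmf \<pi> j)"
proof (induction n)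
  case 0
  then show ?case by (subst binomial_pmf_0) (auto simp: pmf_le_1)
next
  case (Suc n)
  have "map_pmf (\<lambda>xs. count_list xs j) (replicate_pmf (Suc n) \<pi>) =
     do {b \<leftarrow> map_pmf (\<lambda>x. x = j) \<pi>;
         k \<leftarrow> map_pmf (\<lambda>xs. count_list xs j) (replicate_pmf n \<pi>);
         return_pmf ((if b then 1 else 0) + k)}"
    by (simp add: map_bind_pmf bind_map_pmf eq_commute[of _ j] cong: if_cong)
       (auto intro!: bind_pmf_cong simp: map_pmf_def)
  also have "\<dots> = binomial_pmf (Suc n) (pmf \<pi> j)"
    using Suc pmf_nonneg[of \<pi> j] pmf_le_1[of \<pi> j]
    by (simp add: map_eq_bernoulli_pmf binomial_pmf_Suc)
  finally show ?case .
qed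

lemma expectation_count_list:
  fixes f :: "nat \<Rightarrow> 'b::{banach, second_countable_topology}"
  shows "measure_pmf.expectation (replicate_pmf n \<pi>) (\<lambda>xs. f (count_list xs j))
    = (\<Sum>k\<le>n. Bernstein n k (pmf \<pi> j) *\<^sub>R f k)"
proof -
  have "measure_pmf.expectation (replicate_pmf n \<pi>) (\<lambda>xs. f (count_list xs j))
    = measure_pmf.expectation (map_pmf (\<lambda>xs. count_list xs j) (replicate_pmf n \<pi>)) f"
    by simp
  also have "\<dots> = (\<Sum>k\<le>n. Bernstein n k (pmf \<pi> j) *\<^sub>R f k)"
    unfolding count_list_replicate_pmf Bernstein_def
    using pmf_nonneg[of \<pi> j] pmf_le_1[of \<pi> j] by (subst expectation_binomial_pmf') auto
  finally show ?thesis .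
qed

lemma sum_Bernstein_variance:
  "(\<Sum>k\<le>n. Bernstein n k q * (real k - real n * q)\<^sup>2) = real n * q * (1 - q)"
proof -
  have "(\<Sum>k\<le>n. Bernstein n k q * (real k - real n * q)\<^sup>2)
    = (\<Sum>k\<le>n. real k * (real k - 1) * Bernstein n k q + (1 - 2 * real n * q) * (real k * Bernstein n k q)
         + (real n * q)\<^sup>2 * Bernstein n k q)"
    by (intro sum.cong refl) (simp add: power2_eq_square algebra_simps)
  also have "\<dots> = real n * (real n - 1) * q\<^sup>2 + (1 - 2 * real n * q) * (real n * q) + (real n * q)\<^sup>2"
    by (simp add: sum.distrib flip: sum_distrib_left)
  also have "\<dots> = real n * q * (1 - q)" by (simp add: power2_eq_square algebra_simps)
  finally show ?thesis .
qed

lemma sum_Bernstein_abs_deviation: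
  assumes "q \<in> {0..1}"
  shows "(\<Sum>k\<le>n. Bernstein n k q * \<bar>real k - real n * q\<bar>) \<le> sqrt (real n * q * (1 - q))"
proof -
  define a where "a = (\<lambda>k. sqrt (Bernstein n k q))"
  have nn: "0 \<le> Bernstein n k q" for k using assms by (intro Bernstein_nonneg) auto
  have "(\<Sum>k\<le>n. Bernstein n k q * \<bar>real k - real n * q\<bar>)\<^sup>2 = (\<Sum>k\<le>n. a k * (a k * \<bar>real k - real n * q\<bar>))\<^sup>2"
    using nn by (simp add: a_def flip: mult.assoc)
  also have "\<dots> \<le> (\<Sum>k\<le>n. (a k)\<^sup>2) * (\<Sum>k\<le>n. (a k * \<bar>real k - real n * q\<bar>)\<^sup>2)"
    by (rule Cauchy_Schwarz_ineq_sum)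
  also have "\<dots> = real n * q * (1 - q)"
    using nn sum_Bernstein_variance[of n q] by (simp add: a_def power_mult_distrib)
  finally show ?thesis by (simp add: real_le_rsqrt)
qed

text \<open>Raising a binomial variable by one changes its law little: both laws have an explicit
  density with respect to the law of one more trial.\<close>

lemma sum_Bernstein_shift:
  fixes f :: "nat \<Rightarrow> real"
  assumes q: "0 < q" "q < 1" and f: "\<And>k. \<bar>f k\<bar> \<le> 1"
  shows "\<bar>(\<Sum>k\<le>n. Bernstein n k q * f (Suc k)) - (\<Sum>k\<le>n. Bernstein n k q * f k)\<bar>
    \<le> 1 / sqrt (real (Suc n) * q * (1 - q))"
proof -
  define N where "N = Suc n"
  define V where "V = real N * q * (1 - q)"
  have V: "V > 0" using q by (simp add: V_def N_def)
  \<comment> \<open>The laws of k + 1 and of k successes in n trials, as densities with respect to the law for n + 1 trials.\<close>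
  have B1: "real N * q * Bernstein n k q = real (Suc k) * Bernstein N (Suc k) q" if "k \<le> n" for k
  proof -
    have "real (Suc k * (N choose Suc k)) = real (N * (n choose k))"
      unfolding N_def by (metis Suc_times_binomial_eq mult.commute)
    then have "real (Suc k) * real (N choose Suc k) = real N * real (n choose k)" by (simp only: of_nat_mult)
    moreover have "N - Suc k = n - k" by (simp add: N_def)
    ultimately show ?thesis unfolding Bernstein_def
      by (metis (no_types, opaque_lifting) mult.assoc mult.left_commute power_Suc)
  qed
  have B2: "real N * (1 - q) * Bernstein n k q = (real N - real k) * Bernstein N k q" if "k \<le> n" for k
  proof -
    have "(N - k) * (N choose k) = N * (n choose k)"
      unfolding N_def using that by (metis Suc_diff_le binomial_absorb_comp diff_Suc_1 le_SucI)
    then have "real (N - k) * real (N choose k) = real N * real (n choose k)"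
      by (metis of_nat_mult)
    moreover have "N - k = Suc (n - k)" using that by (simp add: N_def Suc_diff_le)
    moreover have "real (N - k) = real N - real k" using that by (simp add: N_def of_nat_diff)
    ultimately show ?thesis unfolding Bernstein_def
      by (metis (no_types, opaque_lifting) mult.assoc mult.left_commute power_Suc)
  qed
  have nz: "real N * q \<noteq> 0" "real N * (1 - q) \<noteq> 0" using q by (auto simp: N_def)
  have S1: "(\<Sum>k\<le>n. Bernstein n k q * f (Suc k)) = (\<Sum>k\<le>N. real k * Bernstein N k q * f k) / (real N * q)"
  proof -
    have "real N * q * (\<Sum>k\<le>n. Bernstein n k q * f (Suc k)) = (\<Sum>k\<le>n. real (Suc k) * Bernstein N (Suc k) q * f (Suc k))"
      unfolding sum_distrib_left by (intro sum.cong refl) (use B1 in \<open>simp flip: mult.assoc\<close>)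
    also have "\<dots> = (\<Sum>k\<le>N. real k * Bernstein N k q * f k)"
      unfolding N_def by (subst sum.atMost_Suc_shift) simp
    finally show ?thesis using nz(1) by (metis nonzero_mult_div_cancel_left)
  qed
  have S2: "(\<Sum>k\<le>n. Bernstein n k q * f k) = (\<Sum>k\<le>N. (real N - real k) * Bernstein N k q * f k) / (real N * (1 - q))"
  proof -
    have "real N * (1 - q) * (\<Sum>k\<le>n. Bernstein n k q * f k) = (\<Sum>k\<le>n. (real N - real k) * Bernstein N k q * f k)"
      unfolding sum_distrib_left by (intro sum.cong refl) (use B2 in \<open>simp flip: mult.assoc\<close>)
    also have "\<dots> = (\<Sum>k\<le>N. (real N - real k) * Bernstein N k q * f k)"
      unfolding N_def by simp
    finally show ?thesis using nz(2) by (metis nonzero_mult_div_cancel_left)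
  qed
  have "(\<Sum>k\<le>n. Bernstein n k q * f (Suc k)) - (\<Sum>k\<le>n. Bernstein n k q * f k)
    = (\<Sum>k\<le>N. Bernstein N k q * (real k - real N * q) * f k) / V"
  proof -
    \<comment> \<open>The difference of the two densities is the centred count over its variance.\<close>
    have pt: "real k * Bernstein N k q * f k / (real N * q) - (real N - real k) * Bernstein N k q * f k / (real N * (1 - q))
      = Bernstein N k q * (real k - real N * q) * f k / V" for k
      using q by (simp add: V_def N_def divide_simps) (simp add: algebra_simps)
    show ?thesis unfolding S1 S2 by (simp add: sum_divide_distrib pt flip: sum_subtractf)
  qed
  also have "\<bar>\<dots>\<bar> \<le> (\<Sum>k\<le>N. Bernstein N k q * \<bar>real k - real N * q\<bar>) / V"
  proof -
    have "\<bar>\<Sum>k\<le>N. Bernstein N k q * (real k - real N * q) * f k\<bar> \<le> (\<Sum>k\<le>N. Bernstein N k q * \<bar>real k - real N * q\<bar>)"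
    proof (rule order.trans[OF sum_abs sum_mono])
      fix k
      have "\<bar>Bernstein N k q * (real k - real N * q) * f k\<bar> = Bernstein N k q * \<bar>real k - real N * q\<bar> * \<bar>f k\<bar>"
        using q by (simp add: abs_mult Bernstein_nonneg)
      also have "\<dots> \<le> Bernstein N k q * \<bar>real k - real N * q\<bar> * 1"
        using q f by (intro mult_left_mono) (auto simp: Bernstein_nonneg)
      finally show "\<bar>Bernstein N k q * (real k - real N * q) * f k\<bar> \<le> Bernstein N k q * \<bar>real k - real N * q\<bar>"
        by simp
    qed
    then show ?thesis using V by (simp add: divide_right_mono)
  qed
  also have "\<dots> \<le> sqrt V / V"
    unfolding V_def using q by (intro divide_right_mono sum_Bernstein_abs_deviation) auto
  also have "\<dots> = 1 / sqrt V" using V by (simp add: real_div_sqrt field_simps)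
  finally show ?thesis by (simp add: V_def N_def)
qed

lemma expectation_prod_list_finite:
  fixes \<rho> :: "complex pmf"
  assumes fin: "finite (set_pmf \<rho>)"
  shows "measure_pmf.expectation (replicate_pmf n \<rho>) prod_list = (measure_pmf.expectation \<rho> (\<lambda>x. x)) ^ n"
proof (induction n)
  case (Suc n)
  have finr: "finite (set_pmf (replicate_pmf n \<rho>))"
    unfolding set_replicate_pmf using finite_lists_length_eq[OF fin, of n] by (simp add: lists_eq_set conj_commute)
  have "measure_pmf.expectation (replicate_pmf (Suc n) \<rho>) prod_list
    = measure_pmf.expectation (\<rho> \<bind> (\<lambda>x. map_pmf (Cons x) (replicate_pmf n \<rho>))) prod_list"
    by (simp add: map_pmf_def)
  also have "\<dots> = (\<Sum>x\<in>set_pmf \<rho>. pmf \<rho> x *\<^sub>R measure_pmf.expectation (map_pmf (Cons x) (replicate_pmf n \<rho>)) prod_list)"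
    by (rule pmf_expectation_bind) (use fin finr in auto)
  also have "\<dots> = (\<Sum>x\<in>set_pmf \<rho>. pmf \<rho> x *\<^sub>R x) * (measure_pmf.expectation \<rho> (\<lambda>x. x)) ^ n"
    by (simp add: Suc.IH sum_distrib_right)
  also have "(\<Sum>x\<in>set_pmf \<rho>. pmf \<rho> x *\<^sub>R x) = measure_pmf.expectation \<rho> (\<lambda>x. x)"
    by (rule integral_measure_pmf[OF fin, symmetric]) auto
  finally show ?case by simp
qed simp

lemma map_replicate_pmf: "map_pmf (map w) (replicate_pmf n \<pi>) = replicate_pmf n (map_pmf w \<pi>)"
proof (induction n)
  case (Suc n)
  have "map_pmf (map w) (replicate_pmf (Suc n) \<pi>)
    = do {x \<leftarrow> \<pi>; map_pmf (\<lambda>xs. w x # map w xs) (replicate_pmf n \<pi>)}"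
    by (simp add: map_bind_pmf map_pmf_comp flip: map_pmf_def)
  also have "\<dots> = do {x \<leftarrow> \<pi>; map_pmf (Cons (w x)) (map_pmf (map w) (replicate_pmf n \<pi>))}"
    by (simp add: map_pmf_comp)
  also have "\<dots> = replicate_pmf (Suc n) (map_pmf w \<pi>)"
    unfolding Suc by (simp add: bind_map_pmf flip: map_pmf_def)
  finally show ?case .
qed simp

lemma expectation_prod_list:
  fixes w :: "'a \<Rightarrow> complex"
  assumes fin: "finite (range w)"
  shows "measure_pmf.expectation (replicate_pmf n \<pi>) (\<lambda>xs. prod_list (map w xs))
    = (measure_pmf.expectation \<pi> w) ^ n"
proof -
  have "measure_pmf.expectation (replicate_pmf n \<pi>) (\<lambda>xs. prod_list (map w xs))
    = measure_pmf.expectation (replicate_pmf n (map_pmf w \<pi>)) prod_list"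
    by (simp flip: map_replicate_pmf)
  also have "\<dots> = (measure_pmf.expectation (map_pmf w \<pi>) (\<lambda>x. x)) ^ n"
    by (rule expectation_prod_list_finite) (auto intro: finite_subset[OF _ fin])
  finally show ?thesis by simp
qed

text \<open>Equality in the triangle inequality would force all values of \<open>w\<close> on the support to be the
  direction of the mean.\<close>

lemma norm_expectation_less_1:
  fixes w :: "'a \<Rightarrow> complex"
  assumes fin: "finite (range w)" and unit: "\<And>x. norm (w x) = 1"
    and ab: "w a \<noteq> w b" "a \<in> set_pmf \<pi>" "b \<in> set_pmf \<pi>"
  shows "norm (measure_pmf.expectation \<pi> w) < 1"
proof (rule ccontr)
  define m where "m = measure_pmf.expectation \<pi> w"
  assume "\<not> norm (measure_pmf.expectation \<pi> w) < 1"
  then have m1: "norm m \<ge> 1" by (simp add: m_def)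
  have int: "integrable (measure_pmf \<pi>) w"
    by (rule measure_pmf.integrable_const_bound[where B=1]) (auto simp: unit)
  have int': "integrable (measure_pmf \<pi>) (\<lambda>x. Re (cnj m * w x))"
    using int by (intro integrable_Re integrable_mult_right)
  have nn: "0 \<le> norm m - Re (cnj m * w x)" for x
    using complex_Re_le_cmod[of "cnj m * w x"] by (simp add: norm_mult unit)
  have "measure_pmf.expectation \<pi> (\<lambda>x. norm m - Re (cnj m * w x)) = norm m - Re (cnj m * m)"
    using int int' by (simp add: m_def)
  also have "Re (cnj m * m) = (norm m)\<^sup>2" by (metis Re_complex_of_real complex_norm_square mult.commute)
  also have "norm m - (norm m)\<^sup>2 \<le> 0" using m1 mult_left_mono[OF m1, of "norm m"] by (simp add: power2_eq_square)
  finally have "measure_pmf.expectation \<pi> (\<lambda>x. norm m - Re (cnj m * w x)) \<le> 0" .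
  then have "measure_pmf.expectation \<pi> (\<lambda>x. norm m - Re (cnj m * w x)) = 0"
    using nn by (intro antisym integral_nonneg) auto
  then have ae: "AE x in \<pi>. norm m - Re (cnj m * w x) = 0"
    using nn int' by (subst (asm) integral_nonneg_eq_0_iff_AE) auto
  have eq: "w x = m / norm m" if "x \<in> set_pmf \<pi>" for x
  proof -
    have R: "Re (cnj m * w x) = norm (cnj m * w x)"
      using ae that by (simp add: AE_measure_pmf_iff norm_mult unit)
    then have "Im (cnj m * w x) = 0" using cmod_power2[of "cnj m * w x"] by simp
    then have "cnj m * w x = of_real (norm m)"
      using R by (simp add: complex_eq_iff norm_mult unit)
    then have "(m * cnj m) * w x = m * of_real (norm m)" by (simp add: mult.assoc)
    then have "of_real (norm m) * (of_real (norm m) * w x) = of_real (norm m) * m"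
      by (simp add: complex_norm_square[symmetric] power2_eq_square mult_ac)
    then have "of_real (norm m) * w x = m" using m1 by (simp only: mult_cancel_left) auto
    moreover have "complex_of_real (norm m) \<noteq> 0" using m1 by auto
    ultimately show ?thesis by (metis nonzero_mult_div_cancel_left)
  qed
  show False using eq[OF ab(2)] eq[OF ab(3)] ab(1) by simp
qed

section \<open>Uniform points on circles\<close>

abbreviation point_space :: "(nat \<times> real) measure" where
  "point_space \<equiv> count_space UNIV \<Otimes>\<^sub>M borel"

lemma sets_seq_borel: "sets seq_borel = sets (borel :: (nat \<Rightarrow> real) measure)"
  unfolding seq_borel_def by (rule sets_PiM_equal_borel)

lemma space_seq_borel [simp]: "space seq_borel = UNIV"
  by (simp add: seq_borel_def space_PiM)

lemma measurable_coord_seq_borel [measurable]: "(\<lambda>y. y j) \<in> borel_measurable seq_borel"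
  unfolding seq_borel_def by simp

lemma nabla'_props:
  assumes "y \<in> nabla'"
  shows "0 \<le> y j" "y j \<le> 1" "summable y" "suminf y = 1" "(\<Sum>j. ennreal (y j)) = 1" "decseq y"
  using assms by (auto simp: nabla'_def nabla_def suminf_ennreal2)

lemma emeasure_count_lborel:
  assumes "B \<in> sets point_space"
  shows "emeasure (count_space UNIV \<Otimes>\<^sub>M lborel) B = (\<Sum>j. emeasure lborel (Pair j -` B))"
proof -
  have "sets (count_space UNIV \<Otimes>\<^sub>M lborel) = sets (point_space)"
    by (intro sets_pair_measure_cong) auto
  then show ?thesis using assms
    by (subst lborel.emeasure_pair_measure_alt) (auto simp: nn_integral_count_space_nat)
qed

lemma sets_circles: "circles y \<in> sets point_space"
proof -
  have "circles y = (\<Union>j. {j} \<times> {0..<y j})" by (auto simp: circles_def)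
  then show ?thesis by auto
qed

lemma emeasure_uniform_on_circles:
  assumes y: "y \<in> nabla'" and B: "B \<in> sets point_space"
  shows "emeasure (uniform_on_circles y) B = (\<Sum>j. emeasure lborel ({0..<y j} \<inter> Pair j -` B))"
proof -
  have eq: "sets (count_space UNIV \<Otimes>\<^sub>M lborel) = sets (point_space)"
    by (intro sets_pair_measure_cong) auto
  have c: "emeasure (count_space UNIV \<Otimes>\<^sub>M lborel) (circles y \<inter> B)
    = (\<Sum>j. emeasure lborel ({0..<y j} \<inter> Pair j -` B))" if "B \<in> sets point_space" for B
    using emeasure_count_lborel[of "circles y \<inter> B"] sets_circles[of y] that
    by (auto simp: circles_def vimage_def Int_def intro!: arg_cong[where f=suminf] ext arg_cong[where f="emeasure lborel"])
  have 1: "emeasure (count_space UNIV \<Otimes>\<^sub>M lborel) (circles y) = 1"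
  proof -
    have "{0..<y j} \<inter> Pair j -` circles y = {0..<y j}" for j by (auto simp: circles_def)
    then have "emeasure (count_space UNIV \<Otimes>\<^sub>M lborel) (circles y) = (\<Sum>j. emeasure lborel {0..<y j})"
      using c[OF sets_circles, of y] by (simp only: Int_absorb)
    also have "\<dots> = (\<Sum>j. ennreal (y j))" by (simp add: nabla'_props(1)[OF y])
    finally show ?thesis by (simp only: nabla'_props(5)[OF y])
  qed
  show ?thesis
    unfolding uniform_on_circles_def
    by (subst emeasure_uniform_measure)
      (use B sets_circles[of y] c[OF B] 1 eq in \<open>auto simp: divide_ennreal_def\<close>)
qed

lemma measure_uniform_on_circles_cylinder:
  assumes y: "y \<in> nabla'" and C: "C \<in> sets borel"
  shows "measure (uniform_on_circles y) ({j} \<times> C) = measure lborel ({0..<y j} \<inter> C)"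
proof -
  have "{j} \<times> C \<in> sets point_space" using C by auto
  then have "emeasure (uniform_on_circles y) ({j} \<times> C)
    = (\<Sum>i. emeasure lborel ({0..<y i} \<inter> Pair i -` ({j} \<times> C)))"
    by (rule emeasure_uniform_on_circles[OF y])
  also have "\<dots> = (\<Sum>i\<in>{j}. emeasure lborel ({0..<y i} \<inter> Pair i -` ({j} \<times> C)))"
    by (rule suminf_finite) (auto simp: vimage_def)
  also have "\<dots> = emeasure lborel ({0..<y j} \<inter> C)" by (simp add: vimage_def)
  finally show ?thesis by (simp add: measure_def)
qed

lemma measure_uniform_on_circles_UNIV:
  assumes y: "y \<in> nabla'"
  shows "measure (uniform_on_circles y) UNIV = 1"
proof -
  have "UNIV \<in> sets point_space" using sets.top[of point_space] by (simp add: space_pair_measure)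
  then show ?thesis
    using emeasure_uniform_on_circles[OF y, of UNIV] by (simp add: measure_def nabla'_props(1,5)[OF y])
qed

text \<open>The law of the circle of one point. \<^const>\<open>embed_pmf\<close> is meaningful for probability vectors only;
  the other case extends it to all \<open>y\<close>.\<close>

definition circle_pmf :: "(nat \<Rightarrow> real) \<Rightarrow> nat pmf" where
  "circle_pmf y = (if (\<forall>j. 0 \<le> y j) \<and> (\<Sum>j. ennreal (y j)) = 1 then embed_pmf y else return_pmf 0)"

lemma pmf_circle_pmf:
  "pmf (circle_pmf y) j = (if (\<forall>j. 0 \<le> y j) \<and> (\<Sum>j. ennreal (y j)) = 1 then y j else indicator {0} j)"
  unfolding circle_pmf_def
  by (auto simp: nn_integral_count_space_nat pmf_embed_pmf indicator_def)

lemma pmf_circle_pmf_nabla' [simp]: "y \<in> nabla' \<Longrightarrow> pmf (circle_pmf y) j = y j"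
  by (subst pmf_circle_pmf) (simp add: nabla'_props(1,4,5))

lemma pmf_replicate_pmf:
  "pmf (replicate_pmf n \<pi>) xs = (if length xs = n then \<Prod>k<n. pmf \<pi> (xs ! k) else 0)"
proof (induction n arbitrary: xs)
  case 0
  then show ?case by (auto simp: indicator_def)
next
  case (Suc n)
  have "replicate_pmf (Suc n) \<pi> = map_pmf (\<lambda>(x, xs). x # xs) (pair_pmf \<pi> (replicate_pmf n \<pi>))"
    by (simp add: pair_pmf_def map_bind_pmf)
  moreover have inj: "inj (\<lambda>(x, xs). x # xs)" by (auto simp: inj_def)
  ultimately show ?case
  proof (cases xs)
    case Nil
    then show ?thesis by (auto simp: set_replicate_pmf pmf_eq_0_set_pmf simp del: replicate_pmf.simps)
  next
    case (Cons x ys)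
    have "pmf (replicate_pmf (Suc n) \<pi>) xs = pmf (pair_pmf \<pi> (replicate_pmf n \<pi>)) (x, ys)"
      using pmf_map_inj'[OF inj, of "pair_pmf \<pi> (replicate_pmf n \<pi>)" "(x, ys)"] Cons
        \<open>replicate_pmf (Suc n) \<pi> = _\<close> by simp
    also have "\<dots> = pmf \<pi> x * (if length ys = n then \<Prod>k<n. pmf \<pi> (ys ! k) else 0)"
      by (simp only: pmf_pair Suc)
    also have "\<dots> = (if length xs = Suc n then \<Prod>k<Suc n. pmf \<pi> (xs ! k) else 0)"
      unfolding Cons prod.lessThan_Suc_shift by simp
    finally show ?thesis .
  qed
qed

locale circle_points = prob_space P for P :: "'a measure" +
  fixes Y :: "'a \<Rightarrow> nat \<Rightarrow> real" and X :: "nat \<Rightarrow> 'a \<Rightarrow> nat \<times> real"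
  assumes measurable_Y [measurable]: "Y \<in> P \<rightarrow>\<^sub>M seq_borel"
    and Y_nabla': "AE \<omega> in P. Y \<omega> \<in> nabla'"
    and cond_iid: "cond_iid_uniform P Y X"
begin

lemma measurable_X [measurable]: "X k \<in> P \<rightarrow>\<^sub>M point_space"
  using cond_iid by (simp add: cond_iid_uniform_def)

lemma measurable_Y_coord [measurable]: "(\<lambda>\<omega>. Y \<omega> j) \<in> borel_measurable P"
  using measurable_compose[OF measurable_Y measurable_coord_seq_borel] .

abbreviation (input) "sigma_Y \<equiv> vimage_algebra (space P) Y seq_borel"

lemma subalgebra_Y: "subalgebra P sigma_Y"
proof -
  have "sets sigma_Y \<subseteq> sets P"
    using measurable_Y by (auto simp: sets_vimage_algebra2 measurable_def)
  then show ?thesis by (simp add: subalgebra_def)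
qed

sublocale Y: finite_measure_subalgebra P sigma_Y
  by unfold_locales (rule subalgebra_Y)

text \<open>The conditional law of the points, multiplied by the indicator of an event that concerns the
  perimeters and integrated.\<close>

lemma prob_points:
  assumes A: "A \<in> sets seq_borel" and B: "\<And>k. k < n \<Longrightarrow> B k \<in> sets point_space"
  defines "E \<equiv> {\<omega>\<in>space P. \<forall>k<n. X k \<omega> \<in> B k}"
  shows "E \<in> sets P"
    and "AE \<omega> in P. real_cond_exp P sigma_Y (indicat_real E) \<omega> = (\<Prod>k<n. measure (uniform_on_circles (Y \<omega>)) (B k))"
    and "prob ({\<omega>\<in>space P. Y \<omega> \<in> A} \<inter> E)
      = (\<integral>\<omega>. indicator A (Y \<omega>) * real_cond_exp P sigma_Y (indicat_real E) \<omega> \<partial>P)"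
proof -
  have "{\<omega>\<in>space P. X k \<omega> \<in> B k} \<in> sets P" if "k < n" for k
    using measurable_sets[OF measurable_X B[OF that], of k] by (simp add: vimage_def Int_def conj_commute)
  then have "{\<omega>\<in>space P. \<forall>k\<in>{..<n}. X k \<omega> \<in> B k} \<in> sets P"
    by (rule sets.sets_Collect_finite_All) simp_all
  then show E: "E \<in> sets P" unfolding E_def by (simp only: Ball_def lessThan_iff)
  show "AE \<omega> in P. real_cond_exp P sigma_Y (indicat_real E) \<omega> = (\<Prod>k<n. measure (uniform_on_circles (Y \<omega>)) (B k))"
    unfolding E_def
    by (rule cond_iid[unfolded cond_iid_uniform_def, THEN conjunct2, THEN spec[of _ n], THEN spec[of _ B], THEN mp])
      (use B in blast)
  define A' where "A' = {\<omega>\<in>space P. Y \<omega> \<in> A}"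
  have A': "A' \<in> sets sigma_Y"
    using in_vimage_algebra[OF A, of Y "space P"] by (simp add: A'_def vimage_def Int_def conj_commute)
  have sub: "A' \<inter> E \<subseteq> space P" unfolding A'_def by blast
  have "prob (A' \<inter> E) = (\<integral>\<omega>. indicator A' \<omega> * indicat_real E \<omega> \<partial>P)"
  proof -
    have "(\<integral>\<omega>. indicator A' \<omega> * indicat_real E \<omega> \<partial>P) = (\<integral>\<omega>. indicat_real (A' \<inter> E) \<omega> \<partial>P)"
      by (intro Bochner_Integration.integral_cong) (auto simp: indicator_def)
    also have "\<dots> = prob ((A' \<inter> E) \<inter> space P)" by (rule Bochner_Integration.integral_indicator)
    finally show ?thesis by (simp only: Int_absorb2[OF sub])
  qed
  also have "\<dots> = (\<integral>\<omega>\<in>A'. indicat_real E \<omega> \<partial>P)" by (simp add: set_lebesgue_integral_def)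
  also have "\<dots> = (\<integral>\<omega>\<in>A'. real_cond_exp P sigma_Y (indicat_real E) \<omega> \<partial>P)"
    by (rule Y.real_cond_exp_intA[OF integrable_real_indicator[OF E] A']) (simp add: emeasure_eq_measure)
  also have "\<dots> = (\<integral>\<omega>. indicator A (Y \<omega>) * real_cond_exp P sigma_Y (indicat_real E) \<omega> \<partial>P)"
    unfolding set_lebesgue_integral_def
    by (intro Bochner_Integration.integral_cong) (simp_all add: A'_def indicator_def)
  finally show "prob ({\<omega>\<in>space P. Y \<omega> \<in> A} \<inter> E)
      = (\<integral>\<omega>. indicator A (Y \<omega>) * real_cond_exp P sigma_Y (indicat_real E) \<omega> \<partial>P)" by (simp add: A'_def)
qed

lemma prob_circles:
  assumes A: "A \<in> sets seq_borel"
  shows "prob {\<omega>\<in>space P. Y \<omega> \<in> A \<and> (\<forall>k<n. fst (X k \<omega>) = c k)}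
    = (\<integral>\<omega>. indicator A (Y \<omega>) * (\<Prod>k<n. Y \<omega> (c k)) \<partial>P)"
proof -
  define B where "B = (\<lambda>k. {c k} \<times> (UNIV :: real set))"
  have B: "B k \<in> sets point_space" for k by (auto simp: B_def)
  note * = prob_points[OF A B, of n "\<lambda>k. k"]
  have "prob {\<omega>\<in>space P. Y \<omega> \<in> A \<and> (\<forall>k<n. fst (X k \<omega>) = c k)}
    = prob ({\<omega>\<in>space P. Y \<omega> \<in> A} \<inter> {\<omega>\<in>space P. \<forall>k<n. X k \<omega> \<in> B k})"
    by (intro arg_cong[where f=prob]) (auto simp: B_def mem_Times_iff)
  also have "\<dots> = (\<integral>\<omega>. indicator A (Y \<omega>) * real_cond_exp P sigma_Y (indicat_real {\<omega>\<in>space P. \<forall>k<n. X k \<omega> \<in> B k}) \<omega> \<partial>P)"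
    by (rule *(3))
  also have "\<dots> = (\<integral>\<omega>. indicator A (Y \<omega>) * (\<Prod>k<n. Y \<omega> (c k)) \<partial>P)"
  proof (rule integral_cong_AE)
    show "AE \<omega> in P. indicator A (Y \<omega>) * real_cond_exp P sigma_Y (indicat_real {\<omega>\<in>space P. \<forall>k<n. X k \<omega> \<in> B k}) \<omega>
      = indicator A (Y \<omega>) * (\<Prod>k<n. Y \<omega> (c k))"
      using *(2) Y_nabla'
    proof eventually_elim
      case (elim \<omega>)
      show ?case unfolding elim(1)
        using measure_uniform_on_circles_cylinder[OF elim(2), of UNIV] nabla'_props(1)[OF elim(2)]
        by (simp add: B_def)
    qed
    have [measurable]: "(\<lambda>\<omega>. indicat_real A (Y \<omega>)) \<in> borel_measurable P"
      by (rule measurable_compose[OF measurable_Y]) (use A in simp)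
    show "(\<lambda>\<omega>. indicator A (Y \<omega>) * (\<Prod>k<n. Y \<omega> (c k))) \<in> borel_measurable P"
      by (intro borel_measurable_times borel_measurable_prod measurable_Y_coord) fact
    show "(\<lambda>\<omega>. indicator A (Y \<omega>) * real_cond_exp P sigma_Y (indicat_real {\<omega>\<in>space P. \<forall>k<n. X k \<omega> \<in> B k}) \<omega>) \<in> borel_measurable P"
      by (intro borel_measurable_times borel_measurable_cond_exp2) fact
  qed
  finally show ?thesis .
qed

definition circle_list :: "nat \<Rightarrow> 'a \<Rightarrow> nat list" where
  "circle_list n \<omega> = map (\<lambda>k. fst (X k \<omega>)) [0..<n]"

lemma circle_list_eq_iff:
  "circle_list n \<omega> = xs \<longleftrightarrow> length xs = n \<and> (\<forall>k<n. fst (X k \<omega>) = xs ! k)"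
  by (auto simp: circle_list_def list_eq_iff_nth_eq)

lemma measurable_circle_list [measurable]: "circle_list n \<in> P \<rightarrow>\<^sub>M count_space UNIV"
proof -
  have "circle_list n -` {xs} \<inter> space P \<in> sets P" for xs
  proof -
  have "circle_list n -` {xs} \<inter> space P = {\<omega>\<in>space P. length xs = n \<and> (\<forall>k<n. fst (X k \<omega>) = xs ! k)}"
    unfolding vimage_def Int_def by (simp add: circle_list_eq_iff conj_commute)
  also have "\<dots> \<in> sets P"
  proof (cases "length xs = n")
    case True
    have "{\<omega>\<in>space P. \<forall>k\<in>{..<n}. fst (X k \<omega>) = xs ! k} \<in> sets P"
    proof (rule sets.sets_Collect_finite_All)
      fix k
      have "fst \<circ> X k \<in> P \<rightarrow>\<^sub>M count_space UNIV" by (rule measurable_comp[OF measurable_X measurable_fst])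
      from measurable_sets[OF this, of "{xs ! k}"]
      show "{\<omega>\<in>space P. fst (X k \<omega>) = xs ! k} \<in> sets P"
        by (simp add: vimage_def Int_def conj_commute)
    qed simp
    then show ?thesis using True by (simp only: Ball_def lessThan_iff simp_thms)
  qed simp
  finally show "circle_list n -` {xs} \<inter> space P \<in> sets P" .
  qed
  then show ?thesis
    by (subst measurable_count_space_eq2_countable) simp_all
qed

end

context circle_points begin

text \<open>As functions of an event for the perimeters both sides are measures, and they agree by the
  conditional law of the labels; integrating \<open>h\<close> against them gives the claim.\<close>

lemma nn_integral_circle_list_point:
  assumes h: "h \<in> borel_measurable seq_borel"
  shows "(\<integral>\<^sup>+\<omega>. h (Y \<omega>) * indicator {xs} (circle_list n \<omega>) \<partial>P)
    = (\<integral>\<^sup>+\<omega>. h (Y \<omega>) * ennreal (pmf (replicate_pmf n (circle_pmf (Y \<omega>))) xs) \<partial>P)"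
proof -
  define g where "g = (\<lambda>\<omega>. if length xs = n then ennreal (\<Prod>k<n. Y \<omega> (xs ! k)) else 0)"
  have "(\<lambda>\<omega>. ennreal (\<Prod>k<n. Y \<omega> (xs ! k))) \<in> borel_measurable P"
    by (intro measurable_compose[OF borel_measurable_prod measurable_ennreal] measurable_Y_coord)
  then have g[measurable]: "g \<in> borel_measurable P" unfolding g_def by (cases "length xs = n") simp_all
  define \<mu> where "\<mu> = density P (\<lambda>\<omega>. indicator {xs} (circle_list n \<omega>))"
  define \<nu> where "\<nu> = density P g"
  have "distr \<mu> seq_borel Y = distr \<nu> seq_borel Y"
  proof (rule measure_eqI)
    fix A assume "A \<in> sets (distr \<mu> seq_borel Y)"
    then have A[measurable]: "A \<in> sets seq_borel" by simp
    have "emeasure (distr \<mu> seq_borel Y) A = (\<integral>\<^sup>+\<omega>. indicator {xs} (circle_list n \<omega>) * indicator (Y -` A \<inter> space P) \<omega> \<partial>P)"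
      unfolding \<mu>_def by (simp add: emeasure_distr emeasure_density)
    also have "\<dots> = (\<integral>\<^sup>+\<omega>. indicator {\<omega>\<in>space P. Y \<omega> \<in> A \<and> length xs = n \<and> (\<forall>k<n. fst (X k \<omega>) = xs ! k)} \<omega> \<partial>P)"
      by (intro nn_integral_cong) (auto simp: indicator_def circle_list_eq_iff)
    also have "\<dots> = emeasure P {\<omega>\<in>space P. Y \<omega> \<in> A \<and> length xs = n \<and> (\<forall>k<n. fst (X k \<omega>) = xs ! k)}"
    proof (rule nn_integral_indicator)
      have "{\<omega>\<in>space P. Y \<omega> \<in> A \<and> length xs = n \<and> (\<forall>k<n. fst (X k \<omega>) = xs ! k)}
        = (Y -` A \<inter> space P) \<inter> (circle_list n -` {xs} \<inter> space P)"
        by (auto simp: circle_list_eq_iff[symmetric])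
      then show "{\<omega>\<in>space P. Y \<omega> \<in> A \<and> length xs = n \<and> (\<forall>k<n. fst (X k \<omega>) = xs ! k)} \<in> sets P"
        using measurable_sets[OF measurable_Y A] measurable_sets[OF measurable_circle_list[of n], of "{xs}"] by auto
    qed
    also have "\<dots> = (\<integral>\<^sup>+\<omega>. g \<omega> * indicator (Y -` A \<inter> space P) \<omega> \<partial>P)"
    proof (cases "length xs = n")
      case True
      have bound: "AE \<omega> in P. 0 \<le> indicator A (Y \<omega>) * (\<Prod>k<n. Y \<omega> (xs ! k)) \<and> indicator A (Y \<omega>) * (\<Prod>k<n. Y \<omega> (xs ! k)) \<le> 1"
        using Y_nabla'
      proof eventually_elim
        case (elim \<omega>)
        then have "0 \<le> (\<Prod>k<n. Y \<omega> (xs ! k))" "(\<Prod>k<n. Y \<omega> (xs ! k)) \<le> 1"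
          by (auto intro!: prod_nonneg prod_le_1 nabla'_props(1,2)[OF elim])
        then show ?case by (auto simp: indicator_def)
      qed
      have "emeasure P {\<omega>\<in>space P. Y \<omega> \<in> A \<and> length xs = n \<and> (\<forall>k<n. fst (X k \<omega>) = xs ! k)}
        = ennreal (\<integral>\<omega>. indicator A (Y \<omega>) * (\<Prod>k<n. Y \<omega> (xs ! k)) \<partial>P)"
        using prob_circles[OF A, of n "\<lambda>k. xs ! k"] True by (simp add: emeasure_eq_measure)
      also have "\<dots> = (\<integral>\<^sup>+\<omega>. ennreal (indicator A (Y \<omega>) * (\<Prod>k<n. Y \<omega> (xs ! k))) \<partial>P)"
      proof (rule nn_integral_eq_integral[symmetric])
        show "integrable P (\<lambda>\<omega>. indicator A (Y \<omega>) * (\<Prod>k<n. Y \<omega> (xs ! k)))"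
          by (rule integrable_const_bound[where B=1]) (use bound in auto)
      qed (use bound in auto)
      also have "\<dots> = (\<integral>\<^sup>+\<omega>. g \<omega> * indicator (Y -` A \<inter> space P) \<omega> \<partial>P)"
        using True by (intro nn_integral_cong) (auto simp: g_def indicator_def)
      finally show ?thesis .
    qed (simp add: g_def)
    also have "\<dots> = emeasure (distr \<nu> seq_borel Y) A"
      unfolding \<nu>_def by (simp add: emeasure_distr emeasure_density)
    finally show "emeasure (distr \<mu> seq_borel Y) A = emeasure (distr \<nu> seq_borel Y) A" .
  qed simp
  then have "(\<integral>\<^sup>+y. h y \<partial>distr \<mu> seq_borel Y) = (\<integral>\<^sup>+y. h y \<partial>distr \<nu> seq_borel Y)" by simp
  then have "(\<integral>\<^sup>+\<omega>. indicator {xs} (circle_list n \<omega>) * h (Y \<omega>) \<partial>P) = (\<integral>\<^sup>+\<omega>. g \<omega> * h (Y \<omega>) \<partial>P)"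
    using h unfolding \<mu>_def \<nu>_def
    by (simp add: nn_integral_distr nn_integral_density)
  moreover have "(\<integral>\<^sup>+\<omega>. g \<omega> * h (Y \<omega>) \<partial>P) = (\<integral>\<^sup>+\<omega>. h (Y \<omega>) * ennreal (pmf (replicate_pmf n (circle_pmf (Y \<omega>))) xs) \<partial>P)"
  proof (rule nn_integral_cong_AE)
    show "AE \<omega> in P. g \<omega> * h (Y \<omega>) = h (Y \<omega>) * ennreal (pmf (replicate_pmf n (circle_pmf (Y \<omega>))) xs)"
      using Y_nabla' by eventually_elim (auto simp: g_def pmf_replicate_pmf mult.commute)
  qed
  ultimately show ?thesis by (simp add: mult.commute)
qed

lemma measurable_pmf_circle [measurable]:
  "(\<lambda>\<omega>. pmf (replicate_pmf n (circle_pmf (Y \<omega>))) xs) \<in> borel_measurable P"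
proof -
  have 1: "(\<lambda>\<omega>. \<Sum>j. ennreal (Y \<omega> j)) \<in> borel_measurable P"
    by (rule borel_measurable_suminf_order, rule measurable_compose[OF measurable_Y_coord measurable_ennreal])
  have "{\<omega>\<in>space P. \<forall>j. 0 \<le> Y \<omega> j} \<in> sets P"
    by (intro sets.sets_Collect_countable_All borel_measurable_le measurable_Y_coord borel_measurable_const)
  moreover have "{\<omega>\<in>space P. (\<Sum>j. ennreal (Y \<omega> j)) = 1} \<in> sets P"
    using measurable_sets[OF 1, of "{1}"] by (simp only: vimage_def Int_def singleton_iff mem_Collect_eq conj_commute) simp
  ultimately have "{\<omega>\<in>space P. (\<forall>j. 0 \<le> Y \<omega> j) \<and> (\<Sum>j. ennreal (Y \<omega> j)) = 1} \<in> sets P"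
    by (intro sets.sets_Collect_conj)
  then have "(\<lambda>\<omega>. pmf (circle_pmf (Y \<omega>)) j) \<in> borel_measurable P" for j
    unfolding pmf_circle_pmf by (intro measurable_If measurable_Y_coord) auto
  then have "(\<lambda>\<omega>. \<Prod>k<n. pmf (circle_pmf (Y \<omega>)) (xs ! k)) \<in> borel_measurable P"
    by (rule borel_measurable_prod)
  then show ?thesis unfolding pmf_replicate_pmf by (cases "length xs = n") simp_all
qed

text \<open>Given the perimeters the labels are independent draws. This moves all later estimates to a discrete
  space of lists, on which the perimeters are constants.\<close>

lemma nn_integral_circle_list:
  assumes h: "\<And>xs. (\<lambda>y. h y xs) \<in> borel_measurable seq_borel"
  shows "(\<integral>\<^sup>+\<omega>. h (Y \<omega>) (circle_list n \<omega>) \<partial>P)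
    = (\<integral>\<^sup>+\<omega>. (\<integral>\<^sup>+xs. h (Y \<omega>) xs \<partial>replicate_pmf n (circle_pmf (Y \<omega>))) \<partial>P)"
    and "(\<lambda>\<omega>. \<integral>\<^sup>+xs. h (Y \<omega>) xs \<partial>replicate_pmf n (circle_pmf (Y \<omega>))) \<in> borel_measurable P"
proof -
  have hY[measurable]: "(\<lambda>\<omega>. h (Y \<omega>) xs) \<in> borel_measurable P" for xs
    using measurable_compose[OF measurable_Y h] .
  have "(\<integral>\<^sup>+\<omega>. h (Y \<omega>) (circle_list n \<omega>) \<partial>P)
    = (\<integral>\<^sup>+\<omega>. (\<integral>\<^sup>+xs. h (Y \<omega>) xs * indicator {xs} (circle_list n \<omega>) \<partial>count_space UNIV) \<partial>P)"
  proof (rule nn_integral_cong)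
    fix \<omega>
    have "(\<integral>\<^sup>+xs. h (Y \<omega>) xs * indicator {xs} (circle_list n \<omega>) \<partial>count_space UNIV)
      = (\<integral>\<^sup>+xs. h (Y \<omega>) xs * indicator {circle_list n \<omega>} xs \<partial>count_space UNIV)"
      by (intro nn_integral_cong) (auto simp: indicator_def)
    then show "h (Y \<omega>) (circle_list n \<omega>)
      = (\<integral>\<^sup>+xs. h (Y \<omega>) xs * indicator {xs} (circle_list n \<omega>) \<partial>count_space UNIV)"
      by (subst (asm) nn_integral_indicator_singleton) auto
  qed
  also have "\<dots> = (\<integral>\<^sup>+xs. (\<integral>\<^sup>+\<omega>. h (Y \<omega>) xs * indicator {xs} (circle_list n \<omega>) \<partial>P) \<partial>count_space UNIV)"
    by (rule nn_integral_count_space_nn_integral) auto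
  also have "\<dots> = (\<integral>\<^sup>+xs. (\<integral>\<^sup>+\<omega>. h (Y \<omega>) xs * ennreal (pmf (replicate_pmf n (circle_pmf (Y \<omega>))) xs) \<partial>P) \<partial>count_space UNIV)"
    by (simp add: nn_integral_circle_list_point[OF h])
  also have "\<dots> = (\<integral>\<^sup>+\<omega>. (\<integral>\<^sup>+xs. h (Y \<omega>) xs * ennreal (pmf (replicate_pmf n (circle_pmf (Y \<omega>))) xs) \<partial>count_space UNIV) \<partial>P)"
    by (rule nn_integral_count_space_nn_integral[symmetric]) auto
  also have "\<dots> = (\<integral>\<^sup>+\<omega>. (\<integral>\<^sup>+xs. h (Y \<omega>) xs \<partial>replicate_pmf n (circle_pmf (Y \<omega>))) \<partial>P)"
    by (simp only: nn_integral_measure_pmf mult.commute)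
  finally show "(\<integral>\<^sup>+\<omega>. h (Y \<omega>) (circle_list n \<omega>) \<partial>P)
    = (\<integral>\<^sup>+\<omega>. (\<integral>\<^sup>+xs. h (Y \<omega>) xs \<partial>replicate_pmf n (circle_pmf (Y \<omega>))) \<partial>P)" .
  interpret L: sigma_finite_measure "count_space (UNIV :: nat list set)"
    by (rule sigma_finite_measure_count_space_countable) auto
  have "(\<lambda>\<omega>. \<integral>\<^sup>+xs. ennreal (pmf (replicate_pmf n (circle_pmf (Y \<omega>))) xs) * h (Y \<omega>) xs \<partial>count_space UNIV) \<in> borel_measurable P"
  proof (rule L.borel_measurable_nn_integral)
    show "(\<lambda>(\<omega>, xs). ennreal (pmf (replicate_pmf n (circle_pmf (Y \<omega>))) xs) * h (Y \<omega>) xs)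
      \<in> borel_measurable (P \<Otimes>\<^sub>M count_space UNIV)"
      unfolding case_prod_beta
      by (rule measurable_compose_countable[of
          "\<lambda>xs p. ennreal (pmf (replicate_pmf n (circle_pmf (Y (fst p)))) xs) * h (Y (fst p)) xs" _ _ snd])
        measurable
  qed
  then show "(\<lambda>\<omega>. \<integral>\<^sup>+xs. h (Y \<omega>) xs \<partial>replicate_pmf n (circle_pmf (Y \<omega>))) \<in> borel_measurable P"
    by (simp add: nn_integral_measure_pmf)
qed

end

section \<open>Points in general position\<close>

context circle_points begin

text \<open>The set of forbidden points depends on the perimeters only through the event \<open>A\<close>, since the
  conditional law is known for sets of points that are chosen in advance.\<close>

lemma AE_X_notin:
  assumes A: "A \<in> sets seq_borel" and C: "C \<in> sets borel"
    and null: "AE \<omega> in P. Y \<omega> \<in> A \<longrightarrow> measure lborel ({0..<Y \<omega> j} \<inter> C) = 0"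
  shows "AE \<omega> in P. \<not> (Y \<omega> \<in> A \<and> X k \<omega> \<in> {j} \<times> C)"
proof -
  define B where "B = (\<lambda>i. if i = k then {j} \<times> C else (UNIV :: (nat \<times> real) set))"
  have U: "(UNIV :: (nat \<times> real) set) \<in> sets point_space"
    using sets.top[of point_space] by (simp add: space_pair_measure)
  have B: "B i \<in> sets point_space" for i
    using C U unfolding B_def by (simp add: pair_measureI)
  define E where "E = {\<omega>\<in>space P. \<forall>i<Suc k. X i \<omega> \<in> B i}"
  note * = prob_points[OF A B, of "Suc k" "\<lambda>i. i", folded E_def]
  have "AE \<omega> in P. indicator A (Y \<omega>) * real_cond_exp P sigma_Y (indicat_real E) \<omega> = 0"
    using *(2) Y_nabla' null
  proof eventually_elim
    case (elim \<omega>)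
    show ?case
    proof (cases "Y \<omega> \<in> A")
      case True
      have "measure (uniform_on_circles (Y \<omega>)) (B k) = 0"
        using measure_uniform_on_circles_cylinder[OF elim(2) C, of j] elim(3) True by (simp add: B_def)
      then have "(\<Prod>i<Suc k. measure (uniform_on_circles (Y \<omega>)) (B i)) = 0" by simp
      then show ?thesis using elim(1) by simp
    qed simp
  qed
  then have 0: "prob ({\<omega>\<in>space P. Y \<omega> \<in> A} \<inter> E) = 0"
    unfolding *(3) by (rule integral_eq_zero_AE)
  have eq: "{\<omega>\<in>space P. Y \<omega> \<in> A} \<inter> E = {\<omega>\<in>space P. Y \<omega> \<in> A \<and> X k \<omega> \<in> {j} \<times> C}"
    unfolding E_def B_def by fastforce
  have "{\<omega>\<in>space P. Y \<omega> \<in> A} = Y -` A \<inter> space P" by blast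
  then have "{\<omega>\<in>space P. Y \<omega> \<in> A} \<in> sets P" using measurable_sets[OF measurable_Y A] by simp
  then have "{\<omega>\<in>space P. Y \<omega> \<in> A \<and> X k \<omega> \<in> {j} \<times> C} \<in> sets P"
    using *(1) by (simp only: eq[symmetric] sets.Int)
  then show ?thesis using 0 unfolding eq by (simp only: prob_Collect_eq_0)
qed

text \<open>The perimeter is random; comparing it with rational numbers reduces the upper bound to countably
  many events of product form.\<close>

lemma AE_X_in_circles: "AE \<omega> in P. \<forall>k. snd (X k \<omega>) \<in> {0<..Y \<omega> (fst (X k \<omega>))}"
proof -
  have A: "{y. y j \<le> q} \<in> sets seq_borel" for j q
    using borel_measurable_le[OF measurable_coord_seq_borel[of j] borel_measurable_const[of q]] by simp
  have 1: "AE \<omega> in P. \<forall>k j. \<forall>q\<in>\<rat>. \<not> (Y \<omega> \<in> {y. y j \<le> q} \<and> X k \<omega> \<in> {j} \<times> {q..})"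
  proof -
    have "AE \<omega> in P. \<not> (Y \<omega> \<in> {y. y j \<le> q} \<and> X k \<omega> \<in> {j} \<times> {q..})" for k j q
    proof (rule AE_X_notin[OF A])
      have "{0..<y j} \<inter> {q..} = {}" if "y j \<le> q" for y :: "nat \<Rightarrow> real" using that by auto
      then show "AE \<omega> in P. Y \<omega> \<in> {y. y j \<le> q} \<longrightarrow> measure lborel ({0..<Y \<omega> j} \<inter> {q..}) = 0" by simp
    qed simp
    then show ?thesis
      by (simp only: AE_all_countable AE_ball_countable[OF countable_rat]) blast
  qed
  have 2: "AE \<omega> in P. \<forall>k j. \<not> (Y \<omega> \<in> UNIV \<and> X k \<omega> \<in> {j} \<times> {..0})"
  proof -
    have "AE \<omega> in P. \<not> (Y \<omega> \<in> UNIV \<and> X k \<omega> \<in> {j} \<times> {..0})" for k j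
    proof (rule AE_X_notin)
      have "measure lborel ({0..<y} \<inter> {..0}) = 0" for y :: real
      proof -
        have "emeasure lborel ({0..<y} \<inter> {..0}) \<le> emeasure lborel {0::real}"
          by (rule emeasure_mono) auto
        then show ?thesis by (simp add: measure_def)
      qed
      then show "AE \<omega> in P. Y \<omega> \<in> UNIV \<longrightarrow> measure lborel ({0..<Y \<omega> j} \<inter> {..0}) = 0" by simp
      show "UNIV \<in> sets seq_borel" using sets.top[of seq_borel] by simp
    qed simp
    then show ?thesis by (simp only: AE_all_countable) blast
  qed
  show ?thesis using 1 2
  proof eventually_elim
    case (elim \<omega>)
    show ?case
    proof
      fix k
      define j where "j = fst (X k \<omega>)"
      define s where "s = snd (X k \<omega>)"
      have X: "X k \<omega> = (j, s)" by (simp add: j_def s_def)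
      have "0 < s" using elim(2)[rule_format, of k j] X by auto
      moreover have "s \<le> Y \<omega> j"
      proof (rule ccontr)
        assume "\<not> s \<le> Y \<omega> j"
        then obtain q where "q \<in> \<rat>" "Y \<omega> j < q" "q < s" using Rats_dense_in_real[of "Y \<omega> j" s] by auto
        then show False using elim(1)[rule_format, of q j k] X by auto
      qed
      ultimately show "snd (X k \<omega>) \<in> {0<..Y \<omega> (fst (X k \<omega>))}" by (simp add: s_def j_def)
    qed
  qed
qed

text \<open>The circles are cut into cells of length \<open>1 / N\<close>. Given the first point, the second one falls into
  the same cell with probability at most \<open>1 / N\<close>.\<close>

lemma AE_X_distinct:
  assumes kl: "k \<noteq> l"
  shows "AE \<omega> in P. X k \<omega> \<noteq> X l \<omega>"
proof -
  have UY: "(UNIV :: (nat \<Rightarrow> real) set) \<in> sets seq_borel" using sets.top[of seq_borel] by simp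
  have U: "(UNIV :: (nat \<times> real) set) \<in> sets point_space"
    using sets.top[of point_space] by (simp add: space_pair_measure)
  \<comment> \<open>The cells are indexed by the circle and an integer, so they form a countable family.\<close>
  define cell :: "nat \<Rightarrow> nat \<times> real \<Rightarrow> nat \<times> int" where "cell = (\<lambda>N x. (fst x, \<lfloor>real (Suc N) * snd x\<rfloor>))"
  define D where "D = (\<lambda>N (c :: nat \<times> int). {real_of_int (snd c) / real (Suc N) ..< (real_of_int (snd c) + 1) / real (Suc N)})"
  have cell: "cell N x = c \<longleftrightarrow> x \<in> {fst c} \<times> D N c" for N x c
  proof -
    have "\<lfloor>real (Suc N) * snd x\<rfloor> = snd c \<longleftrightarrow> snd x \<in> D N c"
      by (simp add: D_def floor_eq_iff pos_divide_le_eq pos_less_divide_eq mult.commute del: of_nat_Suc)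
    then show ?thesis by (auto simp: cell_def prod_eq_iff mem_Times_iff)
  qed
  have pair: "emeasure P {\<omega>\<in>space P. cell N (X k \<omega>) = c \<and> cell N (X l \<omega>) = c}
      \<le> ennreal (1 / real (Suc N)) * emeasure P {\<omega>\<in>space P. cell N (X k \<omega>) = c}"
    and meas: "{\<omega>\<in>space P. cell N (X k \<omega>) = c \<and> cell N (X l \<omega>) = c} \<in> sets P"
      "{\<omega>\<in>space P. cell N (X k \<omega>) = c} \<in> sets P" for N c
  proof -
    define Q where "Q = {fst c} \<times> D N c"
    have DQ: "D N c \<in> sets borel" by (simp add: D_def)
    have Q: "Q \<in> sets point_space" using DQ unfolding Q_def by (simp add: pair_measureI)
    define n where "n = Suc (max k l)"
    define B where "B = (\<lambda>(I :: nat set) (i :: nat). if i \<in> I then Q else (UNIV :: (nat \<times> real) set))"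
    have B: "B I i \<in> sets point_space" for I i using Q U by (simp add: B_def)
    define E where "E = (\<lambda>I :: nat set. {\<omega>\<in>space P. \<forall>i<n. X i \<omega> \<in> B I i})"
    have *: "E I \<in> sets P"
      "AE \<omega> in P. real_cond_exp P sigma_Y (indicat_real (E I)) \<omega> = (\<Prod>i<n. measure (uniform_on_circles (Y \<omega>)) (B I i))"
      "prob ({\<omega>\<in>space P. Y \<omega> \<in> UNIV} \<inter> E I)
        = (\<integral>\<omega>. indicator UNIV (Y \<omega>) * real_cond_exp P sigma_Y (indicat_real (E I)) \<omega> \<partial>P)" for I
      unfolding E_def by (rule prob_points[OF UY B])+
    have prodB: "(\<Prod>i<n. measure (uniform_on_circles y) (B I i)) = (\<Prod>i\<in>I. measure (uniform_on_circles y) Q)"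
      if "y \<in> nabla'" "I \<subseteq> {..<n}" for I y
      by (rule prod.mono_neutral_cong_right)
        (use that measure_uniform_on_circles_UNIV[of y] in \<open>auto simp: B_def\<close>)
    have sub: "{k} \<subseteq> {..<n}" "{k, l} \<subseteq> {..<n}" by (auto simp: n_def)
    have Q1: "measure (uniform_on_circles y) Q \<le> 1 / real (Suc N)" if "y \<in> nabla'" for y
    proof -
      have "measure lborel ({0..<y (fst c)} \<inter> D N c) \<le> measure lborel (D N c)"
        by (rule measure_mono_fmeasurable) (simp_all add: D_def fmeasurable_def divide_right_mono)
      also have "\<dots> = 1 / real (Suc N)"
        by (simp add: D_def divide_right_mono diff_divide_distrib[symmetric] del: of_nat_Suc)
      finally show ?thesis using measure_uniform_on_circles_cylinder[OF that DQ, of "fst c"] by (simp add: Q_def)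
    qed
    have int: "integrable P (\<lambda>\<omega>. real_cond_exp P sigma_Y (indicat_real (E I)) \<omega>)" for I
      by (rule Y.real_cond_exp_int(1)[OF integrable_real_indicator[OF *(1)]]) (simp add: emeasure_eq_measure)
    have pE: "prob (E I) = (\<integral>\<omega>. real_cond_exp P sigma_Y (indicat_real (E I)) \<omega> \<partial>P)" for I
    proof -
      have "{\<omega>\<in>space P. Y \<omega> \<in> UNIV} \<inter> E I = E I" unfolding E_def by blast
      then show ?thesis using *(3)[of I] by simp
    qed
    have "prob (E {k,l}) \<le> (\<integral>\<omega>. 1 / real (Suc N) * real_cond_exp P sigma_Y (indicat_real (E {k})) \<omega> \<partial>P)"
      unfolding pE
    proof (rule integral_mono_AE[OF int integrable_mult_right[OF int]])
      show "AE \<omega> in P. real_cond_exp P sigma_Y (indicat_real (E {k,l})) \<omega>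
        \<le> 1 / real (Suc N) * real_cond_exp P sigma_Y (indicat_real (E {k})) \<omega>"
        using *(2)[of "{k,l}"] *(2)[of "{k}"] Y_nabla'
      proof eventually_elim
        case (elim \<omega>)
        show ?case unfolding elim(1,2) prodB[OF elim(3) sub(1)] prodB[OF elim(3) sub(2)]
          using mult_right_mono[OF Q1[OF elim(3)] measure_nonneg[of "uniform_on_circles (Y \<omega>)" Q]] kl
          by (simp del: of_nat_Suc)
      qed
    qed
    also have "\<dots> = 1 / real (Suc N) * prob (E {k})" unfolding pE by (rule integral_mult_right_zero)
    finally have le: "prob (E {k,l}) \<le> 1 / real (Suc N) * prob (E {k})" .
    have E1: "E {k} = {\<omega>\<in>space P. cell N (X k \<omega>) = c}"
      unfolding E_def B_def cell Q_def[symmetric] n_def by (auto simp: less_Suc_eq_le)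
    have E2: "E {k,l} = {\<omega>\<in>space P. cell N (X k \<omega>) = c \<and> cell N (X l \<omega>) = c}"
      unfolding E_def B_def cell Q_def[symmetric] n_def by (auto simp: less_Suc_eq_le)
    show "emeasure P {\<omega>\<in>space P. cell N (X k \<omega>) = c \<and> cell N (X l \<omega>) = c}
      \<le> ennreal (1 / real (Suc N)) * emeasure P {\<omega>\<in>space P. cell N (X k \<omega>) = c}"
      using le unfolding E1 E2 emeasure_eq_measure
      by (subst ennreal_mult[symmetric]) (simp_all del: of_nat_Suc add: ennreal_leI)
    show "{\<omega>\<in>space P. cell N (X k \<omega>) = c \<and> cell N (X l \<omega>) = c} \<in> sets P"
      "{\<omega>\<in>space P. cell N (X k \<omega>) = c} \<in> sets P"
      using *(1)[of "{k,l}"] *(1)[of "{k}"] unfolding E1 E2 by blast+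
  qed
  have small: "emeasure P {\<omega>\<in>space P. cell N (X k \<omega>) = cell N (X l \<omega>)} \<le> ennreal (1 / real (Suc N))"
    and meas2: "{\<omega>\<in>space P. cell N (X k \<omega>) = cell N (X l \<omega>)} \<in> sets P" for N
  proof -
    have eq: "{\<omega>\<in>space P. cell N (X k \<omega>) = cell N (X l \<omega>)}
      = (\<Union>c. {\<omega>\<in>space P. cell N (X k \<omega>) = c \<and> cell N (X l \<omega>) = c})" by auto
    show "{\<omega>\<in>space P. cell N (X k \<omega>) = cell N (X l \<omega>)} \<in> sets P"
      unfolding eq by (rule sets.countable_UN'') (use meas in auto)
    have "emeasure P {\<omega>\<in>space P. cell N (X k \<omega>) = cell N (X l \<omega>)}
      = (\<integral>\<^sup>+c. emeasure P {\<omega>\<in>space P. cell N (X k \<omega>) = c \<and> cell N (X l \<omega>) = c} \<partial>count_space UNIV)"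
      unfolding eq by (rule emeasure_UN_countable) (use meas in \<open>auto simp: disjoint_family_on_def\<close>)
    also have "\<dots> \<le> (\<integral>\<^sup>+c. ennreal (1 / real (Suc N)) * emeasure P {\<omega>\<in>space P. cell N (X k \<omega>) = c} \<partial>count_space UNIV)"
      by (intro nn_integral_mono pair)
    also have "\<dots> = ennreal (1 / real (Suc N)) * (\<integral>\<^sup>+c. emeasure P {\<omega>\<in>space P. cell N (X k \<omega>) = c} \<partial>count_space UNIV)"
      by (rule nn_integral_cmult) simp
    also have "(\<integral>\<^sup>+c. emeasure P {\<omega>\<in>space P. cell N (X k \<omega>) = c} \<partial>count_space UNIV)
      = emeasure P (\<Union>c. {\<omega>\<in>space P. cell N (X k \<omega>) = c})"
      by (rule emeasure_UN_countable[symmetric]) (use meas in \<open>auto simp: disjoint_family_on_def\<close>)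
    also have "(\<Union>c. {\<omega>\<in>space P. cell N (X k \<omega>) = c}) = space P" by auto
    finally show "emeasure P {\<omega>\<in>space P. cell N (X k \<omega>) = cell N (X l \<omega>)} \<le> ennreal (1 / real (Suc N))"
      by (simp add: emeasure_space_1)
  qed
  define Z where "Z = (\<Inter>N. {\<omega>\<in>space P. cell N (X k \<omega>) = cell N (X l \<omega>)})"
  have "Z \<in> sets P" unfolding Z_def using meas2 by (intro sets.countable_INT) auto
  moreover have "emeasure P Z = 0"
  proof -
    have "prob Z \<le> 1 / real (Suc N)" for N
    proof -
      have "emeasure P Z \<le> ennreal (1 / real (Suc N))"
        by (rule order.trans[OF emeasure_mono small[of N]]) (use meas2 in \<open>auto simp: Z_def\<close>)
      then show ?thesis by (simp add: emeasure_eq_measure del: of_nat_Suc)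
    qed
    then have "prob Z \<le> 0"
      by (intro LIMSEQ_le_const[OF LIMSEQ_inverse_real_of_nat]) (auto simp: inverse_eq_divide)
    then show ?thesis by (simp add: emeasure_eq_measure measure_le_0_iff)
  qed
  ultimately have "Z \<in> null_sets P" by blast
  then show ?thesis
    by (rule AE_I') (auto simp: Z_def)
qed

lemma AE_distinct_points: "AE \<omega> in P. distinct_points (Y \<omega>) (\<lambda>k. X k \<omega>)"
proof -
  have "AE \<omega> in P. \<forall>k l. k \<noteq> l \<longrightarrow> X k \<omega> \<noteq> X l \<omega>"
  proof -
    have "AE \<omega> in P. k \<noteq> l \<longrightarrow> X k \<omega> \<noteq> X l \<omega>" for k l
      by (cases "k = l") (simp_all add: AE_X_distinct)
    then show ?thesis by (simp only: AE_all_countable) blast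
  qed
  with AE_X_in_circles show ?thesis
    by eventually_elim (auto simp: distinct_points_def inj_def)
qed

end

section \<open>Uniform phases\<close>

lemma norm_one_minus_cis: "norm (1 - cis t) = 2 * \<bar>sin (t / 2)\<bar>"
proof -
  have "(norm (1 - cis t))\<^sup>2 = (1 - cos t)\<^sup>2 + (sin t)\<^sup>2" by (simp add: cmod_power2)
  also have "\<dots> = 2 - 2 * cos t" using sin_cos_squared_add[of t] by (simp add: power2_eq_square algebra_simps)
  also have "\<dots> = (2 * \<bar>sin (t / 2)\<bar>)\<^sup>2" using cos_double_sin[of "t / 2"] by (simp add: power_mult_distrib)
  finally show ?thesis by (rule power2_eq_imp_eq) auto
qed

lemma sin_ge_third:
  assumes "0 \<le> t" "t \<le> pi / 2"
  shows "t / 3 \<le> sin t"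
proof -
  have "\<bar>sin t - (\<Sum>m<3. sin_coeff m * t ^ m)\<bar> \<le> inverse (fact 3) * \<bar>t\<bar> ^ 3"
    by (rule Maclaurin_sin_bound)
  moreover have "(\<Sum>m<3. sin_coeff m * t ^ m) = t" by (simp add: sin_coeff_def numeral_eq_Suc)
  moreover have "inverse (fact 3) * \<bar>t\<bar> ^ 3 = t ^ 3 / 6" using assms by (simp add: fact_numeral)
  ultimately have "t - t ^ 3 / 6 \<le> sin t" by linarith
  moreover have "t\<^sup>2 \<le> 4" using power_mono[of t 2 2] assms pi_half_less_two by simp
  then have "t ^ 3 \<le> 4 * t" using assms mult_left_mono[of "t\<^sup>2" 4 t] by (simp add: power2_eq_square power3_eq_cube mult_ac)
  ultimately show ?thesis by simp
qed

text \<open>The chord has length \<open>2 |sin (\<pi> x)|\<close>, and on the first quarter period the sine lies above a line.\<close>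

lemma norm_one_minus_cis_ge: "2 * dist_nearest_int x \<le> norm (1 - cis (2 * pi * x))"
proof -
  define d where "d = x - of_int (round x)"
  have d: "\<bar>d\<bar> \<le> 1 / 2" using of_int_round_abs_le[of x] by (simp add: d_def abs_minus_commute)
  have "cis (2 * pi * x) = cis (2 * pi * d + 2 * pi * of_int (round x))" by (simp add: d_def algebra_simps)
  also have "\<dots> = cis (2 * pi * d)" by (simp flip: cis_mult)
  finally have "norm (1 - cis (2 * pi * x)) = 2 * \<bar>sin (pi * d)\<bar>" by (simp add: norm_one_minus_cis)
  also have "\<bar>sin (pi * d)\<bar> = \<bar>sin (pi * \<bar>d\<bar>)\<bar>" by (simp add: abs_if)
  also have "2 * \<bar>sin (pi * \<bar>d\<bar>)\<bar> \<ge> 2 * (pi * \<bar>d\<bar> / 3)"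
    using sin_ge_third[of "pi * \<bar>d\<bar>"] d by (simp add: abs_le_iff)
  finally have "2 * (pi * \<bar>d\<bar> / 3) \<le> norm (1 - cis (2 * pi * x))" .
  moreover have "2 * \<bar>d\<bar> \<le> 2 * (pi * \<bar>d\<bar> / 3)" using pi_gt3 mult_right_mono[of 3 pi "\<bar>d\<bar>"] by simp
  ultimately show ?thesis by (simp add: dist_nearest_int_def d_def)
qed

lemma measurable_cis [measurable]: "(\<lambda>t. cis (2 * pi * t)) \<in> borel_measurable borel"
  by (intro borel_measurable_continuous_onI continuous_intros)

lemma uniform_unit_circle_near_1:
  assumes t: "0 < t"
  shows "measure uniform_unit_circle {z. norm (1 - z) < t} \<le> t"
proof -
  define L where "L = uniform_measure lborel {0..<1::real}"
  interpret L: prob_space L unfolding L_def by (rule prob_space_uniform_measure) auto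
  have op: "{z::complex. norm (1 - z) < t} \<in> sets borel"
    by (intro borel_open open_Collect_less continuous_intros)
  have Lb: "sets L = sets borel" "space L = UNIV" by (simp_all add: L_def)
  have m: "(\<lambda>t. cis (2 * pi * t)) \<in> L \<rightarrow>\<^sub>M borel" using measurable_cis Lb by (simp cong: measurable_cong_sets)
  have "measure uniform_unit_circle {z. norm (1 - z) < t} = measure L {s. norm (1 - cis (2 * pi * s)) < t}"
    unfolding uniform_unit_circle_def L_def[symmetric]
    by (subst measure_distr[OF m op]) (simp add: Lb vimage_def)
  also have "\<dots> = measure lborel ({0..<1} \<inter> {s. norm (1 - cis (2 * pi * s)) < t})"
  proof -
    have "{s. norm (1 - cis (2 * pi * s)) < t} \<in> sets borel"
      by (intro borel_open open_Collect_less continuous_intros)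
    then show ?thesis unfolding L_def measure_def
      by (subst emeasure_uniform_measure) (auto simp: divide_ennreal_def)
  qed
  also have "\<dots> \<le> measure lborel ({0..t/2} \<union> {1 - t/2..1})"
  proof (rule measure_mono_fmeasurable)
    show "{0..<1} \<inter> {s. norm (1 - cis (2 * pi * s)) < t} \<subseteq> {0..t/2} \<union> {1 - t/2..1}"
    proof
      fix s assume s: "s \<in> {0..<1} \<inter> {s. norm (1 - cis (2 * pi * s)) < t}"
      then have "dist_nearest_int s < t / 2" using norm_one_minus_cis_ge[of s] by auto
      then have d: "\<bar>s - of_int (round s)\<bar> < t / 2" by (simp add: dist_nearest_int_def)
      have "round s = 0 \<or> round s = 1"
      proof -
        have "0 \<le> round s" "round s \<le> 1" using round_mono[of 0 s] round_mono[of s 1] s by auto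
        then show ?thesis by linarith
      qed
      then show "s \<in> {0..t/2} \<union> {1 - t/2..1}" using d s by auto
    qed
    show "{0..<1} \<inter> {s. norm (1 - cis (2 * pi * s)) < t} \<in> sets lborel"
      by (intro sets.Int) (auto intro!: borel_open open_Collect_less continuous_intros)
    show "{0..t/2} \<union> {1 - t/2..1} \<in> fmeasurable lborel" by (intro fmeasurable.Un) (use t in \<open>simp_all add: fmeasurable_def\<close>)
  qed
  also have "\<dots> \<le> measure lborel {0..t/2} + measure lborel {1 - t/2..1}"
    by (rule measure_Un_le) auto
  also have "\<dots> = t" using t by simp
  finally show ?thesis .
qed

lemma (in prob_space) prob_phase_near_1:
  assumes U: "U \<in> borel_measurable M" "distr M borel U = uniform_unit_circle" and t: "0 < t"
  shows "prob {\<omega>\<in>space M. norm (1 - U \<omega>) < t} \<le> t" "{\<omega>\<in>space M. norm (1 - U \<omega>) < t} \<in> events"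
proof -
  have op: "{z::complex. norm (1 - z) < t} \<in> sets borel"
    by (intro borel_open open_Collect_less continuous_intros)
  have "prob {\<omega>\<in>space M. norm (1 - U \<omega>) < t} = measure uniform_unit_circle {z. norm (1 - z) < t}"
    unfolding U(2)[symmetric] by (subst measure_distr[OF U(1) op]) (simp add: vimage_def Int_def conj_commute)
  then show "prob {\<omega>\<in>space M. norm (1 - U \<omega>) < t} \<le> t" using uniform_unit_circle_near_1[OF t] by simp
  show "{\<omega>\<in>space M. norm (1 - U \<omega>) < t} \<in> events"
    using measurable_sets[OF U(1) op] by (simp add: vimage_def Int_def conj_commute)
qed

section \<open>Convergence of the frequencies\<close>

text \<open>The size of the inverse distances \<open>1 / |1 - u j|\<close> that occurs for uniform phases: the probabilities
  \<open>1 / wt j\<close> of larger values are summable.\<close>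

abbreviation wt :: "nat \<Rightarrow> real" where
  "wt j \<equiv> real (Suc j) ^ 2"

lemma summable_inverse_wt: "summable (\<lambda>j. 1 / wt j)"
  using inverse_power_summable[of 2] by (subst summable_Suc_iff[of "\<lambda>j. 1 / (real j)\<^sup>2"]) (simp add: inverse_eq_divide)

definition geometric_decay :: "(nat \<Rightarrow> real) \<Rightarrow> bool" where
  "geometric_decay y \<longleftrightarrow> (\<exists>C>0. \<exists>r\<in>{0<..<1}. \<forall>j. y j \<le> C * r ^ Suc j)"

text \<open>Split \<open>r\<^bsup>\<tau>\<^esup>\<close> into \<open>p + 1\<close> equal factors: \<open>p\<close> of them absorb the polynomial, the last one is a
  geometric series.\<close>

lemma summable_power_powr:
  assumes y: "geometric_decay y" "\<And>j. 0 \<le> y j" and \<tau>: "0 < \<tau>"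
  shows "summable (\<lambda>j. real (Suc j) ^ p * y j powr \<tau>)"
proof -
  obtain C r where C: "C > 0" and r: "0 < r" "r < 1" and le: "\<And>j. y j \<le> C * r ^ Suc j"
    using y(1) by (auto simp: geometric_decay_def)
  \<comment> \<open>The (p + 1)-st root of r powr \<tau>.\<close>
  define s where "s = r powr (\<tau> / real (Suc p))"
  have s: "0 < s" "s < 1" using r \<tau> powr_less_mono2[of "\<tau> / real (Suc p)" r 1] by (auto simp: s_def)
  have "(\<lambda>n. real n * s ^ n) \<longlonglongrightarrow> 0" using s by (intro powser_times_n_limit_0) auto
  then have "Bseq (\<lambda>n. real n * s ^ n)" by (intro convergent_imp_Bseq convergentI)
  then obtain K where K: "\<And>n. \<bar>real n * s ^ n\<bar> \<le> K" by (auto simp: Bseq_def)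
  have A: "norm (real (Suc j) ^ p * y j powr \<tau>) \<le> C powr \<tau> * K ^ p * s ^ Suc j" for j
  proof -
    have s3: "r powr \<tau> = s ^ Suc p"
    proof -
      have "s ^ Suc p = s powr real (Suc p)" using s by (simp add: powr_realpow del: of_nat_Suc power_Suc)
      also have "\<dots> = r powr \<tau>" by (simp add: s_def powr_powr del: of_nat_Suc)
      finally show ?thesis by simp
    qed
    have "y j powr \<tau> \<le> (C * r ^ Suc j) powr \<tau>" using le y \<tau> by (intro powr_mono2) auto
    also have "\<dots> = C powr \<tau> * (r powr \<tau>) ^ Suc j"
      using C r by (simp add: powr_mult powr_power powr_powr mult.commute flip: powr_realpow)
    also have "\<dots> = C powr \<tau> * (s ^ Suc j) ^ p * s ^ Suc j"
    proof -
      have "(s ^ Suc p) ^ Suc j = (s ^ Suc j) ^ Suc p" by (simp only: power_mult[symmetric] mult.commute)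
      then show ?thesis unfolding s3 by (simp only: power_Suc mult_ac)
    qed
    finally have "real (Suc j) ^ p * y j powr \<tau> \<le> real (Suc j) ^ p * (C powr \<tau> * (s ^ Suc j) ^ p * s ^ Suc j)"
      by (rule mult_left_mono) simp
    also have "\<dots> = C powr \<tau> * (real (Suc j) * s ^ Suc j) ^ p * s ^ Suc j"
      by (simp only: power_mult_distrib mult_ac)
    also have "\<dots> \<le> C powr \<tau> * K ^ p * s ^ Suc j"
      using s K[of "Suc j"] by (intro mult_right_mono mult_left_mono power_mono) auto
    finally show ?thesis by simp
  qed
  have B: "summable (\<lambda>j. C powr \<tau> * K ^ p * s ^ Suc j)"
    using s by (intro summable_mult summable_Suc_iff[THEN iffD2] summable_geometric) auto
  show ?thesis by (rule summable_comparison_test'[OF B, of 0]) (rule A)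
qed

lemma summable_wt:
  assumes y: "geometric_decay y" "\<And>j. 0 \<le> y j"
  shows "summable (\<lambda>j. wt j * y j)" "summable (\<lambda>j. wt j * sqrt (y j))"
  using summable_power_powr[OF y, of 1 2] summable_power_powr[OF y, of "1/2" 2] y(2)
  by (simp_all add: powr_half_sqrt)

text \<open>The weight stands for the denominators in \<^const>\<open>xi_gap\<close>.\<close>

definition freq_error :: "(nat \<Rightarrow> real) \<Rightarrow> nat \<Rightarrow> nat list \<Rightarrow> nat \<Rightarrow> real" where
  "freq_error y n xs j = wt j * \<bar>circle_freq n xs j - y j\<bar>"

lemma summable_freq_error:
  assumes y: "summable (\<lambda>j. wt j * y j)" "\<And>j. 0 \<le> y j"
  shows "summable (freq_error y n xs)"
proof -
  have "summable (\<lambda>j. wt j * circle_freq n xs j)"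
    by (rule summable_finite[of "set xs"]) (auto simp: circle_freq_def count_list_0_iff)
  from summable_add[OF this y(1)] show ?thesis
  proof (rule summable_comparison_test'[of _ 0])
    fix j
    have "\<bar>circle_freq n xs j - y j\<bar> \<le> circle_freq n xs j + y j"
      using y(2)[of j] by (simp add: abs_le_iff circle_freq_def)
    from mult_left_mono[OF this, of "wt j"]
    show "norm (freq_error y n xs j) \<le> wt j * circle_freq n xs j + wt j * y j"
      by (simp add: freq_error_def abs_mult ring_distribs(1) del: of_nat_Suc)
  qed
qed

text \<open>The counts increase with \<open>n\<close>, so between two fourth powers the frequencies are squeezed between
  those at the end points up to the ratio \<open>\<rho>\<close> of the end points, which tends to \<open>1\<close>.\<close>

lemma freq_error_interpolate:
  assumes m: "0 < m" "m ^ 4 \<le> n" "n \<le> Suc m ^ 4" and y: "0 \<le> y j"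
    and mono: "count_list (X (m ^ 4)) j \<le> count_list (X n) j" "count_list (X n) j \<le> count_list (X (Suc m ^ 4)) j"
  defines "\<rho> \<equiv> (real (Suc m) / real m) ^ 4"
  shows "freq_error y n (X n) j \<le> \<rho> * (freq_error y (m ^ 4) (X (m ^ 4)) j + freq_error y (Suc m ^ 4) (X (Suc m ^ 4)) j)
    + (\<rho> - 1) * (wt j * y j)"
proof -
  define M where "M = real (m ^ 4)" define N where "N = real (Suc m ^ 4)"
  have MN: "0 < M" "M \<le> real n" "real n \<le> N" "\<rho> = N / M"
    using m unfolding M_def N_def of_nat_le_iff by (simp_all add: \<rho>_def power_divide del: of_nat_Suc)
  define a b c where "a = real (count_list (X (m ^ 4)) j)" and "b = real (count_list (X n) j)"
    and "c = real (count_list (X (Suc m ^ 4)) j)"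
  have abc: "0 \<le> a" "a \<le> b" "b \<le> c" using mono by (auto simp: a_def b_def c_def)
  have \<rho>1: "1 \<le> \<rho>" using MN by simp
  have up: "b / real n \<le> \<rho> * (c / N)"
  proof -
    have "b / real n \<le> c / M" using abc MN by (intro frac_le) auto
    then show ?thesis using MN by simp
  qed
  have lo: "a / M \<le> \<rho> * (b / real n)"
  proof -
    have "a / M \<le> b / M" using abc MN by (intro divide_right_mono) auto
    also have "\<dots> = \<rho> * (b / N)" using MN by simp
    also have "\<dots> \<le> \<rho> * (b / real n)" using abc MN \<rho>1 by (intro mult_left_mono divide_left_mono) auto
    finally show ?thesis .
  qed
  have "\<bar>b / real n - y j\<bar> \<le> \<rho> * (\<bar>a / M - y j\<bar> + \<bar>c / N - y j\<bar>) + (\<rho> - 1) * y j"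
  proof -
    have 1: "b / real n - y j \<le> \<rho> * \<bar>c / N - y j\<bar> + (\<rho> - 1) * y j"
    proof -
      have "\<rho> * (c / N - y j) \<le> \<rho> * \<bar>c / N - y j\<bar>" using \<rho>1 by (intro mult_left_mono) auto
      then show ?thesis using up by (simp add: algebra_simps)
    qed
    have 2: "y j - b / real n \<le> \<rho> * \<bar>a / M - y j\<bar> + (\<rho> - 1) * y j"
    proof (cases "b / real n \<le> y j")
      case True
      have "y j - b / real n \<le> \<rho> * (y j - b / real n)"
        using mult_right_mono[OF \<rho>1, of "y j - b / real n"] True by simp
      also have "\<dots> \<le> \<rho> * y j - a / M" using lo by (simp add: algebra_simps)
      also have "\<dots> \<le> (\<rho> - 1) * y j + \<bar>a / M - y j\<bar>" by (simp add: algebra_simps)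
      also have "\<dots> \<le> (\<rho> - 1) * y j + \<rho> * \<bar>a / M - y j\<bar>"
        using mult_right_mono[OF \<rho>1, of "\<bar>a / M - y j\<bar>"] by simp
      finally show ?thesis by simp
    next
      case False
      then have "y j - b / real n \<le> 0" by simp
      also have "0 \<le> \<rho> * \<bar>a / M - y j\<bar> + (\<rho> - 1) * y j" using \<rho>1 y by simp
      finally show ?thesis .
    qed
    have "0 \<le> \<rho> * \<bar>a / M - y j\<bar>" "0 \<le> \<rho> * \<bar>c / N - y j\<bar>" using \<rho>1 by auto
    then show ?thesis using 1 2 by (auto simp: abs_le_iff ring_distribs(1))
  qed
  then have "wt j * \<bar>b / real n - y j\<bar> \<le> wt j * (\<rho> * (\<bar>a / M - y j\<bar> + \<bar>c / N - y j\<bar>) + (\<rho> - 1) * y j)"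
    by (rule mult_left_mono) simp
  then show ?thesis
    unfolding freq_error_def circle_freq_def a_def[symmetric] b_def[symmetric] c_def[symmetric] M_def[symmetric] N_def[symmetric]
    by (simp only: ring_distribs mult_ac)
qed

lemma freq_error_tendsto_interpolate:
  assumes y: "summable (\<lambda>j. wt j * y j)" "\<And>j. 0 \<le> y j"
    and mono: "\<And>m n j. m \<le> n \<Longrightarrow> count_list (X m) j \<le> count_list (X n) j"
    and lim: "(\<lambda>m. \<Sum>j. freq_error y (Suc m ^ 4) (X (Suc m ^ 4)) j) \<longlonglongrightarrow> 0"
  shows "(\<lambda>n. \<Sum>j. freq_error y n (X n) j) \<longlonglongrightarrow> 0"
proof -
  define D where "D = (\<lambda>n. \<Sum>j. freq_error y n (X n) j)"
  define S where "S = (\<Sum>j. wt j * y j)"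
  note sf = summable_freq_error[OF y]
  have D0: "0 \<le> D n" for n unfolding D_def by (rule suminf_nonneg[OF sf]) (simp add: freq_error_def)
  define \<rho> where "\<rho> = (\<lambda>m. (real (Suc m) / real m) ^ 4)"
  define B where "B = (\<lambda>m. \<rho> m * (D (m ^ 4) + D (Suc m ^ 4)) + (\<rho> m - 1) * S)"
  have bound: "D n \<le> B m" if m: "0 < m" "m ^ 4 \<le> n" "n \<le> Suc m ^ 4" for m n
  proof -
    have "D n \<le> (\<Sum>j. \<rho> m * (freq_error y (m ^ 4) (X (m ^ 4)) j + freq_error y (Suc m ^ 4) (X (Suc m ^ 4)) j)
      + (\<rho> m - 1) * (wt j * y j))"
      unfolding D_def \<rho>_def
      by (intro suminf_le freq_error_interpolate m y mono sf summable_add summable_mult)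
    also have "\<dots> = B m"
      unfolding B_def D_def S_def
      by (rule sums_unique[symmetric]) (intro sums_add sums_mult summable_sums sf y)
    finally show ?thesis .
  qed
  have l1: "(\<lambda>m. D (Suc m ^ 4)) \<longlonglongrightarrow> 0" using lim by (simp add: D_def)
  then have l0: "(\<lambda>m. D (m ^ 4)) \<longlonglongrightarrow> 0" by (rule LIMSEQ_imp_Suc)
  have \<rho>1: "\<rho> \<longlonglongrightarrow> 1"
  proof -
    have "(\<lambda>m. real (Suc m) / real m) \<longlonglongrightarrow> 1" by (rule LIMSEQ_Suc_n_over_n)
    from tendsto_power[OF this, of 4] show ?thesis by (simp add: \<rho>_def)
  qed
  have "B \<longlonglongrightarrow> 1 * (0 + 0) + (1 - 1) * S"
    unfolding B_def by (intro tendsto_intros l0 l1 \<rho>1)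
  then have B: "B \<longlonglongrightarrow> 0" by simp
  show ?thesis
  proof (rule LIMSEQ_I)
    fix e :: real assume "0 < e"
    then obtain M where M: "\<And>m. m \<ge> M \<Longrightarrow> \<bar>B m\<bar> < e" using B by (auto simp: LIMSEQ_iff)
    show "\<exists>no. \<forall>n\<ge>no. norm ((\<Sum>j. freq_error y n (X n) j) - 0) < e"
    proof (intro exI allI impI)
      fix n assume n: "Suc M ^ 4 \<le> n"
      define m where "m = (LEAST k. n < Suc k ^ 4)"
      have "n < Suc n ^ 4" using self_le_power[of "Suc n" 4] by linarith
      then have m1: "n < Suc m ^ 4" unfolding m_def by (rule LeastI)
      have mM: "Suc M \<le> m"
      proof (rule ccontr)
        assume "\<not> Suc M \<le> m"
        then have "Suc m ^ 4 \<le> Suc M ^ 4" by (intro power_mono) auto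
        then show False using m1 n by linarith
      qed
      then obtain k where k: "m = Suc k" by (cases m) auto
      have "\<not> n < Suc k ^ 4" using not_less_Least[of k "\<lambda>k. n < Suc k ^ 4"] k by (simp add: m_def)
      then have "m ^ 4 \<le> n" by (simp only: k not_less)
      moreover have "n \<le> Suc m ^ 4" using m1 by (rule less_imp_le)
      ultimately have "D n \<le> B m" using mM by (intro bound) auto
      then show "norm ((\<Sum>j. freq_error y n (X n) j) - 0) < e"
        using M[of m] mM D0[of n] by (simp add: D_def)
    qed
  qed
qed

text \<open>The standard deviation of a binomial count produces the square root of the perimeter, which is still
  summable against the weights.\<close>

lemma nn_integral_freq_error:
  assumes y: "y \<in> nabla'" and n: "0 < n"
  shows "(\<integral>\<^sup>+xs. ennreal (freq_error y n xs j) \<partial>replicate_pmf n (circle_pmf y))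
    \<le> ennreal (wt j * sqrt (y j) / sqrt (real n))"
proof -
  define f where "f = (\<lambda>k. wt j * \<bar>real k / real n - y j\<bar>)"
  note y01 = nabla'_props(1,2)[OF y, of j]
  have eq: "freq_error y n xs j = f (count_list xs j)" for xs
    by (simp add: freq_error_def circle_freq_def f_def)
  have fin: "integrable (replicate_pmf n (circle_pmf y)) (\<lambda>xs. f (count_list xs j))"
  proof (rule measure_pmf.integrable_const_bound[where B="wt j * 1"])
    show "AE xs in replicate_pmf n (circle_pmf y). norm (f (count_list xs j)) \<le> wt j * 1"
      unfolding AE_measure_pmf_iff
    proof
      fix xs assume "xs \<in> set_pmf (replicate_pmf n (circle_pmf y))"
      then have len: "length xs = n" by (simp add: set_replicate_pmf)
      have "\<bar>circle_freq n xs j - y j\<bar> \<le> 1"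
        using circle_freq_unit[OF len, of j] y01 unfolding atLeastAtMost_iff by linarith
      then have "\<bar>real (count_list xs j) / real n - y j\<bar> \<le> 1" unfolding circle_freq_def .
      then show "norm (f (count_list xs j)) \<le> wt j * 1"
        unfolding f_def by (simp add: abs_mult del: of_nat_Suc mult_1_right)
    qed
  qed simp
  have "(\<integral>\<^sup>+xs. ennreal (freq_error y n xs j) \<partial>replicate_pmf n (circle_pmf y))
    = ennreal (measure_pmf.expectation (replicate_pmf n (circle_pmf y)) (\<lambda>xs. f (count_list xs j)))"
    unfolding eq by (rule nn_integral_eq_integral[OF fin]) (simp add: f_def)
  also have "measure_pmf.expectation (replicate_pmf n (circle_pmf y)) (\<lambda>xs. f (count_list xs j))
    = (\<Sum>k\<le>n. Bernstein n k (y j) *\<^sub>R f k)"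
    unfolding expectation_count_list by (simp add: pmf_circle_pmf_nabla'[OF y])
  also have "\<dots> = wt j / real n * (\<Sum>k\<le>n. Bernstein n k (y j) * \<bar>real k - real n * y j\<bar>)"
    unfolding sum_distrib_left
  proof (rule sum.cong[OF refl])
    fix k
    have "\<bar>real k / real n - y j\<bar> = \<bar>real k - real n * y j\<bar> / real n"
    proof -
      have "real k / real n - y j = (real k - real n * y j) / real n" using n by (simp add: field_simps)
      then show ?thesis by (simp add: abs_divide)
    qed
    then show "Bernstein n k (y j) *\<^sub>R f k = wt j / real n * (Bernstein n k (y j) * \<bar>real k - real n * y j\<bar>)"
      by (simp add: f_def)
  qed
  also have "\<dots> \<le> wt j / real n * sqrt (real n * y j * (1 - y j))"
    using y01 by (intro mult_left_mono sum_Bernstein_abs_deviation) auto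
  also have "\<dots> \<le> wt j / real n * sqrt (real n * y j)"
    using y01 by (intro mult_left_mono real_sqrt_le_mono) (auto simp: mult_left_le)
  also have "\<dots> = wt j * sqrt (y j) / sqrt (real n)"
    using n by (simp add: real_sqrt_mult field_simps del: of_nat_Suc)
  finally show ?thesis by (simp add: ennreal_leI)
qed

context circle_points begin

text \<open>Along fourth powers the mean errors are of order \<open>1 / m\<^sup>2\<close> and hence summable. The sets \<open>A C\<close> are
  needed because the sum of \<open>wt j * sqrt (Y j)\<close> is finite almost surely but may fail to be
  integrable.\<close>

lemma AE_freq_error_subsequence:
  assumes dec: "AE \<omega> in P. geometric_decay (Y \<omega>)"
  shows "AE \<omega> in P. (\<lambda>m. \<Sum>j. freq_error (Y \<omega>) (Suc m ^ 4) (circle_list (Suc m ^ 4) \<omega>) j) \<longlonglongrightarrow> 0"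
proof -
  define S where "S = (\<lambda>y :: nat \<Rightarrow> real. \<Sum>j. ennreal (wt j * sqrt (y j)))"
  \<comment> \<open>On A C the conditional mean of the error is at most C / (m + 1)^2.\<close>
  define A where "A = (\<lambda>C :: nat. {y. S y \<le> of_nat C})"
  define N where "N = (\<lambda>m. Suc m ^ 4)"
  define h where "h = (\<lambda>C m y xs. indicator (A C) y * (\<Sum>j. ennreal (freq_error y (N m) xs j)))"
  have Sm: "S \<in> borel_measurable seq_borel"
    unfolding S_def
    by (intro borel_measurable_suminf_order measurable_compose[OF _ measurable_ennreal]
        borel_measurable_times borel_measurable_const measurable_compose[OF measurable_coord_seq_borel borel_measurable_sqrt])
  have A: "A C \<in> sets seq_borel" for C
    using borel_measurable_le[OF Sm borel_measurable_const[of "of_nat C"]] by (simp add: A_def)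
  have hm: "(\<lambda>y. h C m y xs) \<in> borel_measurable seq_borel" for C m xs
    unfolding h_def freq_error_def
    by (intro borel_measurable_times_ennreal borel_measurable_suminf_order measurable_compose[OF _ measurable_ennreal]
        borel_measurable_indicator A borel_measurable_times borel_measurable_const borel_measurable_abs
        borel_measurable_diff measurable_coord_seq_borel)
  have hY: "(\<lambda>\<omega>. h C m (Y \<omega>) (circle_list (N m) \<omega>)) \<in> borel_measurable P" for C m
    by (rule measurable_compose_countable[OF measurable_compose[OF measurable_Y hm] measurable_circle_list])
  have le: "(\<integral>\<^sup>+\<omega>. h C m (Y \<omega>) (circle_list (N m) \<omega>) \<partial>P) \<le> ennreal (real C / (real (Suc m))\<^sup>2)" for C m
  proof -
    have Nm: "0 < N m" by (simp add: N_def)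
    have sq: "sqrt (real (N m)) = (real (Suc m))\<^sup>2"
      unfolding N_def of_nat_power by (rule real_sqrt_unique) (simp_all flip: power_mult)
    have "(\<integral>\<^sup>+\<omega>. h C m (Y \<omega>) (circle_list (N m) \<omega>) \<partial>P)
      = (\<integral>\<^sup>+\<omega>. (\<integral>\<^sup>+xs. h C m (Y \<omega>) xs \<partial>replicate_pmf (N m) (circle_pmf (Y \<omega>))) \<partial>P)"
      by (rule nn_integral_circle_list(1)[OF hm])
    also have "\<dots> \<le> (\<integral>\<^sup>+\<omega>. ennreal (real C / (real (Suc m))\<^sup>2) \<partial>P)"
    proof (rule nn_integral_mono_AE)
      show "AE \<omega> in P. (\<integral>\<^sup>+xs. h C m (Y \<omega>) xs \<partial>replicate_pmf (N m) (circle_pmf (Y \<omega>)))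
        \<le> ennreal (real C / (real (Suc m))\<^sup>2)"
        using Y_nabla'
      proof eventually_elim
        case (elim \<omega>)
        define y where "y = Y \<omega>"
        have y: "y \<in> nabla'" using elim by (simp add: y_def)
        have "(\<integral>\<^sup>+xs. h C m y xs \<partial>replicate_pmf (N m) (circle_pmf y))
          = indicator (A C) y * (\<Sum>j. \<integral>\<^sup>+xs. ennreal (freq_error y (N m) xs j) \<partial>replicate_pmf (N m) (circle_pmf y))"
          unfolding h_def by (subst nn_integral_cmult; (subst nn_integral_suminf)?) simp_all
        also have "\<dots> \<le> indicator (A C) y * (\<Sum>j. ennreal (wt j * sqrt (y j) / sqrt (real (N m))))"
          by (intro mult_left_mono suminf_le nn_integral_freq_error y Nm) auto
        also have "(\<Sum>j. ennreal (wt j * sqrt (y j) / sqrt (real (N m)))) = (\<Sum>j. ennreal (wt j * sqrt (y j))) * ennreal (1 / (real (Suc m))\<^sup>2)"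
        proof -
          have "ennreal (wt j * sqrt (y j) / sqrt (real (N m))) = ennreal (wt j * sqrt (y j)) * ennreal (1 / (real (Suc m))\<^sup>2)" for j
            unfolding sq by (subst ennreal_mult[symmetric]) (simp_all add: nabla'_props(1)[OF y] del: of_nat_Suc)
          then show ?thesis by (simp only: ennreal_suminf_multc)
        qed
        also have "indicator (A C) y * ((\<Sum>j. ennreal (wt j * sqrt (y j))) * ennreal (1 / (real (Suc m))\<^sup>2))
          \<le> of_nat C * ennreal (1 / (real (Suc m))\<^sup>2)"
          by (cases "y \<in> A C") (simp_all add: A_def S_def mult_right_mono del: of_nat_Suc)
        also have "\<dots> = ennreal (real C / (real (Suc m))\<^sup>2)"
          by (simp add: ennreal_of_nat_eq_real_of_nat ennreal_mult[symmetric] del: of_nat_Suc)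
        finally show ?case by (simp add: y_def)
      qed
    qed
    also have "\<dots> = ennreal (real C / (real (Suc m))\<^sup>2)" by (simp add: emeasure_space_1 del: of_nat_Suc)
    finally show ?thesis .
  qed
  have fin: "AE \<omega> in P. (\<Sum>m. h C m (Y \<omega>) (circle_list (N m) \<omega>)) \<noteq> \<infinity>" for C
  proof (rule nn_integral_PInf_AE)
    show "(\<lambda>\<omega>. \<Sum>m. h C m (Y \<omega>) (circle_list (N m) \<omega>)) \<in> borel_measurable P"
      by (intro borel_measurable_suminf_order hY)
    have "(\<integral>\<^sup>+\<omega>. (\<Sum>m. h C m (Y \<omega>) (circle_list (N m) \<omega>)) \<partial>P)
      = (\<Sum>m. \<integral>\<^sup>+\<omega>. h C m (Y \<omega>) (circle_list (N m) \<omega>) \<partial>P)"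
      by (rule nn_integral_suminf) (rule hY)
    also have "\<dots> \<le> (\<Sum>m. ennreal (real C / (real (Suc m))\<^sup>2))" by (intro suminf_le le) auto
    also have "\<dots> < \<infinity>"
    proof -
      have "summable (\<lambda>m. inverse ((real (Suc m))\<^sup>2))"
        using inverse_power_summable[of 2] by (subst summable_Suc_iff) simp
      then have "summable (\<lambda>m. real C / (real (Suc m))\<^sup>2)"
        unfolding divide_inverse by (rule summable_mult)
      then have "(\<Sum>m. ennreal (real C / (real (Suc m))\<^sup>2)) \<noteq> \<top>" by (rule ennreal_suminf_neq_top) simp
      then show ?thesis by (simp only: infinity_ennreal_def less_top[symmetric] simp_thms)
    qed
    finally show "(\<integral>\<^sup>+\<omega>. (\<Sum>m. h C m (Y \<omega>) (circle_list (N m) \<omega>)) \<partial>P) \<noteq> \<infinity>" by simp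
  qed
  then have "AE \<omega> in P. \<forall>C. (\<Sum>m. h C m (Y \<omega>) (circle_list (N m) \<omega>)) \<noteq> \<infinity>"
    by (simp only: AE_all_countable) blast
  then show ?thesis using Y_nabla' dec
  proof eventually_elim
    case (elim \<omega>)
    note y = nabla'_props(1)[OF elim(2)]
    have "summable (\<lambda>j. wt j * sqrt (Y \<omega> j))" by (rule summable_wt(2)[OF elim(3) y])
    then have "S (Y \<omega>) \<noteq> \<top>" unfolding S_def by (rule ennreal_suminf_neq_top) (simp add: y)
    then have "S (Y \<omega>) < \<top>" by (simp only: less_top[symmetric] simp_thms)
    then obtain C :: nat where C: "S (Y \<omega>) \<le> of_nat C"
      using ennreal_Ex_less_of_nat less_imp_le by blast
    have sum: "(\<Sum>j. ennreal (freq_error (Y \<omega>) n xs j)) = ennreal (\<Sum>j. freq_error (Y \<omega>) n xs j)" for n xs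
      by (rule suminf_ennreal2[OF _ summable_freq_error[OF summable_wt(1)[OF elim(3) y] y]]) (simp add: freq_error_def)
    have nn: "0 \<le> (\<Sum>j. freq_error (Y \<omega>) n xs j)" for n xs
      by (rule suminf_nonneg[OF summable_freq_error[OF summable_wt(1)[OF elim(3) y] y]]) (simp add: freq_error_def)
    have "(\<Sum>m. ennreal (\<Sum>j. freq_error (Y \<omega>) (N m) (circle_list (N m) \<omega>) j)) \<noteq> \<infinity>"
      using elim(1)[rule_format, of C] C by (simp add: h_def A_def sum)
    then have "summable (\<lambda>m. \<Sum>j. freq_error (Y \<omega>) (N m) (circle_list (N m) \<omega>) j)"
      by (intro summable_suminf_not_top nn) auto
    then show ?case unfolding N_def by (rule summable_LIMSEQ_zero)
  qed
qed

lemma AE_freq_error_tendsto_0: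
  assumes dec: "AE \<omega> in P. geometric_decay (Y \<omega>)"
  shows "AE \<omega> in P. (\<lambda>n. \<Sum>j. freq_error (Y \<omega>) n (circle_list n \<omega>) j) \<longlonglongrightarrow> 0"
  using AE_freq_error_subsequence[OF dec] Y_nabla' dec
proof eventually_elim
  case (elim \<omega>)
  note y = nabla'_props(1)[OF elim(2)]
  show ?case
  proof (rule freq_error_tendsto_interpolate[OF summable_wt(1)[OF elim(3) y] y _ elim(1)])
    fix m n j :: nat assume "m \<le> n"
    then show "count_list (circle_list m \<omega>) j \<le> count_list (circle_list n \<omega>) j"
      unfolding circle_list_def by (induction rule: dec_induct) auto
  qed
qed

end

text \<open>By Borel-Cantelli the bound \<open>1 / wt j\<close> is violated for finitely many \<open>j\<close> only, and the constant
  absorbs these.\<close>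

lemma (in prob_space) AE_phase_bound:
  assumes U: "\<And>j. U j \<in> borel_measurable M" "\<And>j. distr M borel (U j) = uniform_unit_circle"
  shows "AE \<omega> in M. (\<forall>j. U j \<omega> \<noteq> 1) \<and> (\<exists>c>0. \<forall>j. c / wt j \<le> norm (1 - U j \<omega>))"
proof -
  note near = prob_phase_near_1[OF U]
  have ne: "AE \<omega> in M. U j \<omega> \<noteq> 1" for j
  proof -
    have "{\<omega>\<in>space M. U j \<omega> = 1} \<in> events"
      using measurable_sets[OF U(1), of "{1}" j] by (simp add: vimage_def Int_def conj_commute)
    moreover have "prob {\<omega>\<in>space M. U j \<omega> = 1} \<le> 0 + e" if "0 < e" for e
      by (rule order.trans[OF finite_measure_mono]) (use near(1)[OF that, of j] near(2)[OF that, of j] that in auto)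
    then have "prob {\<omega>\<in>space M. U j \<omega> = 1} \<le> 0" by (rule field_le_epsilon)
    ultimately show ?thesis by (subst prob_Collect_eq_0[symmetric]) (auto simp: measure_le_0_iff)
  qed
  have "AE \<omega> in M. eventually (\<lambda>j. \<omega> \<in> space M - {\<omega>\<in>space M. norm (1 - U j \<omega>) < 1 / wt j}) sequentially"
  proof (rule borel_cantelli_AE1[OF near(2)])
    show "summable (\<lambda>j. prob {\<omega>\<in>space M. norm (1 - U j \<omega>) < 1 / wt j})"
      by (rule summable_comparison_test'[OF summable_inverse_wt, of 0]) (use near(1) in auto)
  qed (simp_all add: emeasure_eq_measure)
  moreover have "AE \<omega> in M. \<forall>j. U j \<omega> \<noteq> 1" using ne by (simp only: AE_all_countable) blast
  ultimately show ?thesis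
  proof eventually_elim
    case (elim \<omega>)
    obtain J where J: "\<And>j. J \<le> j \<Longrightarrow> \<omega> \<in> space M - {\<omega>\<in>space M. norm (1 - U j \<omega>) < 1 / wt j}"
      using elim(1) by (auto simp: eventually_sequentially)
    define c where "c = Min (insert 1 ((\<lambda>j. norm (1 - U j \<omega>)) ` {..<J}))"
    have c1: "c \<le> 1" by (simp add: c_def)
    have c0: "c > 0" using elim(2) unfolding c_def by (subst Min_gr_iff) (auto simp: eq_commute[of 1])
    have "c / wt j \<le> norm (1 - U j \<omega>)" for j
    proof (cases "j < J")
      case True
      have "c / wt j \<le> c" using c0 by (simp add: divide_le_eq mult_le_cancel_left1 del: of_nat_Suc)
      also have "\<dots> \<le> norm (1 - U j \<omega>)" unfolding c_def by (rule Min_le) (use True in auto)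
      finally show ?thesis .
    next
      case False
      then have "1 / wt j \<le> norm (1 - U j \<omega>)" using J[of j] by (auto simp del: of_nat_Suc)
      then show ?thesis using divide_right_mono[OF c1, of "wt j"] by simp
    qed
    then show ?case using elim(2) c0 by blast
  qed
qed

section \<open>Diophantine approximation and binomial laws\<close>

lemma dist_nearest_int_le: "dist_nearest_int x \<le> \<bar>x - of_int k\<bar>"
  unfolding dist_nearest_int_def by (rule round_diff_minimal)

lemma dist_nearest_int_diff: "dist_nearest_int (x - y) \<le> dist_nearest_int x + dist_nearest_int y"
  using dist_nearest_int_le[of "x - y" "round x - round y"] by (simp add: dist_nearest_int_def)

lemma dist_nearest_int_pos:
  assumes "\<alpha> \<notin> \<rat>" "n \<noteq> 0"
  shows "0 < dist_nearest_int (real n * \<alpha>)"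
proof -
  have "real n * \<alpha> \<noteq> of_int (round (real n * \<alpha>))"
  proof
    assume "real n * \<alpha> = of_int (round (real n * \<alpha>))"
    then have "\<alpha> = of_int (round (real n * \<alpha>)) / of_nat n" using assms by (simp add: field_simps)
    then have "\<alpha> \<in> \<rat>" by (metis Rats_divide Rats_of_int Rats_of_nat)
    then show False using assms by simp
  qed
  then show ?thesis by (simp add: dist_nearest_int_def)
qed

text \<open>For an exponent beyond the type the lower limit is positive, which is the bound for large \<open>n\<close>; the
  remaining values are positive as \<open>\<alpha>\<close> is irrational, and the constant absorbs them.\<close>

lemma finite_type_lower_bound:
  assumes \<alpha>: "\<alpha> \<notin> \<rat>" and ft: "finite_type \<alpha>"
  obtains m c where "1 \<le> m" "0 < c" "c \<le> 1"
    "\<And>n. n \<noteq> 0 \<Longrightarrow> c / real n ^ m \<le> dist_nearest_int (real n * \<alpha>)"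
proof -
  note result = that
  define G where "G = {\<gamma>. liminf (\<lambda>n. ereal (real n powr \<gamma> * dist_nearest_int (real n * \<alpha>))) = 0}"
  have "Sup (ereal ` G) \<noteq> \<infinity>" using ft by (simp add: finite_type_def diophantine_type_def G_def)
  then obtain k where k: "Sup (ereal ` G) < ereal (real k)" using less_PInf_Ex_of_nat by auto
  \<comment> \<open>An integer exponent strictly above the type.\<close>
  define m where "m = Suc k"
  have "real m \<notin> G"
  proof
    assume "real m \<in> G"
    then have "ereal (real m) \<le> Sup (ereal ` G)" by (intro Sup_upper) simp
    also have "\<dots> < ereal (real k)" by (rule k)
    finally show False by (simp add: m_def)
  qed
  define f where "f = (\<lambda>n. real n powr real m * dist_nearest_int (real n * \<alpha>))"
  have "0 \<le> liminf (\<lambda>n. ereal (f n))"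
    by (rule Liminf_bounded) (simp add: f_def dist_nearest_int_def)
  moreover have "liminf (\<lambda>n. ereal (f n)) \<noteq> 0" using \<open>real m \<notin> G\<close> by (simp add: G_def f_def)
  ultimately have "0 < liminf (\<lambda>n. ereal (f n))" by simp
  then obtain e where e: "0 < ereal e" "ereal e < liminf (\<lambda>n. ereal (f n))" using ereal_dense2 by blast
  have "eventually (\<lambda>n. ereal e < ereal (f n)) sequentially" by (rule less_LiminfD[OF e(2)])
  then obtain N where N: "\<And>n. N \<le> n \<Longrightarrow> e < f n" by (auto simp: eventually_sequentially)
  define c where "c = Min (insert 1 (insert e (f ` {1..<N})))"
  have f: "f n = real n ^ m * dist_nearest_int (real n * \<alpha>)" if "n \<noteq> 0" for n
    using that by (simp add: f_def powr_realpow)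
  have c1: "c \<le> 1" by (simp add: c_def)
  have "0 < f n" if "n \<noteq> 0" for n
    using that dist_nearest_int_pos[OF \<alpha> that] by (simp add: f)
  then have c0: "0 < c" using e(1) unfolding c_def by (subst Min_gr_iff) auto
  have cf: "c \<le> f n" if "n \<noteq> 0" for n
  proof (cases "n < N")
    case True
    then show ?thesis unfolding c_def by (intro Min_le) (use that in auto)
  next
    case False
    then have "e < f n" using N by simp
    moreover have "c \<le> e" unfolding c_def by (rule Min_le) auto
    ultimately show ?thesis by simp
  qed
  have "c / real n ^ m \<le> dist_nearest_int (real n * \<alpha>)" if "n \<noteq> 0" for n
  proof -
    have "c \<le> dist_nearest_int (real n * \<alpha>) * real n ^ m"
      using cf[OF that] unfolding f[OF that] by (simp only: mult.commute)
    then show ?thesis using that by (subst pos_divide_le_eq) simp_all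
  qed
  then show ?thesis using result[of m c] c0 c1 by (simp add: m_def)
qed

text \<open>Two elements of \<open>D\<close> are at least \<open>H\<close> apart, since otherwise a multiple of \<open>\<alpha>\<close> with a factor below
  \<open>H\<close> would be within \<open>2 \<delta>\<close> of an integer. Hence the first \<open>H\<close> shifts of \<open>D\<close> are disjoint, and as
  each shift hardly changes the binomial mass, all these masses are close to the first one and sum to
  at most \<open>1\<close>.\<close>

lemma sum_Bernstein_near_integer:
  assumes q: "0 < q" "q < 1" and H: "0 < H"
    and gap: "\<And>h. h \<noteq> 0 \<Longrightarrow> h < H \<Longrightarrow> 2 * \<delta> \<le> dist_nearest_int (real h * \<alpha>)"
  defines "D \<equiv> {k. dist_nearest_int (real k * \<alpha>) < \<delta>}"
  shows "(\<Sum>k\<le>n. Bernstein n k q * indicator D k) \<le> 1 / real H + real H / sqrt (real (Suc n) * q * (1 - q))"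
proof -
  define s where "s = 1 / sqrt (real (Suc n) * q * (1 - q))"
  define e where "e = (\<lambda>h. \<Sum>k\<le>n. Bernstein n k q * indicat_real D (k + h))"
  have s0: "0 \<le> s" using q by (simp add: s_def)
  have step: "e h \<le> e (Suc h) + s" for h
  proof -
    have "\<bar>(\<Sum>k\<le>n. Bernstein n k q * indicat_real D (Suc k + h)) - (\<Sum>k\<le>n. Bernstein n k q * indicat_real D (k + h))\<bar> \<le> s"
      unfolding s_def by (rule sum_Bernstein_shift[OF q, of "\<lambda>k. indicat_real D (k + h)"]) (simp add: indicator_def)
    then show ?thesis by (simp add: e_def)
  qed
  have e0: "e 0 \<le> e h + real h * s" for h
  proof (induction h)
    case (Suc h)
    then show ?case using step[of h] by (simp add: ring_distribs)
  qed simp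
  have one: "(\<Sum>h<H. indicat_real D (k + h)) \<le> 1" for k
  proof (cases "\<exists>h<H. k + h \<in> D")
    case True
    then obtain h where h: "h < H" "k + h \<in> D" by blast
    have "k + h' \<notin> D" if "h' < H" "h' \<noteq> h" for h'
    proof
      assume h': "k + h' \<in> D"
      define a where "a = max h h'" define b where "b = min h h'"
      have ab: "b < a" "a < H" "k + a \<in> D" "k + b \<in> D" using h h' that by (auto simp: a_def b_def max_def min_def)
      have "2 * \<delta> \<le> dist_nearest_int (real (a - b) * \<alpha>)" by (rule gap) (use ab in auto)
      also have "real (a - b) * \<alpha> = real (k + a) * \<alpha> - real (k + b) * \<alpha>"
        using ab by (simp add: of_nat_diff algebra_simps)
      also have "dist_nearest_int \<dots> \<le> dist_nearest_int (real (k + a) * \<alpha>) + dist_nearest_int (real (k + b) * \<alpha>)"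
        by (rule dist_nearest_int_diff)
      also have "\<dots> < 2 * \<delta>" using ab(3,4) by (simp add: D_def)
      finally show False by simp
    qed
    then have "(\<Sum>h'<H. indicat_real D (k + h')) = (\<Sum>h'\<in>{h}. indicat_real D (k + h'))"
      using h by (intro sum.mono_neutral_right) auto
    also have "\<dots> = indicat_real D (k + h)" by (subst sum.insert, simp, simp, subst sum.empty) simp
    finally show ?thesis by (simp add: indicator_def)
  next
    case False
    then have "(\<Sum>h<H. indicat_real D (k + h)) = 0" by (intro sum.neutral) auto
    then show ?thesis by simp
  qed
  have "real H * e 0 = (\<Sum>h<H. e 0)" by simp
  also have "\<dots> \<le> (\<Sum>h<H. e h + real H * s)"
  proof (rule sum_mono)
    fix h assume "h \<in> {..<H}"
    then have "real h * s \<le> real H * s" using s0 by (intro mult_right_mono) auto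
    then show "e 0 \<le> e h + real H * s" using e0[of h] by simp
  qed
  also have "\<dots> = (\<Sum>h<H. e h) + real H * (real H * s)" by (simp add: sum.distrib)
  also have "(\<Sum>h<H. e h) = (\<Sum>k\<le>n. Bernstein n k q * (\<Sum>h<H. indicat_real D (k + h)))"
    unfolding e_def by (subst sum.swap) (simp add: sum_distrib_left)
  also have "\<dots> \<le> (\<Sum>k\<le>n. Bernstein n k q * 1)"
    using q one by (intro sum_mono mult_left_mono Bernstein_nonneg) auto
  also have "\<dots> = 1" by simp
  finally have "real H * e 0 \<le> 1 + real H * (real H * s)" by simp
  then have "e 0 \<le> (1 + real H * (real H * s)) / real H" using H by (simp add: pos_le_divide_eq mult.commute)
  also have "\<dots> = 1 / real H + real H * s" using H by (simp add: add_divide_distrib)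
  finally show ?thesis by (simp only: e_def s_def add_0_right mult_1_right times_divide_eq_right)
qed

section \<open>Locally uniform convergence and measurability of the limit\<close>

lemma continuous_on_xi_infinity: "xi_params y u \<Longrightarrow> continuous_on UNIV (xi_infinity y u)"
  by (intro holomorphic_on_imp_continuous_on xi_infinity_holomorphic)

text \<open>The topology is given by generating sets, so the proof is an induction on the generation of \<open>U\<close>. For
  a generating set the strict inequality on \<open>K\<close> leaves a margin, as the maximum is attained.\<close>

lemma eventually_in_compact_open:
  assumes U: "openin compact_convergence_topology U" and f: "f \<in> U"
    and cont: "\<And>n. continuous_on UNIV (g n)"
    and lim: "\<And>R e. 0 < e \<Longrightarrow> eventually (\<lambda>n. \<forall>z\<in>cball 0 R. dist (g n z) (f z) < e) sequentially"
  shows "eventually (\<lambda>n. g n \<in> U) sequentially"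
proof -
  have "generate_topology_on {{g. continuous_on UNIV g \<and> (\<forall>z\<in>K. dist (g z) (f z) < e)} | f K e.
          continuous_on UNIV (f :: complex \<Rightarrow> complex) \<and> compact K \<and> 0 < (e :: real)} U"
    using U unfolding compact_convergence_topology_def openin_topology_generated_by_iff .
  then show ?thesis using f
  proof induction
    case (Int a b)
    then show ?case by (auto intro: eventually_conj)
  next
    case (UN K)
    then obtain k where k: "k \<in> K" "f \<in> k" by blast
    then have "eventually (\<lambda>n. g n \<in> k) sequentially" using UN by blast
    then show ?case by eventually_elim (use k in blast)
  next
    case (Basis s)
    then obtain h K e where s: "s = {g. continuous_on UNIV g \<and> (\<forall>z\<in>K. dist (g z) (h z) < e)}"
      and h: "continuous_on UNIV h" and K: "compact K" and e: "0 < e" by blast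
    have fc: "continuous_on UNIV f" and fK: "\<And>z. z \<in> K \<Longrightarrow> dist (f z) (h z) < e"
      using Basis s by blast+
    show ?case
    proof (cases "K = {}")
      case True then show ?thesis using s cont by simp
    next
      case False
      obtain z0 where z0: "z0 \<in> K" "\<And>z. z \<in> K \<Longrightarrow> dist (f z) (h z) \<le> dist (f z0) (h z0)"
        using continuous_attains_sup[OF K False, of "\<lambda>z. dist (f z) (h z)"]
          continuous_on_dist[OF continuous_on_subset[OF fc] continuous_on_subset[OF h], of K] by auto
      obtain R where "\<And>z. z \<in> K \<Longrightarrow> norm z \<le> R" using compact_imp_bounded[OF K] unfolding bounded_iff by blast
      then have R: "K \<subseteq> cball 0 R" by auto
      have "0 < e - dist (f z0) (h z0)" using fK[OF z0(1)] by simp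
      from lim[OF this, of R] show ?thesis
      proof eventually_elim
        case (elim n)
        have "dist (g n z) (h z) < e" if "z \<in> K" for z
        proof -
          have "dist (g n z) (h z) \<le> dist (g n z) (f z) + dist (f z) (h z)" by (rule dist_triangle)
          also have "\<dots> < (e - dist (f z0) (h z0)) + dist (f z0) (h z0)"
            using elim z0(2)[OF that] that R by (intro add_less_le_mono) auto
          finally show ?thesis by simp
        qed
        then show ?case using s cont by simp
      qed
    qed
  qed simp
qed

lemma borel_measurable_continuous_map_real:
  assumes F: "continuous_map T euclideanreal F"
  shows "F \<in> borel_of T \<rightarrow>\<^sub>M borel"
proof (rule borel_measurableI)
  fix S :: "real set" assume "open S"
  then have "openin T {x \<in> topspace T. F x \<in> S}"
    using F by (simp add: continuous_map_def)
  moreover have "F -` S \<inter> space (borel_of T) = {x \<in> topspace T. F x \<in> S}"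
    by (auto simp: borel_of_def space_measure_of_conv)
  moreover have "{S. openin T S} \<subseteq> Pow (topspace (T))"
    using openin_subset by blast
  ultimately show "F -` S \<inter> space (borel_of T) \<in> sets (borel_of T)"
    by (simp add: borel_of_def sets_measure_of)
qed

lemma compact_continuous_map_tendsto:
  fixes F :: "(complex \<Rightarrow> complex) \<Rightarrow> real"
  assumes F: "continuous_map compact_convergence_topology euclideanreal F"
    and f: "continuous_on UNIV f" and cont: "\<And>n. continuous_on UNIV (g n)"
    and lim: "\<And>R e. 0 < e \<Longrightarrow> eventually (\<lambda>n. \<forall>z\<in>cball 0 R. dist (g n z) (f z) < e) sequentially"
  shows "(\<lambda>n. F (g n)) \<longlonglongrightarrow> F f"
proof (rule topological_tendstoI)
  fix V assume V: "open V" "F f \<in> V"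
  define U where "U = {x \<in> topspace compact_convergence_topology. F x \<in> V}"
  have "openin compact_convergence_topology U"
    unfolding U_def using F V by (simp add: continuous_map_def)
  moreover have "f \<in> U" using f V by (simp add: U_def topspace_compact_convergence_topology)
  ultimately have "eventually (\<lambda>n. g n \<in> U) sequentially" by (rule eventually_in_compact_open[OF _ _ cont lim])
  then show "eventually (\<lambda>n. F (g n) \<in> V) sequentially" by eventually_elim (simp add: U_def)
qed

text \<open>On a box with summable \<open>A j / b j\<close> the products converge uniformly, so that they depend continuously
  on the parameters even for coordinatewise convergence.\<close>

definition xi_box :: "(nat \<Rightarrow> real) \<Rightarrow> (nat \<Rightarrow> real) \<Rightarrow> ((nat \<Rightarrow> real) \<times> (nat \<Rightarrow> complex)) set" where
  "xi_box A b = {p. \<forall>j. fst p j \<in> {0..min 1 (A j)} \<and> b j \<le> norm (1 - snd p j)}"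

lemma xi_box_params:
  assumes p: "p \<in> xi_box A b" and b: "\<And>j. 0 < b j" and s: "summable (\<lambda>j. A j / b j)"
  shows "xi_params (fst p) (snd p)" "xi_mass (fst p) (snd p) j \<le> A j / b j"
proof -
  have p: "fst p j \<in> {0..min 1 (A j)}" "b j \<le> norm (1 - snd p j)" for j using p by (auto simp: xi_box_def)
  have le: "xi_mass (fst p) (snd p) j \<le> A j / b j" for j
    unfolding xi_mass_def using p[of j] b[of j] by (intro frac_le) auto
  then show "xi_mass (fst p) (snd p) j \<le> A j / b j" .
  have "snd p j \<noteq> 1" for j using p(2)[of j] b[of j] by auto
  moreover have "summable (xi_mass (fst p) (snd p))"
    by (rule summable_comparison_test'[OF s, of 0]) (use le p in \<open>auto simp: xi_mass_def\<close>)
  ultimately show "xi_params (fst p) (snd p)" using p(1) by (auto simp: xi_params_def)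
qed

text \<open>Each term of the gap tends to zero and is dominated by a multiple of \<open>A j / b j\<close>.\<close>

lemma xi_box_seq_continuous:
  assumes p: "\<And>n. p n \<in> xi_box A b" "q \<in> xi_box A b" and b: "\<And>j. 0 < b j" and s: "summable (\<lambda>j. A j / b j)"
    and lim: "\<And>j. (\<lambda>n. fst (p n) j) \<longlonglongrightarrow> fst q j" "\<And>j. (\<lambda>n. snd (p n) j) \<longlonglongrightarrow> snd q j" and e: "0 < e"
  shows "eventually (\<lambda>n. \<forall>z\<in>cball 0 R. dist (xi_infinity (fst (p n)) (snd (p n)) z) (xi_infinity (fst q) (snd q) z) < e) sequentially"
proof (rule xi_infinity_dist_tendsto[where S="\<Sum>j. A j / b j"])
  note pp = xi_box_params[OF p(1) b s] and qp = xi_box_params[OF p(2) b s]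
  show "xi_params (fst q) (snd q)" by (rule qp)
  show "(\<Sum>j. xi_mass (fst q) (snd q) j) \<le> (\<Sum>j. A j / b j)"
    by (intro suminf_le qp s) (use qp(1) in \<open>auto simp: xi_params_def\<close>)
  show "fst (p n) j \<in> {0..1}" "snd (p n) j \<noteq> 1" for n j
    using pp(1)[of n] by (auto simp: xi_params_def)
  define g where "g = (\<lambda>j n. xi_gap (fst (p n)) (snd (p n)) (fst q) (snd q) j)"
  have bound: "norm (g j n) \<le> 3 * (A j / b j)" for j n
  proof -
    have P: "fst (p n) j \<in> {0..min 1 (A j)}" "b j \<le> norm (1 - snd (p n) j)"
      and Q: "fst q j \<in> {0..min 1 (A j)}" "b j \<le> norm (1 - snd q j)"
      using p by (auto simp: xi_box_def)
    have 1: "\<bar>fst (p n) j - fst q j\<bar> / norm (1 - snd q j) \<le> A j / b j"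
      using P Q b[of j] by (intro frac_le) auto
    have "norm (1 / (1 - snd (p n) j) - 1 / (1 - snd q j)) \<le> 1 / b j + 1 / b j"
      using P Q b[of j] by (intro order.trans[OF norm_triangle_ineq4] add_mono) (auto simp: norm_divide intro!: frac_le)
    then have "fst (p n) j * norm (1 / (1 - snd (p n) j) - 1 / (1 - snd q j)) \<le> A j * (1 / b j + 1 / b j)"
      using P b[of j] by (intro mult_mono) auto
    then have "g j n \<le> 3 * (A j / b j)" using 1 by (simp add: g_def xi_gap_def)
    moreover have "0 \<le> g j n" unfolding g_def using P by (intro xi_gap_nonneg) auto
    ultimately show ?thesis by simp
  qed
  have s3: "summable (\<lambda>j. 3 * (A j / b j))" using s by (rule summable_mult)
  show "summable (xi_gap (fst (p n)) (snd (p n)) (fst q) (snd q))" for n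
    by (rule summable_comparison_test'[OF s3, of 0]) (use bound in \<open>simp add: g_def\<close>)
  have g0: "(\<lambda>n. g j n) \<longlonglongrightarrow> 0" for j
  proof -
    have nz: "snd q j \<noteq> 1" using qp(1) by (auto simp: xi_params_def)
    have "(\<lambda>n. g j n) \<longlonglongrightarrow> \<bar>fst q j - fst q j\<bar> / norm (1 - snd q j)
      + fst q j * norm (1 / (1 - snd q j) - 1 / (1 - snd q j))"
      unfolding g_def xi_gap_def by (intro tendsto_intros lim) (use nz in auto)
    then show ?thesis by simp
  qed
  have "((\<lambda>n. \<Sum>j. g j n) \<longlonglongrightarrow> (\<Sum>j. 0))"
    using tannerys_theorem[of g "\<lambda>_. 0" sequentially "\<lambda>j. 3 * (A j / b j)"] g0 bound s3
    by (simp add: always_eventually)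
  then show "(\<lambda>n. \<Sum>j. xi_gap (fst (p n)) (snd (p n)) (fst q) (snd q) j) \<longlonglongrightarrow> 0" by (simp add: g_def)
qed (rule e)

lemma tendsto_coordinate:
  fixes f :: "'b \<Rightarrow> nat \<Rightarrow> 'c::topological_space"
  assumes "(f \<longlongrightarrow> g) F"
  shows "((\<lambda>n. f n j) \<longlongrightarrow> g j) F"
  by (rule continuous_on_tendsto_compose[OF continuous_on_product_coordinates assms]) auto

lemmas tendsto_fst_coord = tendsto_coordinate[OF tendsto_fst]
lemmas tendsto_snd_coord = tendsto_coordinate[OF tendsto_snd]

lemma closed_xi_box: "closed (xi_box A b)"
  unfolding closed_sequential_limits
proof (intro allI impI, elim conjE)
  fix p q assume p: "\<forall>n. p n \<in> xi_box A b" and lim: "p \<longlonglongrightarrow> q"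
  have "fst q j \<in> {0..min 1 (A j)}" for j
    by (rule closed_sequentially[OF closed_atLeastAtMost _ tendsto_fst_coord[OF lim]]) (use p in \<open>auto simp: xi_box_def\<close>)
  moreover have "b j \<le> norm (1 - snd q j)" for j
    by (rule LIMSEQ_le_const[OF tendsto_norm[OF tendsto_diff[OF tendsto_const tendsto_snd_coord[OF lim]]]])
      (use p in \<open>auto simp: xi_box_def\<close>)
  ultimately show "q \<in> xi_box A b" by (simp add: xi_box_def)
qed

text \<open>The exponents \<open>4\<close> and \<open>2\<close> leave the summable ratio \<open>(j + 1)\<^bsup>-2\<^esup>\<close>, and the second one is the size of
  the distances \<open>|1 - u j|\<close> for uniform phases.\<close>

definition xi_boxes :: "nat \<Rightarrow> ((nat \<Rightarrow> real) \<times> (nat \<Rightarrow> complex)) set" where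
  "xi_boxes k = xi_box (\<lambda>j. real k / real (Suc j) ^ 4) (\<lambda>j. 1 / (real (Suc k) * real (Suc j) ^ 2))"

lemma xi_boxes_bounds:
  "0 < 1 / (real (Suc k) * real (Suc j) ^ 2)"
  "summable (\<lambda>j. (real k / real (Suc j) ^ 4) / (1 / (real (Suc k) * real (Suc j) ^ 2)))"
proof -
  have "summable (\<lambda>j. inverse (real (Suc j) ^ 2))"
    using inverse_power_summable[of 2] by (subst summable_Suc_iff) simp
  then have "summable (\<lambda>j. real k * real (Suc k) * inverse (real (Suc j) ^ 2))" by (rule summable_mult)
  moreover have "(real k / real (Suc j) ^ 4) / (1 / (real (Suc k) * real (Suc j) ^ 2)) = real k * real (Suc k) * inverse (real (Suc j) ^ 2)" for j
  proof -
    have "real (Suc j) ^ 4 = real (Suc j) ^ 2 * real (Suc j) ^ 2" by (simp flip: power_add)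
    then show ?thesis by (simp add: field_simps del: of_nat_Suc)
  qed
  ultimately show "summable (\<lambda>j. (real k / real (Suc j) ^ 4) / (1 / (real (Suc k) * real (Suc j) ^ 2)))" by simp
qed (simp del: of_nat_Suc)

text \<open>The infinite product as a measurable function of its parameters: it agrees with
  \<^const>\<open>xi_infinity\<close> on the boxes, which together contain almost all parameters.\<close>

definition xi_version :: "(nat \<Rightarrow> real) \<times> (nat \<Rightarrow> complex) \<Rightarrow> complex \<Rightarrow> complex" where
  "xi_version p = (if p \<in> (\<Union>k. xi_boxes k) then xi_infinity (fst p) (snd p) else (\<lambda>_. 0))"

lemma continuous_on_xi_version: "continuous_on UNIV (xi_version p)"
  using continuous_on_xi_infinity[OF xi_box_params(1)[OF _ xi_boxes_bounds], of p]
  by (auto simp: xi_version_def xi_boxes_def)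

text \<open>On each box the product is sequentially continuous, hence the preimage of the complement of an open
  set is closed.\<close>

lemma measurable_xi_version: "xi_version \<in> borel \<rightarrow>\<^sub>M borel_of compact_convergence_topology"
  unfolding borel_of_def
proof (rule measurable_measure_of)
  fix U assume "U \<in> {S. openin compact_convergence_topology S}"
  then have U: "openin compact_convergence_topology U" by simp
  have box: "{p \<in> xi_boxes k. xi_infinity (fst p) (snd p) \<in> U} \<in> sets borel" for k
  proof -
    define Z where "Z = {p \<in> xi_boxes k. xi_infinity (fst p) (snd p) \<notin> U}"
    have "closed Z" unfolding closed_sequential_limits
    proof (intro allI impI, elim conjE)
      fix p q assume p: "\<forall>n. p n \<in> Z" and lim: "p \<longlonglongrightarrow> q"
      have pb: "p n \<in> xi_boxes k" for n using p by (auto simp: Z_def)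
      have q: "q \<in> xi_boxes k"
        using closed_xi_box[unfolded closed_sequential_limits] pb lim unfolding xi_boxes_def by blast
      have "xi_infinity (fst q) (snd q) \<notin> U"
      proof
        assume inU: "xi_infinity (fst q) (snd q) \<in> U"
        have "eventually (\<lambda>n. xi_infinity (fst (p n)) (snd (p n)) \<in> U) sequentially"
        proof (rule eventually_in_compact_open[OF U inU])
          show "continuous_on UNIV (xi_infinity (fst (p n)) (snd (p n)))" for n
            by (rule continuous_on_xi_infinity[OF xi_box_params(1)[OF pb[unfolded xi_boxes_def] xi_boxes_bounds]])
        qed (rule xi_box_seq_continuous[OF pb[unfolded xi_boxes_def] q[unfolded xi_boxes_def] xi_boxes_bounds
              tendsto_fst_coord[OF lim] tendsto_snd_coord[OF lim]])
        then have "eventually (\<lambda>n :: nat. False) sequentially" by eventually_elim (use p in \<open>simp add: Z_def\<close>)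
        then show False by simp
      qed
      then show "q \<in> Z" using q by (simp add: Z_def)
    qed
    then have "xi_boxes k - Z \<in> sets borel"
      using closed_xi_box by (intro sets.Diff borel_closed) (simp_all add: xi_boxes_def)
    moreover have "{p \<in> xi_boxes k. xi_infinity (fst p) (snd p) \<in> U} = xi_boxes k - Z" by (auto simp: Z_def)
    ultimately show ?thesis by simp
  qed
  define B where "B = (\<Union>k. xi_boxes k)"
  have bk: "xi_boxes k \<in> sets borel" for k
    unfolding xi_boxes_def by (rule borel_closed[OF closed_xi_box])
  have B: "B \<in> sets borel" unfolding B_def
    by (rule sets.countable_nat_UN) (simp add: image_subset_iff bk)
  have "xi_version -` U \<inter> space borel = {p. xi_version p \<in> U}" by (simp add: vimage_def)
  also have "\<dots> = {p \<in> B. xi_infinity (fst p) (snd p) \<in> U} \<union> (if (\<lambda>_. 0) \<in> U then - B else {})"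
    unfolding xi_version_def B_def[symmetric] by (cases "(\<lambda>_. 0) \<in> U") auto
  also have "{p \<in> B. xi_infinity (fst p) (snd p) \<in> U} = (\<Union>k. {p \<in> xi_boxes k. xi_infinity (fst p) (snd p) \<in> U})"
    unfolding B_def by blast
  also have "(\<Union>k. {p \<in> xi_boxes k. xi_infinity (fst p) (snd p) \<in> U}) \<union> (if (\<lambda>_. 0) \<in> U then - B else {}) \<in> sets borel"
  proof (rule sets.Un)
    show "(\<Union>k. {p \<in> xi_boxes k. xi_infinity (fst p) (snd p) \<in> U}) \<in> sets borel"
      by (rule sets.countable_nat_UN) (simp only: image_subset_iff box ball_UNIV simp_thms)
    show "(if (\<lambda>_. 0) \<in> U then - B else {}) \<in> sets borel"
      using sets.compl_sets[OF B] by (simp add: Compl_eq_Diff_UNIV)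
  qed
  finally show "xi_version -` U \<inter> space borel \<in> sets borel" .
next
  show "{S. openin compact_convergence_topology S} \<subseteq> Pow (topspace compact_convergence_topology)"
    using openin_subset by blast
  show "xi_version \<in> space borel \<rightarrow> topspace compact_convergence_topology"
    by (simp add: topspace_compact_convergence_topology continuous_on_xi_version)
qed

section \<open>Convergence in law on the infinite torus\<close>

definition torus_monom :: "(nat \<Rightarrow> nat) \<Rightarrow> (nat \<Rightarrow> nat) \<Rightarrow> nat \<Rightarrow> (nat \<Rightarrow> complex) \<Rightarrow> complex" where
  "torus_monom a b J u = (\<Prod>j<J. u j ^ a j * cnj (u j) ^ b j)"

definition torus :: "(nat \<Rightarrow> complex) set" where
  "torus = {u. \<forall>j. norm (u j) = 1}"

inductive trig_poly :: "((nat \<Rightarrow> complex) \<Rightarrow> real) \<Rightarrow> bool" where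
  monom: "trig_poly (\<lambda>u. Re (c * torus_monom a b J u))"
| add: "trig_poly f \<Longrightarrow> trig_poly g \<Longrightarrow> trig_poly (\<lambda>u. f u + g u)"

lemma norm_torus_monom: "u \<in> torus \<Longrightarrow> norm (torus_monom a b J u) = 1"
  by (simp add: torus_monom_def torus_def prod_norm[symmetric] norm_mult norm_power)

lemma torus_monom_extend:
  assumes "J \<le> K"
  shows "torus_monom a b J = torus_monom (\<lambda>j. if j < J then a j else 0) (\<lambda>j. if j < J then b j else 0) K"
proof
  fix u
  show "torus_monom a b J u = torus_monom (\<lambda>j. if j < J then a j else 0) (\<lambda>j. if j < J then b j else 0) K u"
    unfolding torus_monom_def by (rule prod.mono_neutral_cong_left) (use assms in auto)
qed

text \<open>\<open>Re x * Re y\<close> is half the sum of the real parts of \<open>x * y\<close> and \<open>x * cnj y\<close>. Real parts of monomials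
  therefore span an algebra of real functions, to which the Stone-Weierstrass theorem applies.\<close>

lemma trig_poly_mult_monom:
  "trig_poly (\<lambda>u. Re (c * torus_monom a b J u) * Re (d * torus_monom a' b' K u))"
proof -
  define L where "L = max J K"
  have "\<exists>a1 b1. torus_monom a b J = torus_monom a1 b1 L" "\<exists>a2 b2. torus_monom a' b' K = torus_monom a2 b2 L"
    by (intro exI, rule torus_monom_extend, simp add: L_def)+
  then obtain a1 b1 a2 b2 where 1: "torus_monom a b J = torus_monom a1 b1 L"
    and 2: "torus_monom a' b' K = torus_monom a2 b2 L" by blast
  have m: "torus_monom a1 b1 L u * torus_monom a2 b2 L u = torus_monom (\<lambda>j. a1 j + a2 j) (\<lambda>j. b1 j + b2 j) L u" for u
    unfolding torus_monom_def prod.distrib[symmetric] by (rule prod.cong) (simp_all add: power_add mult_ac)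
  have n: "torus_monom a1 b1 L u * cnj (torus_monom a2 b2 L u) = torus_monom (\<lambda>j. a1 j + b2 j) (\<lambda>j. b1 j + a2 j) L u" for u
    unfolding torus_monom_def cnj_prod prod.distrib[symmetric]
    by (rule prod.cong) (simp_all add: power_add mult_ac)
  have "Re (c * torus_monom a b J u) * Re (d * torus_monom a' b' K u)
    = Re (c * d / 2 * torus_monom (\<lambda>j. a1 j + a2 j) (\<lambda>j. b1 j + b2 j) L u)
      + Re (c * cnj d / 2 * torus_monom (\<lambda>j. a1 j + b2 j) (\<lambda>j. b1 j + a2 j) L u)" for u
  proof -
    have r: "Re x * Re y = Re (x * y / 2) + Re (x * cnj y / 2)" for x y :: complex
      by (simp add: field_simps)
    show ?thesis unfolding 1 2 r m[symmetric] n[symmetric] by (simp only: complex_cnj_mult mult_ac times_divide_eq_right times_divide_eq_left)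
  qed
  then show ?thesis by (simp only: trig_poly.add[OF trig_poly.monom trig_poly.monom])
qed

lemma trig_poly_mult: "trig_poly f \<Longrightarrow> trig_poly g \<Longrightarrow> trig_poly (\<lambda>u. f u * g u)"
proof (induction f rule: trig_poly.induct)
  case (monom c a b J)
  from monom show ?case
  proof (induction g rule: trig_poly.induct)
    case (monom d a' b' K)
    show ?case by (rule trig_poly_mult_monom)
  next
    case (add f g)
    then show ?case using trig_poly.add by (simp add: ring_distribs(1))
  qed
next
  case (add f1 f2)
  then show ?case using trig_poly.add by (simp add: ring_distribs(2))
qed

lemma continuous_on_torus_monom: "continuous_on S (torus_monom a b J)"
  unfolding torus_monom_def
  by (intro continuous_intros continuous_on_subset[OF continuous_on_product_coordinates]) auto

lemma continuous_on_trig_poly: "trig_poly f \<Longrightarrow> continuous_on S f"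
  by (induction f rule: trig_poly.induct) (intro continuous_intros continuous_on_torus_monom | assumption)+

lemma compact_torus: "compact torus"
proof -
  have "compactin (product_topology (\<lambda>_. euclidean) UNIV) (PiE UNIV (\<lambda>_ :: nat. sphere (0::complex) 1))"
    by (subst compactin_PiE) auto
  moreover have "torus = PiE UNIV (\<lambda>_. sphere 0 1)" by (auto simp: torus_def)
  ultimately show ?thesis by (simp add: euclidean_product_topology)
qed

lemma trig_poly_dense:
  assumes h: "continuous_on torus h" and e: "0 < e"
  obtains g where "trig_poly g" "\<And>u. u \<in> torus \<Longrightarrow> \<bar>h u - g u\<bar> < e"
proof -
  interpret function_ring_on "{f. trig_poly f}" torus
  proof
    show "compact torus" by (rule compact_torus)
    show "(\<lambda>_. c) \<in> {f. trig_poly f}" for c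
      using trig_poly.monom[of "of_real c" "\<lambda>_. 0" "\<lambda>_. 0" 0] by (simp add: torus_monom_def)
    fix x y :: "nat \<Rightarrow> complex" assume "x \<noteq> y"
    then obtain j where j: "x j \<noteq> y j" by auto
    have m: "torus_monom (\<lambda>i. if i = j then 1 else 0) (\<lambda>_. 0) (Suc j) u = u j" for u
      by (simp add: torus_monom_def)
    have "trig_poly (\<lambda>u. Re (u j))" "trig_poly (\<lambda>u. Im (u j))"
      using trig_poly.monom[of 1 "\<lambda>i. if i = j then 1 else 0" "\<lambda>_. 0" "Suc j"]
        trig_poly.monom[of "- \<i>" "\<lambda>i. if i = j then 1 else 0" "\<lambda>_. 0" "Suc j"] by (simp_all add: m)
    then show "\<exists>f\<in>{f. trig_poly f}. f x \<noteq> f y" using j by (auto simp: complex_eq_iff)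
  qed (auto intro: continuous_on_trig_poly trig_poly.add trig_poly_mult)
  show ?thesis using Stone_Weierstrass_basic[OF h e] that by blast
qed

lemma integrable_torus_rv:
  fixes f :: "(nat \<Rightarrow> complex) \<Rightarrow> 'd::{banach, second_countable_topology}"
  assumes P: "prob_space P" and U: "U \<in> P \<rightarrow>\<^sub>M borel" "AE \<omega> in P. U \<omega> \<in> torus"
    and f: "continuous_on UNIV f" "\<And>u. u \<in> torus \<Longrightarrow> norm (f u) \<le> K"
  shows "integrable P (\<lambda>\<omega>. f (U \<omega>))"
proof -
  interpret P: prob_space P by (rule P)
  show ?thesis
  proof (rule P.integrable_const_bound[where B=K])
    show "AE \<omega> in P. norm (f (U \<omega>)) \<le> K" using U(2) by eventually_elim (rule f(2))
    show "(\<lambda>\<omega>. f (U \<omega>)) \<in> borel_measurable P"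
      by (rule measurable_compose[OF U(1) borel_measurable_continuous_onI[OF f(1)]])
  qed
qed

text \<open>By compactness of the infinite torus, \<open>h\<close> is uniformly close to a trigonometric polynomial, which
  involves finitely many moments.\<close>

lemma torus_moments_imp_weak:
  fixes M :: "nat \<Rightarrow> 'b pmf" and v :: "nat \<Rightarrow> 'b \<Rightarrow> nat \<Rightarrow> complex"
    and h :: "(nat \<Rightarrow> complex) \<Rightarrow> real"
  assumes P: "prob_space P" and U: "U \<in> P \<rightarrow>\<^sub>M borel" "AE \<omega> in P. U \<omega> \<in> torus"
    and v: "\<And>n x. v n x \<in> torus"
    and mom: "\<And>a b J. (\<lambda>n. measure_pmf.expectation (M n) (\<lambda>x. torus_monom a b J (v n x)))
       \<longlonglongrightarrow> (\<integral>\<omega>. torus_monom a b J (U \<omega>) \<partial>P)"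
    and h: "continuous_on UNIV h" "\<And>u. \<bar>h u\<bar> \<le> B"
  shows "(\<lambda>n. measure_pmf.expectation (M n) (\<lambda>x. h (v n x))) \<longlonglongrightarrow> (\<integral>\<omega>. h (U \<omega>) \<partial>P)"
proof -
  interpret P: prob_space P by (rule P)
  note bP = integrable_torus_rv[OF P U]
  have bM: "integrable (M n) (\<lambda>x. f (v n x))" if "\<And>u. u \<in> torus \<Longrightarrow> norm (f u) \<le> K"
    for f :: "(nat \<Rightarrow> complex) \<Rightarrow> real" and n K
    by (rule measure_pmf.integrable_const_bound[where B=K]) (use that v in auto)
  have bMc: "integrable (M n) (\<lambda>x. f (v n x))" if "\<And>u. u \<in> torus \<Longrightarrow> norm (f u) \<le> K"
    for f :: "(nat \<Rightarrow> complex) \<Rightarrow> complex" and n K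
    by (rule measure_pmf.integrable_const_bound[where B=K]) (use that v in auto)
  have bt: "\<exists>K. \<forall>u\<in>torus. norm (f u) \<le> K" if "continuous_on UNIV f" for f :: "(nat \<Rightarrow> complex) \<Rightarrow> real"
  proof -
    have "compact (f ` torus)" by (rule compact_continuous_image[OF continuous_on_subset[OF that subset_UNIV] compact_torus])
    from compact_imp_bounded[OF this] show ?thesis unfolding bounded_iff
      by (simp only: Set.ball_simps(9))
  qed
  have trig: "(\<lambda>n. measure_pmf.expectation (M n) (\<lambda>x. g (v n x))) \<longlonglongrightarrow> (\<integral>\<omega>. g (U \<omega>) \<partial>P)" if "trig_poly g" for g
    using that
  proof (induction g rule: trig_poly.induct)
    case (monom c a b J)
    have b: "norm (c * torus_monom a b J u) \<le> norm c" if "u \<in> torus" for u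
      using norm_torus_monom[OF that] by (simp add: norm_mult)
    have c: "continuous_on UNIV (\<lambda>u. c * torus_monom a b J u)"
      by (intro continuous_intros continuous_on_torus_monom)
    have "measure_pmf.expectation (M n) (\<lambda>x. Re (c * torus_monom a b J (v n x)))
      = Re (c * measure_pmf.expectation (M n) (\<lambda>x. torus_monom a b J (v n x)))" for n
      using bMc[of "\<lambda>u. c * torus_monom a b J u", OF b, of n] by (simp only: integral_Re integral_mult_right_zero)
    moreover have "(\<integral>\<omega>. Re (c * torus_monom a b J (U \<omega>)) \<partial>P) = Re (c * (\<integral>\<omega>. torus_monom a b J (U \<omega>) \<partial>P))"
      using bP[OF c b] by (simp only: integral_Re integral_mult_right_zero)
    moreover have "(\<lambda>n. Re (c * measure_pmf.expectation (M n) (\<lambda>x. torus_monom a b J (v n x))))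
       \<longlonglongrightarrow> Re (c * (\<integral>\<omega>. torus_monom a b J (U \<omega>) \<partial>P))"
      by (intro tendsto_intros mom)
    ultimately show ?case by simp
  next
    case (add f g)
    obtain K L where KL: "\<And>u. u \<in> torus \<Longrightarrow> norm (f u) \<le> K" "\<And>u. u \<in> torus \<Longrightarrow> norm (g u) \<le> L"
      using bt[OF continuous_on_trig_poly[OF add.hyps(1)]] bt[OF continuous_on_trig_poly[OF add.hyps(2)]] by blast
    have "measure_pmf.expectation (M n) (\<lambda>x. f (v n x) + g (v n x))
      = measure_pmf.expectation (M n) (\<lambda>x. f (v n x)) + measure_pmf.expectation (M n) (\<lambda>x. g (v n x))" for n
      by (rule Bochner_Integration.integral_add[OF bM[of f, OF KL(1)] bM[of g, OF KL(2)]])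
    moreover have "(\<integral>\<omega>. f (U \<omega>) + g (U \<omega>) \<partial>P) = (\<integral>\<omega>. f (U \<omega>) \<partial>P) + (\<integral>\<omega>. g (U \<omega>) \<partial>P)"
      by (rule Bochner_Integration.integral_add[OF bP[OF continuous_on_trig_poly[OF add.hyps(1)] KL(1)]
            bP[OF continuous_on_trig_poly[OF add.hyps(2)] KL(2)]])
    ultimately show ?case using tendsto_add[OF add.IH] by simp
  qed
  show ?thesis
  proof (rule LIMSEQ_I)
    fix e :: real assume e: "0 < e"
    obtain g where g: "trig_poly g" "\<And>u. u \<in> torus \<Longrightarrow> \<bar>h u - g u\<bar> < e / 3"
      using trig_poly_dense[OF continuous_on_subset[OF h(1)], of "e / 3"] e by auto
    obtain K where K: "\<And>u. u \<in> torus \<Longrightarrow> norm (g u) \<le> K" using bt[OF continuous_on_trig_poly[OF g(1)]] by blast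
    have hb: "norm (h u) \<le> B" for u using h(2) by simp
    have 1: "\<bar>measure_pmf.expectation (M n) (\<lambda>x. h (v n x)) - measure_pmf.expectation (M n) (\<lambda>x. g (v n x))\<bar> \<le> e / 3" for n
    proof -
      have "\<bar>measure_pmf.expectation (M n) (\<lambda>x. h (v n x)) - measure_pmf.expectation (M n) (\<lambda>x. g (v n x))\<bar>
        = \<bar>measure_pmf.expectation (M n) (\<lambda>x. h (v n x) - g (v n x))\<bar>"
        by (subst Bochner_Integration.integral_diff[OF bM[of h, OF hb] bM[of g, OF K]]) simp_all
      also have "\<dots> \<le> measure_pmf.expectation (M n) (\<lambda>x. \<bar>h (v n x) - g (v n x)\<bar>)" by (rule integral_abs_bound)
      also have "\<dots> \<le> measure_pmf.expectation (M n) (\<lambda>x. e / 3)"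
      proof (rule integral_mono)
        show "integrable (M n) (\<lambda>x. \<bar>h (v n x) - g (v n x)\<bar>)"
          by (rule integrable_abs[OF Bochner_Integration.integrable_diff[OF bM[of h, OF hb] bM[of g, OF K]]])
        show "\<bar>h (v n x) - g (v n x)\<bar> \<le> e / 3" for x using g(2)[OF v[of n x]] by simp
      qed simp
      finally show ?thesis by simp
    qed
    have 2: "\<bar>(\<integral>\<omega>. h (U \<omega>) \<partial>P) - (\<integral>\<omega>. g (U \<omega>) \<partial>P)\<bar> \<le> e / 3"
    proof -
      note int = bP[OF h(1) hb] bP[OF continuous_on_trig_poly[OF g(1)] K]
      have "\<bar>(\<integral>\<omega>. h (U \<omega>) \<partial>P) - (\<integral>\<omega>. g (U \<omega>) \<partial>P)\<bar> = \<bar>\<integral>\<omega>. h (U \<omega>) - g (U \<omega>) \<partial>P\<bar>"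
        by (subst Bochner_Integration.integral_diff[OF int]) simp_all
      also have "\<dots> \<le> (\<integral>\<omega>. \<bar>h (U \<omega>) - g (U \<omega>)\<bar> \<partial>P)" by (rule integral_abs_bound)
      also have "\<dots> \<le> (\<integral>\<omega>. e / 3 \<partial>P)"
      proof (rule integral_mono_AE)
        show "integrable P (\<lambda>\<omega>. \<bar>h (U \<omega>) - g (U \<omega>)\<bar>)"
          by (rule integrable_abs[OF Bochner_Integration.integrable_diff[OF int]])
        show "AE \<omega> in P. \<bar>h (U \<omega>) - g (U \<omega>)\<bar> \<le> e / 3" using U(2) by eventually_elim (use g(2) in \<open>auto intro: less_imp_le\<close>)
      qed simp
      finally show ?thesis by (simp add: P.prob_space)
    qed
    obtain N where N: "\<And>n. N \<le> n \<Longrightarrow> norm (measure_pmf.expectation (M n) (\<lambda>x. g (v n x)) - (\<integral>\<omega>. g (U \<omega>) \<partial>P)) < e / 3"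
      using LIMSEQ_D[OF trig[OF g(1)], of "e / 3"] e by auto
    show "\<exists>no. \<forall>n\<ge>no. norm (measure_pmf.expectation (M n) (\<lambda>x. h (v n x)) - (\<integral>\<omega>. h (U \<omega>) \<partial>P)) < e"
    proof (intro exI allI impI)
      fix n assume "N \<le> n"
      from N[OF this] show "norm (measure_pmf.expectation (M n) (\<lambda>x. h (v n x)) - (\<integral>\<omega>. h (U \<omega>) \<partial>P)) < e"
        using 1[of n] 2 unfolding real_norm_def by linarith
    qed
  qed
qed

text \<open>After substitution this is the integral of \<open>exp (2 \<pi> i (a - b) t)\<close> over a period.\<close>

lemma integral_uniform_unit_circle_power:
  "(\<integral>z. z ^ a * cnj z ^ b \<partial>uniform_unit_circle) = (if a = b then 1 else 0)"
proof -
  define L where "L = uniform_measure lborel {0..<1::real}"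
  define k where "k = real a - real b"
  have L: "L = density lborel (\<lambda>x. ennreal (indicator {0..<1} x))"
    by (simp add: L_def uniform_measure_def ennreal_indicator divide_ennreal_def)
  have e: "cis (2 * pi * t) ^ a * cnj (cis (2 * pi * t)) ^ b = cis (2 * pi * k * t)" for t
  proof -
    have "cis (2 * pi * t) ^ a * cnj (cis (2 * pi * t)) ^ b = cis (real a * (2 * pi * t)) * cis (real b * - (2 * pi * t))"
      by (simp only: cis_cnj Complex.DeMoivre)
    also have "\<dots> = cis (2 * pi * k * t)" unfolding cis_mult by (rule arg_cong[where f=cis]) (simp add: k_def algebra_simps)
    finally show ?thesis .
  qed
  have mc: "(\<lambda>t. cis (2 * pi * k * t)) \<in> borel_measurable borel"
    by (intro borel_measurable_continuous_onI continuous_intros)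
  have Lb: "sets L = sets borel" by (simp add: L)
  have "(\<integral>z. z ^ a * cnj z ^ b \<partial>uniform_unit_circle) = (\<integral>t. cis (2 * pi * k * t) \<partial>L)"
    unfolding uniform_unit_circle_def L_def[symmetric]
  proof (subst integral_distr)
    show "(\<lambda>t. cis (2 * pi * t)) \<in> L \<rightarrow>\<^sub>M borel" using measurable_cis Lb by (simp cong: measurable_cong_sets)
    show "(\<lambda>z :: complex. z ^ a * cnj z ^ b) \<in> borel_measurable borel"
      by (intro borel_measurable_continuous_onI continuous_intros)
  qed (simp only: e)
  also have "\<dots> = (\<integral>t. indicator {0..<1} t *\<^sub>R cis (2 * pi * k * t) \<partial>lborel)"
    unfolding L by (rule integral_density) (use mc in auto)
  also have "\<dots> = (\<integral>t. indicator {0..1} t *\<^sub>R cis (2 * pi * k * t) \<partial>lborel)"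
  proof (rule integral_cong_AE)
    show "AE t in lborel. indicator {0..<1} t *\<^sub>R cis (2 * pi * k * t) = indicator {0..1} t *\<^sub>R cis (2 * pi * k * t)"
      using AE_lborel_singleton[of 1] by eventually_elim (auto simp: indicator_def)
  qed (use mc in \<open>auto intro!: borel_measurable_scaleR\<close>)
  also have "\<dots> = integral {0..1} (\<lambda>t. cis (2 * pi * k * t))"
    using set_borel_integral_eq_integral(2)[OF borel_integrable_atLeastAtMost'[of 0 1 "\<lambda>t. cis (2 * pi * k * t)"]]
    by (simp add: set_lebesgue_integral_def continuous_intros)
  also have "\<dots> = (if a = b then 1 else 0)"
  proof (cases "a = b")
    case True then show ?thesis by (simp add: k_def)
  next
    case False
    then have k0: "k \<noteq> 0" by (simp add: k_def)
    define d where "d = complex_of_real (2 * pi * k) * \<i>"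
    define F where "F = (\<lambda>t :: real. exp (d * of_real t) / d)"
    have d0: "d \<noteq> 0" using k0 by (simp add: d_def)
    have cd: "cis (2 * pi * k * t) = exp (d * of_real t)" for t by (simp add: cis_conv_exp d_def mult_ac)
    have "((\<lambda>t. cis (2 * pi * k * t)) has_integral (F 1 - F 0)) {0..1}"
    proof (rule fundamental_theorem_of_calculus)
      fix t :: real
      have "((\<lambda>z. exp (d * z) / d) has_field_derivative exp (d * of_real t)) (at (of_real t))"
        using d0 by (auto intro!: derivative_eq_intros)
      then show "(F has_vector_derivative cis (2 * pi * k * t)) (at t within {0..1})"
        unfolding F_def cd by (rule has_vector_derivative_real_field)
    qed simp
    moreover have "F 1 = F 0"
    proof -
      have "exp d = cis (2 * pi * k)" using cd[of 1] by simp
      also have "\<dots> = cis (2 * pi * real_of_int (int a - int b))" by (simp add: k_def)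
      also have "\<dots> = 1" by (rule cis_multiple_2pi) simp
      finally show ?thesis by (simp add: F_def)
    qed
    ultimately show ?thesis using False by (simp add: integral_unique)
  qed
  finally show ?thesis .
qed

lemma (in prob_space) AE_uniform_in_torus:
  assumes U: "\<And>j. U j \<in> borel_measurable M" "\<And>j. distr M borel (U j) = uniform_unit_circle"
  shows "AE \<omega> in M. (\<lambda>j. U j \<omega>) \<in> torus"
proof -
  have z: "AE z in uniform_unit_circle. norm z = 1"
    unfolding uniform_unit_circle_def
    by (subst AE_distr_iff) (auto intro!: measurable_cis simp: uniform_measure_def)
  have "AE \<omega> in M. norm (U j \<omega>) = 1" for j
    using z unfolding U(2)[of j, symmetric] by (rule AE_distrD[OF U(1)])
  then have "AE \<omega> in M. \<forall>j. norm (U j \<omega>) = 1" by (simp only: AE_all_countable) blast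
  then show ?thesis by eventually_elim (simp add: torus_def)
qed

lemma (in prob_space) torus_monom_uniform:
  assumes iid: "iid_uniform_unit_circle M U UNIV"
  shows "(\<integral>\<omega>. torus_monom a b J (\<lambda>j. U j \<omega>) \<partial>M) = (if \<forall>j<J. a j = b j then 1 else 0)"
proof -
  have ind: "indep_vars (\<lambda>_. borel) U UNIV" and d: "distr M borel (U j) = uniform_unit_circle" for j
    using iid by (auto simp: iid_uniform_unit_circle_def)
  have m: "U j \<in> borel_measurable M" for j using ind by (auto simp: indep_vars_def)
  have gm: "(\<lambda>z :: complex. z ^ a j * cnj z ^ b j) \<in> borel_measurable borel" for j
    by (intro borel_measurable_continuous_onI continuous_intros)
  have ind': "indep_vars (\<lambda>_. borel) (\<lambda>j \<omega>. U j \<omega> ^ a j * cnj (U j \<omega>) ^ b j) {..<J}"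
    using indep_vars_compose2[OF indep_vars_subset[OF ind subset_UNIV], of "{..<J}" "\<lambda>j z. z ^ a j * cnj z ^ b j"] gm by simp
  have unit: "AE \<omega> in M. norm (U j \<omega>) = 1" for j
    using AE_uniform_in_torus[of U, OF m d] by eventually_elim (simp add: torus_def)
  have "(\<integral>\<omega>. torus_monom a b J (\<lambda>j. U j \<omega>) \<partial>M) = (\<Prod>j<J. \<integral>\<omega>. U j \<omega> ^ a j * cnj (U j \<omega>) ^ b j \<partial>M)"
    unfolding torus_monom_def
  proof (rule indep_vars_lebesgue_integral[OF _ ind'])
    fix j
    show "integrable M (\<lambda>\<omega>. U j \<omega> ^ a j * cnj (U j \<omega>) ^ b j)"
    proof (rule integrable_const_bound[where B=1])
      show "AE \<omega> in M. norm (U j \<omega> ^ a j * cnj (U j \<omega>) ^ b j) \<le> 1"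
        using unit[of j] by eventually_elim (simp add: norm_mult norm_power)
    qed (rule measurable_compose[OF m gm])
  qed simp
  also have "\<dots> = (\<Prod>j<J. \<integral>z. z ^ a j * cnj z ^ b j \<partial>uniform_unit_circle)"
  proof (rule prod.cong[OF refl])
    fix j
    show "(\<integral>\<omega>. U j \<omega> ^ a j * cnj (U j \<omega>) ^ b j \<partial>M) = (\<integral>z. z ^ a j * cnj z ^ b j \<partial>uniform_unit_circle)"
      unfolding d[of j, symmetric] by (rule integral_distr[OF m gm, symmetric])
  qed
  also have "\<dots> = (if \<forall>j<J. a j = b j then 1 else 0)"
    by (auto simp: integral_uniform_unit_circle_power)
  finally show ?thesis .
qed

section \<open>Typical samples for fixed perimeters\<close>

text \<open>Markov's inequality with a bound on the mean instead of its value.\<close>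

lemma pmf_Markov:
  assumes t: "0 < t" and E: "0 \<le> E" "(\<integral>\<^sup>+x. ennreal (g x) \<partial>measure_pmf M) \<le> ennreal E"
  shows "measure_pmf.prob M {x. t \<le> g x} \<le> E / t"
proof -
  have "ennreal t * emeasure M {x. t \<le> g x} = (\<integral>\<^sup>+x. ennreal t * indicator {x. t \<le> g x} x \<partial>measure_pmf M)"
    by (subst nn_integral_cmult_indicator) auto
  also have "\<dots> \<le> (\<integral>\<^sup>+x. ennreal (g x) \<partial>measure_pmf M)"
    by (intro nn_integral_mono) (auto simp: indicator_def intro: ennreal_leI)
  also have "\<dots> \<le> ennreal E" by (rule E(2))
  finally have "ennreal (t * measure_pmf.prob M {x. t \<le> g x}) \<le> ennreal E"
    using t by (simp add: measure_pmf.emeasure_eq_measure ennreal_mult)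
  then have "t * measure_pmf.prob M {x. t \<le> g x} \<le> E" using E(1) by simp
  then show ?thesis using t by (simp add: pos_le_divide_eq mult.commute)
qed

lemma power_add_ge:
  fixes a b :: nat
  assumes "0 < p"
  shows "a ^ p + b ^ p \<le> (a + b) ^ p"
proof -
  obtain k where p: "p = Suc k" using assms by (cases p) auto
  have "a * a ^ k + b * b ^ k \<le> a * (a + b) ^ k + b * (a + b) ^ k"
    by (intro add_mono mult_left_mono power_mono) auto
  then show ?thesis by (simp add: p ring_distribs)
qed

lemma sum_power_le:
  fixes f :: "'b \<Rightarrow> nat"
  assumes "finite A" "0 < p"
  shows "(\<Sum>x\<in>A. f x ^ p) \<le> (\<Sum>x\<in>A. f x) ^ p"
  using assms
proof (induction A)
  case (insert x A)
  have "(\<Sum>x\<in>insert x A. f x ^ p) \<le> f x ^ p + (\<Sum>x\<in>A. f x) ^ p" using insert by simp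
  also have "\<dots> \<le> (f x + (\<Sum>x\<in>A. f x)) ^ p" by (rule power_add_ge[OF assms(2)])
  finally show ?case using insert by simp
qed simp

lemma count_list_filter': "count_list (filter Q xs) j = (if Q j then count_list xs j else 0)"
  by (induction xs) auto

lemma sum_count_list_off: "(\<Sum>j\<in>set xs - A. count_list xs j) = length (filter (\<lambda>j. j \<notin> A) xs)"
proof -
  have "(\<Sum>j\<in>set xs - A. count_list xs j) = (\<Sum>j\<in>set xs - A. count_list (filter (\<lambda>j. j \<notin> A) xs) j)"
    by (intro sum.cong) (auto simp: count_list_filter')
  also have "\<dots> = length (filter (\<lambda>j. j \<notin> A) xs)" by (rule sum_count_set) auto
  finally show ?thesis .
qed

text \<open>The perimeters are now deterministic, and \<open>m\<close> and \<open>c\<close> quantify the finite type of \<open>\<alpha>\<close>.\<close>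

locale fixed_perimeters =
  fixes y :: "nat \<Rightarrow> real" and \<alpha> c :: real and m :: nat
  assumes y: "y \<in> nabla'" and decay: "geometric_decay y" and pos: "\<And>j. 0 < y j"
    and \<alpha>: "\<alpha> \<notin> \<rat>" and m: "1 \<le> m" and c: "0 < c" "c \<le> 1"
    and lower: "\<And>n. n \<noteq> 0 \<Longrightarrow> c / real n ^ m \<le> dist_nearest_int (real n * \<alpha>)"
begin

lemmas y01 = nabla'_props(1,2)[OF y]

lemma y0_less_1: "y 0 < 1"
proof -
  have "(\<Sum>j<2. y j) \<le> suminf y" by (rule sum_le_suminf) (use nabla'_props[OF y] in auto)
  then show ?thesis using nabla'_props(4)[OF y] pos[of 1] by (simp add: numeral_2_eq_2)
qed

lemma one_minus_y: "1 - y 0 \<le> 1 - y j"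
  using decseqD[OF nabla'_props(6)[OF y], of 0 j] by simp

text \<open>Small enough that at most \<open>n\<^bsup>6 \<tau>\<^esup>\<close> points on small circles contribute at most
  \<open>n\<^bsup>6 \<tau> (m + 1)\<^esup> = n\<^bsup>3/4\<^esup>\<close> to a sum of \<open>(m + 1)\<close>-st powers of counts.\<close>

definition \<tau> :: real where "\<tau> = 1 / (8 * real (Suc m))"

lemma \<tau>: "0 < \<tau>" "\<tau> \<le> 1 / 16" "6 * \<tau> * real (Suc m) = 3 / 4"
  using m by (simp_all add: \<tau>_def field_simps)

text \<open>The circles whose counts fluctuate by at least the order \<open>n\<^bsup>\<tau>\<^esup>\<close>, which is enough for their phases
  to equidistribute.\<close>

definition large :: "nat \<Rightarrow> nat set" where
  "large n = {j. real n powr (2 * \<tau> - 1) \<le> y j}"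

lemma finite_large: "0 < n \<Longrightarrow> finite (large n)"
proof -
  assume n: "0 < n"
  have "y \<longlonglongrightarrow> 0" using summable_LIMSEQ_zero nabla'_props(3)[OF y] by blast
  then have "eventually (\<lambda>j. y j < real n powr (2 * \<tau> - 1)) sequentially"
    by (rule order_tendstoD(2)) (use n in simp)
  then obtain J where J: "\<And>j. J \<le> j \<Longrightarrow> y j < real n powr (2 * \<tau> - 1)" by (auto simp: eventually_sequentially)
  have "large n \<subseteq> {..<J}"
  proof
    fix j assume "j \<in> large n"
    then show "j \<in> {..<J}" using J[of j] by (simp add: large_def) (metis not_less)
  qed
  then show ?thesis by (rule finite_subset) simp
qed

lemma eventually_large: "eventually (\<lambda>n. j \<in> large n) sequentially"
proof -
  have "(\<lambda>n. real n powr (2 * \<tau> - 1)) \<longlonglongrightarrow> 0"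
    using \<tau> by (intro tendsto_neg_powr filterlim_real_sequentially) simp
  then have "eventually (\<lambda>n. real n powr (2 * \<tau> - 1) < y j) sequentially"
    by (rule order_tendstoD(2)) (rule pos)
  then show ?thesis by eventually_elim (simp add: large_def)
qed

definition small_mass :: "nat \<Rightarrow> real" where
  "small_mass n = (\<Sum>j. if j \<in> large n then 0 else y j)"

lemma summable_small: "summable (\<lambda>j. if j \<in> large n then 0 else y j)"
  by (rule summable_comparison_test'[OF nabla'_props(3)[OF y], of 0]) (use y01 in auto)

lemma small_mass_nonneg: "0 \<le> small_mass n"
  unfolding small_mass_def by (rule suminf_nonneg[OF summable_small]) (use y01 in auto)

lemma summable_y_powr: "0 < t \<Longrightarrow> summable (\<lambda>j. real (Suc j) ^ p * y j powr t)"
  by (rule summable_power_powr[OF decay y01(1)])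

text \<open>On small circles \<open>y j = y j\<^bsup>1 - \<tau>\<^esup> y j\<^bsup>\<tau>\<^esup>\<close>, where the first factor is bounded by the threshold and the
  second one is summable.\<close>

lemma small_mass_le:
  assumes n: "0 < n"
  shows "small_mass n \<le> real n powr ((2 * \<tau> - 1) * (1 - \<tau>)) * (\<Sum>j. y j powr \<tau>)"
proof -
  have s: "summable (\<lambda>j. y j powr \<tau>)" using summable_y_powr[OF \<tau>(1), of 0] by simp
  have "small_mass n \<le> (\<Sum>j. real n powr ((2 * \<tau> - 1) * (1 - \<tau>)) * y j powr \<tau>)"
    unfolding small_mass_def
  proof (rule suminf_le[OF _ summable_small summable_mult[OF s]])
    fix j
    show "(if j \<in> large n then 0 else y j) \<le> real n powr ((2 * \<tau> - 1) * (1 - \<tau>)) * y j powr \<tau>"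
    proof (cases "j \<in> large n")
      case False
      then have "y j \<le> real n powr (2 * \<tau> - 1)" by (simp add: large_def)
      then have "y j powr (1 - \<tau>) \<le> (real n powr (2 * \<tau> - 1)) powr (1 - \<tau>)"
        using pos[of j] \<tau> by (intro powr_mono2) auto
      then have "y j powr (1 - \<tau>) * y j powr \<tau> \<le> real n powr ((2 * \<tau> - 1) * (1 - \<tau>)) * y j powr \<tau>"
        by (intro mult_right_mono) (auto simp: powr_powr)
      moreover have "y j powr (1 - \<tau>) * y j powr \<tau> = y j"
        using pos[of j] by (simp flip: powr_add)
      ultimately show ?thesis using False by simp
    qed simp
  qed
  then show ?thesis using suminf_mult[OF s] by simp
qed

abbreviation "draws n \<equiv> replicate_pmf n (circle_pmf y)"

lemma prob_small: "measure_pmf.prob (circle_pmf y) (- large n) \<le> small_mass n"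
proof -
  have "emeasure (circle_pmf y) (- large n) = (\<integral>\<^sup>+j. indicator (- large n) j \<partial>circle_pmf y)" by simp
  also have "\<dots> = (\<Sum>j. ennreal (if j \<in> large n then 0 else y j))"
    unfolding nn_integral_measure_pmf nn_integral_count_space_nat pmf_circle_pmf_nabla'[OF y]
    by (intro arg_cong[where f=suminf] ext) (simp add: indicator_def)
  also have "\<dots> = ennreal (small_mass n)"
    unfolding small_mass_def by (rule suminf_ennreal2[OF _ summable_small]) (use y01 in auto)
  finally show ?thesis using small_mass_nonneg by (simp add: measure_pmf.emeasure_eq_measure)
qed

definition num_small :: "nat \<Rightarrow> nat list \<Rightarrow> nat" where
  "num_small n xs = length (filter (\<lambda>j. j \<notin> large n) xs)"

lemma num_small_expectation:
  "(\<integral>\<^sup>+xs. ennreal (real (num_small n xs)) \<partial>draws n) \<le> ennreal (real n * small_mass n)"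
proof -
  define b where "b = (\<lambda>j. j \<in> large n)"
  have ns: "num_small n xs = count_list (map b xs) False" for xs
    unfolding num_small_def b_def by (induction xs) auto
  have fin: "integrable (draws n) (\<lambda>xs. real (num_small n xs))"
  proof (rule measure_pmf.integrable_const_bound[where B="real n"])
    show "AE xs in draws n. norm (real (num_small n xs)) \<le> real n"
      unfolding AE_measure_pmf_iff set_replicate_pmf num_small_def using length_filter_le by fastforce
  qed simp
  have "(\<integral>\<^sup>+xs. ennreal (real (num_small n xs)) \<partial>draws n)
    = ennreal (measure_pmf.expectation (draws n) (\<lambda>xs. real (num_small n xs)))"
    by (rule nn_integral_eq_integral[OF fin]) simp
  also have "measure_pmf.expectation (draws n) (\<lambda>xs. real (num_small n xs))
    = measure_pmf.expectation (map_pmf (map b) (draws n)) (\<lambda>bs. real (count_list bs False))"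
    by (simp add: ns)
  also have "\<dots> = real n * pmf (map_pmf b (circle_pmf y)) False"
    unfolding map_replicate_pmf expectation_count_list by (simp add: mult.commute)
  also have "pmf (map_pmf b (circle_pmf y)) False = measure_pmf.prob (circle_pmf y) (- large n)"
    by (simp add: pmf_map b_def vimage_def Compl_eq)
  finally show ?thesis using prob_small[of n] by (simp add: ennreal_leI mult_left_mono)
qed

text \<open>The number of shifts used for circle \<open>j\<close>. The resulting probabilities \<open>1 / step_bound K j\<close> have a sum
  of order \<open>1 / K\<close>, uniformly in \<open>n\<close>.\<close>

definition step_bound :: "nat \<Rightarrow> nat \<Rightarrow> nat" where
  "step_bound K j = K * Suc j ^ 2"

text \<open>The shift error is \<open>step_bound K j / sqrt (n y j)\<close> up to a constant, and the threshold defining the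
  large circles turns it into a negative power of \<open>n\<close> times a summable sequence.\<close>

lemma prob_near_integer:
  assumes K: "0 < K" and n: "0 < n" and j: "j \<in> large n"
  shows "measure_pmf.prob (draws n) {xs. dist_nearest_int (real (count_list xs j) * \<alpha>) < c / (2 * real (step_bound K j) ^ m)}
    \<le> 1 / real K * (1 / wt j) + real K / sqrt (1 - y 0) * real n powr (- 2 * \<tau>\<^sup>2) * (wt j * y j powr \<tau>)"
proof -
  define H where "H = step_bound K j"
  define \<delta> where "\<delta> = c / (2 * real H ^ m)"
  define D where "D = {k. dist_nearest_int (real k * \<alpha>) < \<delta>}"
  have H: "0 < H" "real H = real K * wt j" using K by (simp_all add: H_def step_bound_def)
  have yj: "0 < y j" "y j < 1" using pos y0_less_1 one_minus_y[of j] by (auto intro: le_less_trans)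
  have gap: "2 * \<delta> \<le> dist_nearest_int (real h * \<alpha>)" if "h \<noteq> 0" "h < H" for h
  proof -
    have "c / real H ^ m \<le> c / real h ^ m" using that c by (intro divide_left_mono power_mono) auto
    also have "\<dots> \<le> dist_nearest_int (real h * \<alpha>)" by (rule lower[OF that(1)])
    finally show ?thesis by (simp add: \<delta>_def)
  qed
  have "measure_pmf.prob (draws n) {xs. dist_nearest_int (real (count_list xs j) * \<alpha>) < \<delta>}
    = measure_pmf.expectation (draws n) (indicat_real {xs. dist_nearest_int (real (count_list xs j) * \<alpha>) < \<delta>})"
    by simp
  also have "\<dots> = measure_pmf.expectation (draws n) (\<lambda>xs. indicat_real D (count_list xs j))"
    by (intro Bochner_Integration.integral_cong) (simp_all add: D_def indicator_def)
  also have "\<dots> = (\<Sum>k\<le>n. Bernstein n k (y j) * indicat_real D k)"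
    unfolding expectation_count_list pmf_circle_pmf_nabla'[OF y] real_scaleR_def ..
  also have "\<dots> \<le> 1 / real H + real H / sqrt (real (Suc n) * y j * (1 - y j))"
    unfolding D_def by (rule sum_Bernstein_near_integer[OF yj H(1) gap])
  also have "\<dots> \<le> 1 / real K * (1 / wt j) + real K / sqrt (1 - y 0) * real n powr (- 2 * \<tau>\<^sup>2) * (wt j * y j powr \<tau>)"
  proof (rule add_mono)
    show "1 / real H \<le> 1 / real K * (1 / wt j)" by (simp add: H(2))
    have n0: "0 < real n" using n by simp
    define \<kappa> where "\<kappa> = 1 - y 0"
    have \<kappa>: "0 < \<kappa>" using y0_less_1 by (simp add: \<kappa>_def)
    have "real n * y j * \<kappa> \<le> real (Suc n) * y j * (1 - y j)"
      using yj one_minus_y[of j] \<kappa> by (intro mult_mono) (auto simp: \<kappa>_def)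
    then have "sqrt (real n * y j * \<kappa>) \<le> sqrt (real (Suc n) * y j * (1 - y j))" by simp
    then have "1 / sqrt (real (Suc n) * y j * (1 - y j)) \<le> 1 / sqrt (real n * y j * \<kappa>)"
      using n0 yj \<kappa> by (intro divide_left_mono) auto
    also have "\<dots> = 1 / sqrt \<kappa> * (real n powr (- 1/2) * y j powr (- 1/2))"
      using n0 yj \<kappa> by (simp add: real_sqrt_mult powr_minus_divide powr_half_sqrt)
    also have "y j powr (- 1/2) = y j powr (- (1/2 + \<tau>)) * y j powr \<tau>"
      using yj by (simp flip: powr_add)
    also have "1 / sqrt \<kappa> * (real n powr (- 1/2) * (y j powr (- (1/2 + \<tau>)) * y j powr \<tau>))
      \<le> 1 / sqrt \<kappa> * (real n powr (- 1/2) * ((real n powr (2 * \<tau> - 1)) powr (- (1/2 + \<tau>)) * y j powr \<tau>))"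
      using j n0 \<tau> \<kappa> unfolding large_def
      by (intro mult_left_mono mult_right_mono powr_mono2') auto
    also have "\<dots> = 1 / sqrt \<kappa> * (real n powr (- 2 * \<tau>\<^sup>2) * y j powr \<tau>)"
    proof -
      \<comment> \<open>The factor y j powr \<tau> is kept for summability, which costs the small exponent here.\<close>
      have "- 1/2 + (2 * \<tau> - 1) * (- (1/2 + \<tau>)) = - 2 * \<tau>\<^sup>2" by (simp add: power2_eq_square algebra_simps)
      then have "real n powr (- 1/2) * (real n powr (2 * \<tau> - 1)) powr (- (1/2 + \<tau>)) = real n powr (- 2 * \<tau>\<^sup>2)"
        unfolding powr_powr powr_add[symmetric] by (rule arg_cong)
      then show ?thesis by (simp only: mult.assoc[symmetric])
    qed
    finally have "real K * wt j * (1 / sqrt (real (Suc n) * y j * (1 - y j)))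
      \<le> real K * wt j * (1 / sqrt \<kappa> * (real n powr (- 2 * \<tau>\<^sup>2) * y j powr \<tau>))"
      by (rule mult_left_mono) simp
    then show "real H / sqrt (real (Suc n) * y j * (1 - y j))
      \<le> real K / sqrt (1 - y 0) * real n powr (- 2 * \<tau>\<^sup>2) * (wt j * y j powr \<tau>)"
      unfolding H(2) \<kappa>_def by (simp only: mult_ac times_divide_eq_right times_divide_eq_left mult_1_right mult_1_left)
  qed
  finally show ?thesis by (simp add: \<delta>_def H_def)
qed

text \<open>Samples for which no large circle has a phase near \<open>1\<close>, few points lie on small circles, and the
  frequencies of the large circles are accurate even against the weights \<open>wt j ^ m\<close> that come from the
  first condition.\<close>

definition good_lists :: "nat \<Rightarrow> nat \<Rightarrow> nat list set" where
  "good_lists K n = {xs. (\<forall>j\<in>large n. c / (2 * real (step_bound K j) ^ m) \<le> dist_nearest_int (real (count_list xs j) * \<alpha>))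
     \<and> real (num_small n xs) < real n powr (6 * \<tau>)
     \<and> (\<Sum>j\<in>large n. wt j ^ (m - 1) * freq_error y n xs j) < real n powr (- 1/4)}"

definition bad_bound :: "nat \<Rightarrow> nat \<Rightarrow> real" where
  "bad_bound K n = real K / sqrt (1 - y 0) * real n powr (- 2 * \<tau>\<^sup>2) * (\<Sum>j. wt j * y j powr \<tau>)
     + real n powr (1 + (2 * \<tau> - 1) * (1 - \<tau>) - 6 * \<tau>) * (\<Sum>j. y j powr \<tau>)
     + real n powr (- 1/4) * (\<Sum>j. real (Suc j) ^ (2 * m) * y j powr (1/2))"

lemma bad_bound_tendsto: "bad_bound K \<longlonglongrightarrow> 0"
proof -
  have "(\<lambda>n. real n powr (- 2 * \<tau>\<^sup>2)) \<longlonglongrightarrow> 0" "(\<lambda>n. real n powr (- 1/4)) \<longlonglongrightarrow> 0"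
    using \<tau> by (intro tendsto_neg_powr filterlim_real_sequentially; simp)+
  moreover have "(\<lambda>n. real n powr (1 + (2 * \<tau> - 1) * (1 - \<tau>) - 6 * \<tau>)) \<longlonglongrightarrow> 0"
  proof (intro tendsto_neg_powr filterlim_real_sequentially)
    have "1 + (2 * \<tau> - 1) * (1 - \<tau>) - 6 * \<tau> = - (3 * \<tau> + 2 * \<tau>\<^sup>2)" by (simp add: power2_eq_square algebra_simps)
    moreover have "0 < 3 * \<tau> + 2 * \<tau>\<^sup>2" using \<tau>(1) by (intro add_pos_nonneg) auto
    ultimately show "1 + (2 * \<tau> - 1) * (1 - \<tau>) - 6 * \<tau> < 0" by linarith
  qed
  ultimately have "(\<lambda>n. bad_bound K n) \<longlonglongrightarrow> real K / sqrt (1 - y 0) * 0 * (\<Sum>j. wt j * y j powr \<tau>)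
     + 0 * (\<Sum>j. y j powr \<tau>) + 0 * (\<Sum>j. real (Suc j) ^ (2 * m) * y j powr (1/2))"
    unfolding bad_bound_def by (intro tendsto_intros)
  then show ?thesis by simp
qed

text \<open>A union bound. Only the probability that some phase is near \<open>1\<close> leaves a term that does not vanish
  with \<open>n\<close>, and it is small for large \<open>K\<close>.\<close>

lemma prob_not_good:
  assumes K: "0 < K" and n: "0 < n"
  shows "measure_pmf.prob (draws n) (- good_lists K n) \<le> 1 / real K * (\<Sum>j. 1 / wt j) + bad_bound K n"
proof -
  define A where "A = (\<lambda>j. {xs. dist_nearest_int (real (count_list xs j) * \<alpha>) < c / (2 * real (step_bound K j) ^ m)})"
  define B where "B = {xs. real n powr (6 * \<tau>) \<le> real (num_small n xs)}"
  define E where "E = {xs. real n powr (- 1/4) \<le> (\<Sum>j\<in>large n. wt j ^ (m - 1) * freq_error y n xs j)}"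
  have n0: "0 < real n" using n by simp
  have eq: "- good_lists K n = ((\<Union>j\<in>large n. A j) \<union> B) \<union> E"
    unfolding good_lists_def A_def B_def E_def by (auto simp: not_le not_less)
  have "measure_pmf.prob (draws n) (- good_lists K n)
    \<le> (measure_pmf.prob (draws n) (\<Union>j\<in>large n. A j) + measure_pmf.prob (draws n) B) + measure_pmf.prob (draws n) E"
    unfolding eq by (intro order.trans[OF measure_Un_le] add_mono measure_Un_le order.refl) auto
  also have "measure_pmf.prob (draws n) (\<Union>j\<in>large n. A j) \<le> (\<Sum>j\<in>large n. measure_pmf.prob (draws n) (A j))"
    by (rule measure_pmf.finite_measure_subadditive_finite[OF finite_large[OF n]]) auto
  also have "\<dots> \<le> (\<Sum>j\<in>large n. 1 / real K * (1 / wt j) + real K / sqrt (1 - y 0) * real n powr (- 2 * \<tau>\<^sup>2) * (wt j * y j powr \<tau>))"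
    unfolding A_def by (intro sum_mono prob_near_integer K n)
  also have "\<dots> = 1 / real K * (\<Sum>j\<in>large n. 1 / wt j) + real K / sqrt (1 - y 0) * real n powr (- 2 * \<tau>\<^sup>2) * (\<Sum>j\<in>large n. wt j * y j powr \<tau>)"
    by (simp only: sum.distrib sum_distrib_left)
  also have "\<dots> \<le> 1 / real K * (\<Sum>j. 1 / wt j) + real K / sqrt (1 - y 0) * real n powr (- 2 * \<tau>\<^sup>2) * (\<Sum>j. wt j * y j powr \<tau>)"
  proof (intro add_mono mult_left_mono sum_le_suminf finite_large n)
    show "summable (\<lambda>j. 1 / wt j)" by (rule summable_inverse_wt)
    show "summable (\<lambda>j. wt j * y j powr \<tau>)" by (rule summable_y_powr[OF \<tau>(1)])
    show "0 \<le> real K / sqrt (1 - y 0) * real n powr (- 2 * \<tau>\<^sup>2)" using y0_less_1 by simp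
  qed auto
  also have "measure_pmf.prob (draws n) B \<le> real n * small_mass n / real n powr (6 * \<tau>)"
    unfolding B_def using n0 small_mass_nonneg
    by (intro pmf_Markov num_small_expectation) auto
  also have "\<dots> \<le> real n * (real n powr ((2 * \<tau> - 1) * (1 - \<tau>)) * (\<Sum>j. y j powr \<tau>)) / real n powr (6 * \<tau>)"
    using small_mass_le[OF n] n0 by (intro divide_right_mono mult_left_mono) auto
  also have "\<dots> = real n powr (1 + (2 * \<tau> - 1) * (1 - \<tau>) - 6 * \<tau>) * (\<Sum>j. y j powr \<tau>)"
  proof -
    have "real n powr (1 + (2 * \<tau> - 1) * (1 - \<tau>) - 6 * \<tau>) = real n powr 1 * real n powr ((2 * \<tau> - 1) * (1 - \<tau>)) / real n powr (6 * \<tau>)"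
      by (simp only: powr_diff powr_add)
    then show ?thesis using n0 by simp
  qed
  also have "measure_pmf.prob (draws n) E \<le> (1 / sqrt (real n) * (\<Sum>j. real (Suc j) ^ (2 * m) * y j powr (1/2))) / real n powr (- 1/4)"
    unfolding E_def
  proof (rule pmf_Markov)
    have s: "summable (\<lambda>j. real (Suc j) ^ (2 * m) * y j powr (1/2))" by (rule summable_y_powr) simp
    show "0 \<le> 1 / sqrt (real n) * (\<Sum>j. real (Suc j) ^ (2 * m) * y j powr (1/2))"
      by (intro mult_nonneg_nonneg suminf_nonneg s) auto
    have "(\<integral>\<^sup>+xs. ennreal (\<Sum>j\<in>large n. wt j ^ (m - 1) * freq_error y n xs j) \<partial>draws n)
      = (\<integral>\<^sup>+xs. (\<Sum>j\<in>large n. ennreal (wt j ^ (m - 1)) * ennreal (freq_error y n xs j)) \<partial>draws n)"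
      by (intro nn_integral_cong) (simp add: freq_error_def flip: ennreal_mult sum_ennreal)
    also have "\<dots> = (\<Sum>j\<in>large n. ennreal (wt j ^ (m - 1)) * (\<integral>\<^sup>+xs. ennreal (freq_error y n xs j) \<partial>draws n))"
      by (subst nn_integral_sum) (simp_all add: nn_integral_cmult)
    also have "\<dots> \<le> (\<Sum>j\<in>large n. ennreal (wt j ^ (m - 1)) * ennreal (wt j * sqrt (y j) / sqrt (real n)))"
      by (intro sum_mono mult_left_mono nn_integral_freq_error y n) auto
    also have "\<dots> = (\<Sum>j\<in>large n. ennreal (1 / sqrt (real n) * (real (Suc j) ^ (2 * m) * y j powr (1/2))))"
    proof (rule sum.cong[OF refl])
      fix j
      have w: "wt j ^ (m - 1) * wt j = real (Suc j) ^ (2 * m)"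
      proof -
        have "wt j ^ (m - 1) * wt j = wt j ^ m" using m by (simp only: power_minus_mult[of m])
        then show ?thesis by (simp only: power_mult)
      qed
      have "wt j ^ (m - 1) * (wt j * sqrt (y j) / sqrt (real n)) = 1 / sqrt (real n) * (real (Suc j) ^ (2 * m) * y j powr (1/2))"
        using pos[of j] unfolding w[symmetric] by (simp add: powr_half_sqrt del: of_nat_Suc)
      then show "ennreal (wt j ^ (m - 1)) * ennreal (wt j * sqrt (y j) / sqrt (real n))
        = ennreal (1 / sqrt (real n) * (real (Suc j) ^ (2 * m) * y j powr (1/2)))"
        using y01(1)[of j] by (subst ennreal_mult[symmetric]) (simp_all del: of_nat_Suc)
    qed
    also have "\<dots> = ennreal (\<Sum>j\<in>large n. 1 / sqrt (real n) * (real (Suc j) ^ (2 * m) * y j powr (1/2)))"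
      by (rule sum_ennreal) simp
    also have "\<dots> \<le> ennreal (1 / sqrt (real n) * (\<Sum>j. real (Suc j) ^ (2 * m) * y j powr (1/2)))"
      unfolding sum_distrib_left[symmetric]
      by (intro ennreal_leI mult_left_mono sum_le_suminf s finite_large n) auto
    finally show "(\<integral>\<^sup>+xs. ennreal (\<Sum>j\<in>large n. wt j ^ (m - 1) * freq_error y n xs j) \<partial>draws n)
      \<le> ennreal (1 / sqrt (real n) * (\<Sum>j. real (Suc j) ^ (2 * m) * y j powr (1/2)))" .
  qed (use n0 in simp)
  also have "(1 / sqrt (real n) * (\<Sum>j. real (Suc j) ^ (2 * m) * y j powr (1/2))) / real n powr (- 1/4)
    = real n powr (- 1/4) * (\<Sum>j. real (Suc j) ^ (2 * m) * y j powr (1/2))"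
  proof -
    have "1 / sqrt (real n) = real n powr (- 1/4) * real n powr (- 1/4)"
      using n0 by (simp add: powr_minus_divide powr_half_sqrt[symmetric] flip: powr_add)
    then show ?thesis using n0 by simp
  qed
  finally show ?thesis unfolding bad_bound_def by (simp only: add.assoc)
qed

end

section \<open>Phases of the large circles\<close>

text \<open>Decay faster than \<open>(j + 1)\<^bsup>-4\<^esup>\<close> and the lower bound for the phases place the parameters in a box.\<close>

lemma xi_version_eq:
  assumes y: "geometric_decay y" "\<And>j. y j \<in> {0..1}" and c: "0 < c" "\<And>j. c / wt j \<le> norm (1 - u j)"
  shows "xi_version (y, u) = xi_infinity y u"
proof -
  have y0: "0 \<le> y j" "y j \<le> 1" for j using y(2)[of j] by auto
  have "summable (\<lambda>j. real (Suc j) ^ 4 * y j powr 1)" by (rule summable_power_powr[OF y(1) y0(1)]) simp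
  then have "Bseq (\<lambda>j. real (Suc j) ^ 4 * y j powr 1)"
    using summable_LIMSEQ_zero convergentI convergent_imp_Bseq by blast
  then obtain B where B: "\<And>j. norm (real (Suc j) ^ 4 * y j powr 1) \<le> B" by (auto simp: Bseq_def)
  obtain k where k: "max B (1 / c) < real k" using reals_Archimedean2 by blast
  have "y j \<le> real k / real (Suc j) ^ 4" for j
  proof -
    have "real (Suc j) ^ 4 * y j \<le> real k" using B[of j] k y0(1)[of j] by simp
    then show ?thesis by (simp add: pos_le_divide_eq mult.commute del: of_nat_Suc)
  qed
  moreover have "1 / (real (Suc k) * real (Suc j) ^ 2) \<le> norm (1 - u j)" for j
  proof -
    have "1 / real (Suc k) \<le> c" using k c(1) by (simp add: field_simps)
    then have "1 / real (Suc k) / wt j \<le> c / wt j" by (rule divide_right_mono) simp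
    then show ?thesis using c(2)[of j] by (simp del: of_nat_Suc)
  qed
  ultimately have "(y, u) \<in> xi_boxes k" using y0 by (simp add: xi_boxes_def xi_box_def)
  then have "(y, u) \<in> (\<Union>k. xi_boxes k)" by blast
  then show ?thesis unfolding xi_version_def by simp
qed

lemma xi_params_freq:
  assumes "length xs = n" "\<And>j. v j \<noteq> 1"
  shows "xi_params (circle_freq n xs) v"
proof -
  have "summable (xi_mass (circle_freq n xs) v)"
    by (rule summable_finite[of "set xs"]) (auto simp: xi_mass_def circle_freq_def count_list_0_iff)
  then show ?thesis using circle_freq_unit[OF assms(1)] assms(2) by (simp add: xi_params_def)
qed

lemma prod_list_eq_prod_count:
  fixes w :: "nat \<Rightarrow> complex"
  assumes "\<And>x. J \<le> x \<Longrightarrow> w x = 1"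
  shows "prod_list (map w xs) = (\<Prod>j<J. w j ^ count_list xs j)"
proof (induction xs)
  case (Cons x xs)
  have "(\<Prod>j<J. w j ^ count_list (x # xs) j) = (\<Prod>j<J. (if j = x then w x else 1) * w j ^ count_list xs j)"
    by (intro prod.cong) auto
  also have "\<dots> = (\<Prod>j<J. if j = x then w x else 1) * (\<Prod>j<J. w j ^ count_list xs j)" by (rule prod.distrib)
  also have "(\<Prod>j<J. if j = x then w x else 1) = w x"
    using assms[of x] by (cases "x < J") (simp_all add: prod.delta)
  finally show ?case using Cons by simp
qed simp

context fixed_perimeters begin

text \<open>The phases with those of the small circles replaced by \<open>- 1\<close>. The phase of a small circle
  may be very close to \<open>1\<close>, but every circle is large for all large \<open>n\<close>, so that the replacement is invisible in the limit.\<close>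

definition large_phase :: "nat \<Rightarrow> nat list \<Rightarrow> nat \<Rightarrow> complex" where
  "large_phase n xs j = (if j \<in> large n then cis (- (2 * pi * \<alpha> * real (count_list xs j))) else - 1)"

definition phase_gap :: "nat \<Rightarrow> nat \<Rightarrow> real" where
  "phase_gap K j = c / real (step_bound K j) ^ m"

lemma large_phase_torus: "large_phase n xs \<in> torus"
  by (simp add: large_phase_def torus_def)

lemma phase_gap_bounds:
  assumes K: "0 < K"
  shows "0 < phase_gap K j" "phase_gap K j \<le> 1 / real K * (1 / wt j)" "phase_gap K j = c / (real K ^ m * wt j ^ m)"
    "phase_gap K j \<le> 1"
proof -
  have H: "real (step_bound K j) = real K * wt j" by (simp add: step_bound_def)
  have w1: "1 \<le> wt j" by (rule one_le_power) simp
  have H1: "1 \<le> real K * wt j" using K w1 mult_mono[of 1 "real K" 1 "wt j"] by (simp del: of_nat_Suc)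
  show "0 < phase_gap K j" unfolding phase_gap_def H using c H1 by (intro divide_pos_pos zero_less_power) auto
  show "phase_gap K j = c / (real K ^ m * wt j ^ m)" unfolding phase_gap_def H by (simp only: power_mult_distrib)
  have "(real K * wt j) ^ 1 \<le> (real K * wt j) ^ m" by (rule power_increasing) (use m H1 in auto)
  then have "c / (real K * wt j) ^ m \<le> 1 / (real K * wt j)" using c H1 by (intro frac_le) auto
  then show a: "phase_gap K j \<le> 1 / real K * (1 / wt j)" unfolding phase_gap_def H by simp
  have "1 / (real K * wt j) \<le> 1" using H1 by simp
  then show "phase_gap K j \<le> 1" using a by simp
qed

lemma norm_one_minus_phase: "2 * dist_nearest_int (real k * \<alpha>) \<le> norm (1 - cis (- (2 * pi * \<alpha> * real k)))"
proof -
  have "norm (1 - cis (- (2 * pi * \<alpha> * real k))) = norm (cnj (1 - cis (2 * pi * (real k * \<alpha>))))"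
    by (simp add: cis_cnj mult_ac)
  then show ?thesis using norm_one_minus_cis_ge[of "real k * \<alpha>"] by (simp only: complex_mod_cnj)
qed

lemma large_phase_away:
  assumes K: "0 < K" and xs: "xs \<in> good_lists K n"
  shows "phase_gap K j \<le> norm (1 - large_phase n xs j)"
proof (cases "j \<in> large n")
  case True
  then have "c / (2 * real (step_bound K j) ^ m) \<le> dist_nearest_int (real (count_list xs j) * \<alpha>)"
    using xs by (simp add: good_lists_def)
  then have "phase_gap K j \<le> 2 * dist_nearest_int (real (count_list xs j) * \<alpha>)" by (simp add: phase_gap_def)
  also have "\<dots> \<le> norm (1 - large_phase n xs j)"
    using True norm_one_minus_phase by (simp add: large_phase_def)
  finally show ?thesis .
next
  case False
  then show ?thesis using phase_gap_bounds(4)[OF K, of j] by (simp add: large_phase_def)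
qed

definition gap_bound :: "nat \<Rightarrow> nat \<Rightarrow> real" where
  "gap_bound K n = real K ^ m / c * real n powr (- 1/4) + small_mass n + 2 / c * real n powr (- 1/4)"

lemma small_mass_tendsto: "small_mass \<longlonglongrightarrow> 0"
proof (rule tendsto_sandwich[OF _ _ tendsto_const])
  show "eventually (\<lambda>n. 0 \<le> small_mass n) sequentially" using small_mass_nonneg by simp
  show "eventually (\<lambda>n. small_mass n \<le> real n powr ((2 * \<tau> - 1) * (1 - \<tau>)) * (\<Sum>j. y j powr \<tau>)) sequentially"
    using eventually_gt_at_top[of 0] by eventually_elim (rule small_mass_le)
  have "(\<lambda>n. real n powr ((2 * \<tau> - 1) * (1 - \<tau>))) \<longlonglongrightarrow> 0"
    using \<tau> by (intro tendsto_neg_powr filterlim_real_sequentially mult_neg_pos) auto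
  then show "(\<lambda>n. real n powr ((2 * \<tau> - 1) * (1 - \<tau>)) * (\<Sum>j. y j powr \<tau>)) \<longlonglongrightarrow> 0"
    by (rule tendsto_mult_left_zero)
qed

lemma gap_bound_tendsto: "gap_bound K \<longlonglongrightarrow> 0"
proof -
  have "(\<lambda>n. real n powr (- 1/4)) \<longlonglongrightarrow> 0"
    by (intro tendsto_neg_powr filterlim_real_sequentially) simp
  then have "(\<lambda>n. gap_bound K n) \<longlonglongrightarrow> real K ^ m / c * 0 + 0 + 2 / c * 0"
    unfolding gap_bound_def by (intro tendsto_intros small_mass_tendsto)
  then show ?thesis by simp
qed

text \<open>On a large circle the two phases agree, and only the error of the frequency counts. On a small circle
  with \<open>k\<close> points the Diophantine bound gives \<open>1 / |1 - v| \<le> k\<^sup>m / (2 c)\<close>, which the frequency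
  \<open>k / n\<close> multiplies.\<close>

lemma gap_le:
  assumes K: "0 < K" and n: "0 < n" and xs: "xs \<in> good_lists K n"
  shows "xi_gap (circle_freq n xs) (circle_phase \<alpha> xs) y (large_phase n xs) j
    \<le> (if j \<in> large n then real K ^ m / c * (wt j ^ (m - 1) * freq_error y n xs j) else 0)
      + (if j \<in> large n then 0 else y j)
      + (if j \<in> large n then 0 else 2 / c * (real (count_list xs j ^ Suc m) / real n))"
proof (cases "j \<in> large n")
  case True
  have "0 < c / (2 * real (step_bound K j) ^ m)" using c K by (simp add: step_bound_def)
  also have "\<dots> \<le> dist_nearest_int (real (count_list xs j) * \<alpha>)" using xs True by (simp add: good_lists_def)
  finally have dpos: "0 < dist_nearest_int (real (count_list xs j) * \<alpha>)" .
  have "count_list xs j \<noteq> 0"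
  proof
    assume "count_list xs j = 0"
    then have "dist_nearest_int (real (count_list xs j) * \<alpha>) = 0" by (simp add: dist_nearest_int_def)
    then show False using dpos by simp
  qed
  then have eq: "circle_phase \<alpha> xs j = large_phase n xs j" using True by (simp add: circle_phase_def large_phase_def)
  have "\<bar>circle_freq n xs j - y j\<bar> / norm (1 - large_phase n xs j) \<le> \<bar>circle_freq n xs j - y j\<bar> / phase_gap K j"
    by (rule frac_le[OF _ order.refl phase_gap_bounds(1)[OF K] large_phase_away[OF K xs]]) simp
  also have "\<dots> = real K ^ m / c * (wt j ^ m * \<bar>circle_freq n xs j - y j\<bar>)"
    unfolding phase_gap_bounds(3)[OF K] using c by (simp del: of_nat_Suc)
  also have "wt j ^ m = wt j ^ (m - 1) * wt j" using m by (simp only: power_minus_mult[of m])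
  finally show ?thesis using True eq by (simp add: xi_gap_def freq_error_def mult.assoc del: of_nat_Suc)
next
  case False
  have v: "large_phase n xs j = - 1" using False by (simp add: large_phase_def)
  define k where "k = count_list xs j"
  have a: "circle_freq n xs j = real k / real n" by (simp add: circle_freq_def k_def)
  have "xi_gap (circle_freq n xs) (circle_phase \<alpha> xs) y (large_phase n xs) j \<le> y j + 2 / c * (real (k ^ Suc m) / real n)"
  proof (cases "k = 0")
    case True
    then show ?thesis using y01(1)[of j] by (simp add: xi_gap_def v a)
  next
    case k0: False
    have "2 * (c / real k ^ m) \<le> norm (1 - circle_phase \<alpha> xs j)"
      using lower[OF k0] norm_one_minus_phase[of k] k0 by (simp add: circle_phase_def k_def)
    then have "1 / norm (1 - circle_phase \<alpha> xs j) \<le> 1 / (2 * (c / real k ^ m))"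
      using c k0 by (intro frac_le) auto
    then have "norm (1 / (1 - circle_phase \<alpha> xs j) - 1 / (1 - (- 1))) \<le> real k ^ m / (2 * c) + 1 / 2"
      using norm_triangle_ineq4[of "1 / (1 - circle_phase \<alpha> xs j)" "1 / (1 - (- 1))"] by (simp add: norm_divide)
    then have "real k / real n * norm (1 / (1 - circle_phase \<alpha> xs j) - 1 / (1 - (- 1))) \<le> real k / real n * (real k ^ m / (2 * c) + 1 / 2)"
      by (rule mult_left_mono) simp
    moreover have "\<bar>real k / real n - y j\<bar> / norm (1 - (- 1) :: complex) \<le> y j / 2 + real k / real n * (1 / 2)"
    proof -
      have "\<bar>real k / real n - y j\<bar> \<le> y j + real k / real n" using y01(1)[of j] by (simp add: abs_le_iff)
      then show ?thesis by (simp add: add_divide_distrib[symmetric] divide_right_mono)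
    qed
    moreover have "real k / real n * (real k ^ m / (2 * c) + 1 / 2) + real k / real n * (1 / 2) \<le> real k / real n * (2 / c * real k ^ m)"
    proof -
      have "1 \<le> real k ^ m / c"
      proof -
        have "1 \<le> real k ^ m" using k0 by simp
        then show ?thesis using c by (simp add: pos_le_divide_eq)
      qed
      then have "real k ^ m / (2 * c) + 1 / 2 + 1 / 2 \<le> 2 / c * real k ^ m" using c by (simp add: field_simps)
      then have "real k / real n * (real k ^ m / (2 * c) + 1 / 2 + 1 / 2) \<le> real k / real n * (2 / c * real k ^ m)"
        by (rule mult_left_mono) simp
      then show ?thesis by (simp add: ring_distribs)
    qed
    moreover have "real k / real n * (2 / c * real k ^ m) = 2 / c * (real (k ^ Suc m) / real n)"
      by (simp add: mult_ac)
    ultimately show ?thesis using y01(1)[of j] unfolding xi_gap_def v a by linarith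
  qed
  then show ?thesis using False by (simp add: k_def)
qed

text \<open>The sum of the powers \<open>k\<^bsup>m + 1\<^esup>\<close> over small circles is at most the power of the total number of points
  on them, by superadditivity.\<close>

lemma gap_sum_le:
  assumes K: "0 < K" and n: "0 < n" and xs: "xs \<in> good_lists K n" and len: "length xs = n"
  defines "g \<equiv> xi_gap (circle_freq n xs) (circle_phase \<alpha> xs) y (large_phase n xs)"
  shows "summable g" "(\<Sum>j. g j) \<le> gap_bound K n"
proof -
  define B1 where "B1 = (\<lambda>j. if j \<in> large n then real K ^ m / c * (wt j ^ (m - 1) * freq_error y n xs j) else 0)"
  define B2 where "B2 = (\<lambda>j. if j \<in> large n then 0 else y j)"
  define B3 where "B3 = (\<lambda>j. if j \<in> large n then 0 else 2 / c * (real (count_list xs j ^ Suc m) / real n))"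
  define S1 where "S1 = (\<Sum>j\<in>large n. wt j ^ (m - 1) * freq_error y n xs j)"
  define S3 where "S3 = (\<Sum>j\<in>set xs - large n. 2 / c * (real (count_list xs j ^ Suc m) / real n))"
  have s1: "B1 sums (real K ^ m / c * S1)"
    unfolding B1_def S1_def sum_distrib_left by (rule sums_If_finite_set) (rule finite_large[OF n])
  have s2: "B2 sums small_mass n" unfolding B2_def small_mass_def by (rule summable_sums[OF summable_small])
  have s3: "B3 sums S3"
  proof -
    have "B3 sums (\<Sum>j\<in>set xs - large n. B3 j)"
      by (rule sums_finite) (auto simp: B3_def count_list_0_iff)
    also have "(\<Sum>j\<in>set xs - large n. B3 j) = S3" unfolding S3_def B3_def by (intro sum.cong) auto
    finally show ?thesis .
  qed
  have s: "(\<lambda>j. B1 j + B2 j + B3 j) sums (real K ^ m / c * S1 + small_mass n + S3)"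
    by (intro sums_add s1 s2 s3)
  have le: "g j \<le> B1 j + B2 j + B3 j" for j unfolding g_def B1_def B2_def B3_def by (rule gap_le[OF K n xs])
  have g0: "0 \<le> g j" for j unfolding g_def by (rule xi_gap_nonneg) (simp add: circle_freq_def)
  show sg: "summable g"
    by (rule summable_comparison_test'[OF sums_summable[OF s], of 0]) (use le g0 in auto)
  have "(\<Sum>j. g j) \<le> real K ^ m / c * S1 + small_mass n + S3"
    using suminf_le[OF le sg sums_summable[OF s]] sums_unique[OF s] by simp
  also have "\<dots> \<le> gap_bound K n"
    unfolding gap_bound_def
  proof (intro add_mono order.refl)
    have "S1 \<le> real n powr (- 1/4)" using xs by (simp add: good_lists_def S1_def)
    then show "real K ^ m / c * S1 \<le> real K ^ m / c * real n powr (- 1/4)" using c by (intro mult_left_mono) auto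
    have n0: "0 < real n" using n by simp
    have "(\<Sum>j\<in>set xs - large n. count_list xs j ^ Suc m) \<le> num_small n xs ^ Suc m"
      unfolding num_small_def sum_count_list_off[symmetric] by (rule sum_power_le) auto
    then have "real (\<Sum>j\<in>set xs - large n. count_list xs j ^ Suc m) \<le> real (num_small n xs) ^ Suc m"
      by (simp only: of_nat_power[symmetric] of_nat_le_iff)
    also have "\<dots> \<le> (real n powr (6 * \<tau>)) ^ Suc m"
      using xs by (intro power_mono) (auto simp: good_lists_def)
    also have "\<dots> = real n powr (3 / 4)"
    proof -
      have "(real n powr (6 * \<tau>)) ^ Suc m = (real n powr (6 * \<tau>)) powr real (Suc m)"
        by (rule powr_realpow[symmetric]) (use n0 in simp)
      then show ?thesis by (simp only: powr_powr \<tau>(3))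
    qed
    finally have le: "real (\<Sum>j\<in>set xs - large n. count_list xs j ^ Suc m) \<le> real n powr (3 / 4)" .
    have "S3 = 2 / c * (real (\<Sum>j\<in>set xs - large n. count_list xs j ^ Suc m) / real n)"
      unfolding S3_def of_nat_sum sum_distrib_left[symmetric] sum_divide_distrib[symmetric] ..
    also have "\<dots> \<le> 2 / c * (real n powr (3 / 4) / real n)"
      using le c n0 by (intro mult_left_mono divide_right_mono) auto
    also have "real n powr (3 / 4) / real n = real n powr (- 1/4)"
      using n0 powr_diff[of "real n" "3/4" 1] by simp
    finally show "S3 \<le> 2 / c * real n powr (- 1/4)" .
  qed
  finally show "(\<Sum>j. g j) \<le> gap_bound K n" .
qed

text \<open>Once the first \<open>J\<close> circles are large the monomial is a product of \<open>w\<close> over the labels drawn. Its mean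
  is the \<open>n\<close>-th power of the mean of \<open>w\<close>, which has modulus less than \<open>1\<close> unless \<open>w\<close> is constant, as
  all labels have positive probability; by irrationality \<open>w\<close> is constant only if \<open>a\<close> and \<open>b\<close> agree.\<close>

lemma large_phase_moments:
  "(\<lambda>n. measure_pmf.expectation (draws n) (\<lambda>xs. torus_monom a b J (large_phase n xs)))
     \<longlonglongrightarrow> (if \<forall>j<J. a j = b j then 1 else 0)"
proof -
  define w where "w = (\<lambda>j. if j < J then cis (- (2 * pi * \<alpha> * (real (a j) - real (b j)))) else 1)"
  have fin: "finite (range w)"
  proof (rule finite_subset)
    show "range w \<subseteq> insert 1 (w ` {..<J})" by (auto simp: w_def)
  qed simp
  have ev: "eventually (\<lambda>n. measure_pmf.expectation (draws n) (\<lambda>xs. torus_monom a b J (large_phase n xs))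
    = (measure_pmf.expectation (circle_pmf y) w) ^ n) sequentially"
  proof -
    have "eventually (\<lambda>n. \<forall>j\<in>{..<J}. j \<in> large n) sequentially"
      using eventually_large by (intro eventually_ball_finite) auto
    then show ?thesis
    proof eventually_elim
      case (elim n)
      have "torus_monom a b J (large_phase n xs) = prod_list (map w xs)" for xs
      proof -
        have "prod_list (map w xs) = (\<Prod>j<J. w j ^ count_list xs j)"
          by (rule prod_list_eq_prod_count) (simp add: w_def)
        also have "\<dots> = torus_monom a b J (large_phase n xs)"
          unfolding torus_monom_def
        proof (rule prod.cong[OF refl])
          fix j assume j: "j \<in> {..<J}"
          define t where "t = 2 * pi * \<alpha>"
          define k where "k = count_list xs j"
          have "large_phase n xs j ^ a j * cnj (large_phase n xs j) ^ b j = cis (real (a j) * (- (t * real k))) * cis (real (b j) * (t * real k))"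
            using elim j by (simp add: large_phase_def cis_cnj Complex.DeMoivre t_def k_def)
          also have "\<dots> = cis (real k * (- (t * (real (a j) - real (b j)))))"
            unfolding cis_mult by (rule arg_cong[where f=cis]) (simp add: algebra_simps)
          also have "\<dots> = w j ^ k" using j by (simp add: w_def Complex.DeMoivre t_def)
          finally show "w j ^ count_list xs j = large_phase n xs j ^ a j * cnj (large_phase n xs j) ^ b j"
            by (simp add: k_def)
        qed
        finally show ?thesis by simp
      qed
      then show ?case using expectation_prod_list[OF fin, of n "circle_pmf y"] by simp
    qed
  qed
  have "(\<lambda>n. (measure_pmf.expectation (circle_pmf y) w) ^ n) \<longlonglongrightarrow> (if \<forall>j<J. a j = b j then 1 else 0)"
  proof (cases "\<forall>j<J. a j = b j")
    case True
    then have "w = (\<lambda>_. 1)" by (auto simp: w_def)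
    then show ?thesis using True by simp
  next
    case False
    then obtain j0 where j0: "j0 < J" "a j0 \<noteq> b j0" by blast
    have "w j0 \<noteq> 1"
    proof (cases "a j0 < b j0")
      case True
      have "w j0 = cis (2 * pi * \<alpha> * real (b j0 - a j0))"
        using j0 True by (simp add: w_def of_nat_diff algebra_simps)
      then show ?thesis using cis_irrational_ne_1(1)[OF \<alpha>, of "b j0 - a j0"] True by simp
    next
      case ge: False
      have "w j0 = cis (- (2 * pi * \<alpha> * real (a j0 - b j0)))"
        using j0 ge by (simp add: w_def of_nat_diff)
      then show ?thesis using cis_irrational_ne_1(2)[OF \<alpha>, of "a j0 - b j0"] ge j0 by simp
    qed
    then have ne: "w j0 \<noteq> w J" by (simp add: w_def)
    have mem: "j \<in> set_pmf (circle_pmf y)" for j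
      using pos[of j] by (simp add: set_pmf_iff pmf_circle_pmf_nabla'[OF y])
    have "norm (measure_pmf.expectation (circle_pmf y) w) < 1"
      by (rule norm_expectation_less_1[OF fin _ ne mem mem]) (simp add: w_def)
    then have "(\<lambda>n. (measure_pmf.expectation (circle_pmf y) w) ^ n) \<longlonglongrightarrow> 0" by (rule LIMSEQ_power_zero)
    then show ?thesis by (subst if_not_P[OF False])
  qed
  then show ?thesis by (rule Lim_transform_eventually) (use ev in \<open>simp add: eq_commute\<close>)
qed

end

section \<open>The limit law for fixed perimeters\<close>

context fixed_perimeters begin

text \<open>A compact set that contains \<open>large_phase n xs\<close> for good samples, and uniform phases with probability
  \<open>1 - O(1 / K)\<close>.\<close>

definition phase_set :: "nat \<Rightarrow> (nat \<Rightarrow> complex) set" where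
  "phase_set K = {u. \<forall>j. norm (u j) = 1 \<and> phase_gap K j \<le> norm (1 - u j)}"

lemma phase_set_box: "u \<in> phase_set K \<Longrightarrow> (y, u) \<in> xi_box y (phase_gap K)"
  using y01 by (simp add: phase_set_def xi_box_def)

lemma summable_y_over_gap:
  assumes K: "0 < K"
  shows "summable (\<lambda>j. y j / phase_gap K j)"
proof -
  have "summable (\<lambda>j. real K ^ m / c * (real (Suc j) ^ (2 * m) * y j powr 1))"
    by (intro summable_mult summable_y_powr) simp
  moreover have "y j / phase_gap K j = real K ^ m / c * (real (Suc j) ^ (2 * m) * y j powr 1)" for j
    unfolding phase_gap_bounds(3)[OF K] power_mult using y01(1)[of j] c by (simp add: field_simps del: of_nat_Suc)
  ultimately show ?thesis by simp
qed

lemma closed_phase_set: "closed (phase_set K)"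
  unfolding phase_set_def
  by (intro closed_Collect_all closed_Collect_conj closed_Collect_eq closed_Collect_le continuous_intros
      continuous_on_product_coordinates)

lemma compact_phase_set: "compact (phase_set K)"
proof -
  have "phase_set K = torus \<inter> phase_set K" by (auto simp: torus_def phase_set_def)
  then show ?thesis using compact_Int_closed[OF compact_torus closed_phase_set] by metis
qed

lemma large_phase_in_set: "0 < K \<Longrightarrow> xs \<in> good_lists K n \<Longrightarrow> large_phase n xs \<in> phase_set K"
  using large_phase_away large_phase_torus[of n xs] by (simp add: phase_set_def torus_def)

lemma xi_phase_tendsto:
  assumes K: "0 < K" and F: "continuous_map compact_convergence_topology euclideanreal F"
    and u: "\<And>k. u k \<in> phase_set K" "u' \<in> phase_set K" and lim: "u \<longlonglongrightarrow> u'"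
    and len: "\<And>k. length (xs k) = N k"
    and gap: "\<And>k. summable (xi_gap (circle_freq (N k) (xs k)) (circle_phase \<alpha> (xs k)) y (u k))"
      "(\<lambda>k. \<Sum>j. xi_gap (circle_freq (N k) (xs k)) (circle_phase \<alpha> (xs k)) y (u k) j) \<longlonglongrightarrow> 0"
  shows "(\<lambda>k. F (xi_list \<alpha> (N k) (xs k))) \<longlonglongrightarrow> F (xi_infinity y u')"
proof (rule compact_continuous_map_tendsto[OF F])
  note box = xi_box_params[OF phase_set_box phase_gap_bounds(1)[OF K] summable_y_over_gap[OF K], simplified]
  show "continuous_on UNIV (xi_infinity y u')" by (rule continuous_on_xi_infinity[OF box(1)[OF u(2)]])
  show "continuous_on UNIV (xi_list \<alpha> (N k) (xs k))" for k
    by (rule continuous_on_xi_infinity[OF xi_params_freq[OF len circle_phase_ne_1[OF \<alpha>]]])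
  fix R e :: real assume e: "0 < e"
  have "eventually (\<lambda>k. \<forall>z\<in>cball 0 R. dist (xi_list \<alpha> (N k) (xs k) z) (xi_infinity y (u k) z) < e / 2) sequentially"
  proof (rule xi_infinity_dist_tendsto[where S="\<Sum>j. y j / phase_gap K j", OF box(1)[OF u(1)] _ gap(1) _ _ gap(2)])
    show "(\<Sum>j. xi_mass y (u k) j) \<le> (\<Sum>j. y j / phase_gap K j)" for k
      by (intro suminf_le box(2)[OF u(1)] summable_y_over_gap[OF K]) (use box(1)[OF u(1)] in \<open>simp add: xi_params_def\<close>)
    show "circle_freq (N k) (xs k) j \<in> {0..1}" for k j by (rule circle_freq_unit[OF len])
    show "circle_phase \<alpha> (xs k) j \<noteq> 1" for k j by (rule circle_phase_ne_1[OF \<alpha>])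
  qed (use e in simp)
  moreover have "eventually (\<lambda>k. \<forall>z\<in>cball 0 R. dist (xi_infinity y (u k) z) (xi_infinity y u' z) < e / 2) sequentially"
    using xi_box_seq_continuous[of "\<lambda>k. (y, u k)" y "phase_gap K" "(y, u')" "e / 2" R]
      phase_set_box[OF u(1)] phase_set_box[OF u(2)] phase_gap_bounds(1)[OF K] summable_y_over_gap[OF K]
      tendsto_coordinate[OF lim] e by simp
  ultimately show "eventually (\<lambda>k. \<forall>z\<in>cball 0 R. dist (xi_list \<alpha> (N k) (xs k) z) (xi_infinity y u' z) < e) sequentially"
  proof eventually_elim
    case (elim k)
    show ?case
    proof
      fix z assume "z \<in> cball (0::complex) R"
      then show "dist (xi_list \<alpha> (N k) (xs k) z) (xi_infinity y u' z) < e"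
        using elim dist_triangle[of "xi_list \<alpha> (N k) (xs k) z" "xi_infinity y u' z" "xi_infinity y (u k) z"]
        by fastforce
    qed
  qed
qed

lemma continuous_on_F_xi:
  assumes K: "0 < K" and F: "continuous_map compact_convergence_topology euclideanreal F"
  shows "continuous_on (phase_set K) (\<lambda>u. F (xi_infinity y u))"
  unfolding continuous_on_sequentially
proof (intro allI ballI impI, elim conjE)
  fix u u' assume u': "u' \<in> phase_set K" and u: "\<forall>k. u k \<in> phase_set K" and lim: "u \<longlonglongrightarrow> u'"
  note box = xi_box_params[OF phase_set_box phase_gap_bounds(1)[OF K] summable_y_over_gap[OF K], simplified]
  have "(\<lambda>k. F (xi_infinity y (u k))) \<longlonglongrightarrow> F (xi_infinity y u')"
  proof (rule compact_continuous_map_tendsto[OF F])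
    show "continuous_on UNIV (xi_infinity y u')" by (rule continuous_on_xi_infinity[OF box(1)[OF u']])
    show "continuous_on UNIV (xi_infinity y (u k))" for k
      by (rule continuous_on_xi_infinity[OF box(1)]) (use u in blast)
    fix R e :: real assume "0 < e"
    then show "eventually (\<lambda>k. \<forall>z\<in>cball 0 R. dist (xi_infinity y (u k) z) (xi_infinity y u' z) < e) sequentially"
      using xi_box_seq_continuous[of "\<lambda>k. (y, u k)" y "phase_gap K" "(y, u')" e R]
        phase_set_box[OF u[rule_format]] phase_set_box[OF u'] phase_gap_bounds(1)[OF K] summable_y_over_gap[OF K]
        tendsto_coordinate[OF lim] by simp
  qed
  then show "((\<lambda>u. F (xi_infinity y u)) \<circ> u) \<longlonglongrightarrow> F (xi_infinity y u')" by (simp add: comp_def)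
qed

text \<open>Otherwise there would be good samples of increasing sizes violating the bound. Along a subsequence their
  phases converge in the compact \<^term>\<open>phase_set K\<close>, and both terms have the same limit.\<close>

lemma eventually_close_on_good:
  assumes K: "0 < K" and F: "continuous_map compact_convergence_topology euclideanreal F"
    and h: "continuous_on UNIV h" "\<And>u. u \<in> phase_set K \<Longrightarrow> h u = F (xi_infinity y u)" and d: "0 < d"
  shows "eventually (\<lambda>n. \<forall>xs\<in>good_lists K n. length xs = n \<longrightarrow>
    \<bar>F (xi_list \<alpha> n xs) - h (large_phase n xs)\<bar> < d) sequentially"
proof (rule ccontr)
  define Q where "Q = (\<lambda>n xs. xs \<in> good_lists K n \<and> length xs = n \<and>
    \<not> \<bar>F (xi_list \<alpha> n xs) - h (large_phase n xs)\<bar> < d)"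
  assume "\<not> ?thesis"
  then have ex: "\<exists>n>k. \<exists>xs. Q n xs" for k
    unfolding eventually_sequentially Q_def by (metis Suc_le_eq)
  have "\<exists>n. \<forall>k. n k < n (Suc k) \<and> 0 < n (Suc k) \<and> (\<exists>xs. Q (n (Suc k)) xs)"
    using dependent_nat_choice[of "\<lambda>_ _. True" "\<lambda>_ n n'. n < n' \<and> 0 < n' \<and> (\<exists>xs. Q n' xs)"] ex
    by (metis gr_implies_not0 neq0_conv)
  then obtain N0 where N0: "\<And>k. N0 k < N0 (Suc k)" "\<And>k. \<exists>xs. Q (N0 (Suc k)) xs" by blast
  define N where "N = (\<lambda>k. N0 (Suc k))"
  have mono: "strict_mono N" unfolding N_def by (rule strict_mono_Suc_iff[THEN iffD2]) (use N0 in simp)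
  have Npos: "0 < N k" for k unfolding N_def using N0(1)[of k] by simp
  obtain xs where xs: "\<And>k. Q (N k) (xs k)" using N0(2) unfolding N_def by metis
  have good: "xs k \<in> good_lists K (N k)" "length (xs k) = N k" for k using xs by (simp_all add: Q_def)
  have "\<exists>l\<in>phase_set K. \<exists>r. strict_mono r \<and> ((\<lambda>k. large_phase (N k) (xs k)) \<circ> r) \<longlonglongrightarrow> l"
    by (rule compact_phase_set[unfolded compact_def, THEN spec, THEN mp])
      (intro allI large_phase_in_set[OF K good(1)])
  then obtain u' r where r: "u' \<in> phase_set K" "strict_mono r" "((\<lambda>k. large_phase (N k) (xs k)) \<circ> r) \<longlonglongrightarrow> u'"
    by (elim bexE exE conjE) (rule that)
  define u where "u = (\<lambda>k. large_phase (N (r k)) (xs (r k)))"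
  have lim: "u \<longlonglongrightarrow> u'" using r(3) by (simp add: u_def comp_def)
  have uin: "u k \<in> phase_set K" for k unfolding u_def by (rule large_phase_in_set[OF K good(1)])
  define g where "g = (\<lambda>k. xi_gap (circle_freq (N (r k)) (xs (r k))) (circle_phase \<alpha> (xs (r k))) y (u k))"
  have gs: "summable (g k)" "(\<Sum>j. g k j) \<le> gap_bound K (N (r k))" for k
    unfolding g_def u_def by (rule gap_sum_le[OF K Npos good])+
  have "(\<lambda>k. gap_bound K (N (r k))) \<longlonglongrightarrow> 0"
    using LIMSEQ_subseq_LIMSEQ[OF gap_bound_tendsto strict_mono_o[OF mono r(2)]] by (simp add: comp_def)
  then have "(\<lambda>k. \<Sum>j. g k j) \<longlonglongrightarrow> 0"
  proof (rule tendsto_sandwich[OF _ _ tendsto_const, rotated 2])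
    show "eventually (\<lambda>k. (\<Sum>j. g k j) \<le> gap_bound K (N (r k))) sequentially" using gs(2) by simp
    have "0 \<le> (\<Sum>j. g k j)" for k
      by (rule suminf_nonneg[OF gs(1)]) (simp add: g_def xi_gap_nonneg circle_freq_def)
    then show "eventually (\<lambda>k. 0 \<le> (\<Sum>j. g k j)) sequentially" by simp
  qed
  then have 1: "(\<lambda>k. F (xi_list \<alpha> (N (r k)) (xs (r k)))) \<longlonglongrightarrow> F (xi_infinity y u')"
    using xi_phase_tendsto[OF K F uin r(1) lim, of "\<lambda>k. xs (r k)" "\<lambda>k. N (r k)"] good(2) gs(1)
    by (simp add: g_def)
  have 2: "(\<lambda>k. h (u k)) \<longlonglongrightarrow> F (xi_infinity y u')"
    using continuous_on_tendsto_compose[OF h(1) lim] h(2)[OF r(1)] by simp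
  have "(\<lambda>k. F (xi_list \<alpha> (N (r k)) (xs (r k))) - h (u k)) \<longlonglongrightarrow> 0"
    using tendsto_diff[OF 1 2] by simp
  from LIMSEQ_D[OF this d] obtain k where "\<bar>F (xi_list \<alpha> (N (r k)) (xs (r k))) - h (u k)\<bar> < d"
    by auto
  then show False using xs[of "r k"] by (simp add: Q_def u_def)
qed

text \<open>Tietze's theorem extends \<open>u \<mapsto> F (xi_infinity y u)\<close> from \<open>phase_set K\<close> to a bounded continuous
  function \<open>h\<close> on the torus, for which convergence follows from the moments. Replacing \<open>F\<close> by \<open>h\<close>
  costs the probability of leaving \<open>phase_set K\<close>, which is asymptotically of order \<open>1 / K\<close> for the samples and for
  the uniform phases.\<close>

lemma quenched_limit:
  assumes P: "prob_space P" and iid: "iid_uniform_unit_circle P U UNIV"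
    and F: "continuous_map compact_convergence_topology euclideanreal F"
    and B: "\<And>f. f \<in> topspace compact_convergence_topology \<Longrightarrow> \<bar>F f\<bar> \<le> B"
  shows "(\<lambda>n. measure_pmf.expectation (draws n) (\<lambda>xs. F (xi_list \<alpha> n xs)))
    \<longlonglongrightarrow> (\<integral>\<omega>. F (xi_version (y, \<lambda>j. U j \<omega>)) \<partial>P)"
proof (rule LIMSEQ_I)
  interpret P: prob_space P by (rule P)
  fix e :: real assume e: "0 < e"
  have U: "U j \<in> borel_measurable P" "distr P borel (U j) = uniform_unit_circle" for j
    using iid by (auto simp: iid_uniform_unit_circle_def P.indep_vars_def)
  define V where "V = (\<lambda>\<omega> j. U j \<omega>)"
  have V: "V \<in> P \<rightarrow>\<^sub>M borel"
  proof -
    have "V \<in> P \<rightarrow>\<^sub>M Pi\<^sub>M UNIV (\<lambda>_. borel)" unfolding V_def by (rule measurable_PiM_single') (use U(1) in auto)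
    then show ?thesis using sets_PiM_equal_borel measurable_cong_sets by blast
  qed
  have Vt: "AE \<omega> in P. V \<omega> \<in> torus" unfolding V_def by (rule P.AE_uniform_in_torus[OF U])
  have B0: "0 \<le> B" using B[of "\<lambda>_. 0"] by (simp add: topspace_compact_convergence_topology)
  define T where "T = (\<Sum>j. 1 / wt j)"
  have T0: "0 \<le> T" unfolding T_def by (rule suminf_nonneg[OF summable_inverse_wt]) simp
  \<comment> \<open>K controls the probability that a phase comes near 1, for samples and for the limit alike.\<close>
  obtain K where K: "16 * B * T / e < real K" using reals_Archimedean2 by blast
  have "0 \<le> 16 * B * T / e" using B0 T0 e by simp
  then have K0: "0 < K" using K by (metis of_nat_0_less_iff le_less_trans)
  have KT: "2 * B * (T / real K) < e / 8"
    using K K0 e by (simp add: field_simps)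
  have Fb: "\<bar>F (xi_infinity y u)\<bar> \<le> B" if "u \<in> phase_set K" for u
    using B continuous_on_xi_infinity[OF xi_box_params(1)[OF phase_set_box[OF that] phase_gap_bounds(1)[OF K0] summable_y_over_gap[OF K0]]]
    by (simp add: topspace_compact_convergence_topology)
  obtain h where h: "continuous_on UNIV h" "\<And>u. u \<in> phase_set K \<Longrightarrow> h u = F (xi_infinity y u)" "\<And>u. norm (h u) \<le> B"
    using Tietze[OF continuous_on_F_xi[OF K0 F], of UNIV B] closed_phase_set B0 Fb by auto
  have hb: "\<bar>h u\<bar> \<le> B" for u using h(3)[of u] by simp
  have hm: "h \<in> borel_measurable borel" by (rule borel_measurable_continuous_onI[OF h(1)])
  note Fxm = borel_measurable_continuous_map_real[OF F]
  have Fvm: "(\<lambda>\<omega>. F (xi_version (y, V \<omega>))) \<in> borel_measurable P"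
  proof -
    have pm: "(\<lambda>\<omega>. (y, V \<omega>)) \<in> P \<rightarrow>\<^sub>M borel"
      unfolding borel_prod[symmetric] by (rule measurable_Pair[OF measurable_const V]) simp
    show ?thesis by (rule measurable_compose[OF measurable_compose[OF pm measurable_xi_version] Fxm])
  qed
  have Fvb: "\<bar>F (xi_version p)\<bar> \<le> B" for p
    by (rule B) (simp add: topspace_compact_convergence_topology continuous_on_xi_version)
  have intF: "integrable P (\<lambda>\<omega>. F (xi_version (y, V \<omega>)))"
    by (rule P.integrable_const_bound[where B=B]) (use Fvm Fvb in auto)
  have inth: "integrable P (\<lambda>\<omega>. h (V \<omega>))"
    by (rule P.integrable_const_bound[where B=B]) (use hb measurable_compose[OF V hm] in auto)
  define bad where "bad = (\<Union>j. {\<omega>\<in>space P. norm (1 - U j \<omega>) < phase_gap K j})"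
  note near = P.prob_phase_near_1[OF U phase_gap_bounds(1)[OF K0]]
  have badm: "bad \<in> sets P" unfolding bad_def by (rule sets.countable_nat_UN) (use near(2) in \<open>simp add: image_subset_iff\<close>)
  have pbad: "P.prob bad \<le> T / real K"
  proof -
    have le: "P.prob {\<omega>\<in>space P. norm (1 - U j \<omega>) < phase_gap K j} \<le> 1 / real K * (1 / wt j)" for j
      by (rule order.trans[OF near(1) phase_gap_bounds(2)[OF K0]])
    have s: "summable (\<lambda>j. 1 / real K * (1 / wt j))" by (rule summable_mult[OF summable_inverse_wt])
    have sp: "summable (\<lambda>j. P.prob {\<omega>\<in>space P. norm (1 - U j \<omega>) < phase_gap K j})"
      by (rule summable_comparison_test'[OF s, of 0]) (use le in simp)
    have "P.prob bad \<le> (\<Sum>j. P.prob {\<omega>\<in>space P. norm (1 - U j \<omega>) < phase_gap K j})"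
      unfolding bad_def by (rule P.finite_measure_subadditive_countably[OF _ sp]) (use near(2) in \<open>simp add: image_subset_iff\<close>)
    also have "\<dots> \<le> (\<Sum>j. 1 / real K * (1 / wt j))" by (rule suminf_le[OF le sp s])
    also have "\<dots> = T / real K" unfolding T_def by (subst suminf_mult[OF summable_inverse_wt]) simp
    finally show ?thesis .
  qed
  have diffU: "\<bar>(\<integral>\<omega>. h (V \<omega>) \<partial>P) - (\<integral>\<omega>. F (xi_version (y, V \<omega>)) \<partial>P)\<bar> \<le> 2 * B * (T / real K)"
  proof -
    have "\<bar>(\<integral>\<omega>. h (V \<omega>) \<partial>P) - (\<integral>\<omega>. F (xi_version (y, V \<omega>)) \<partial>P)\<bar> = \<bar>\<integral>\<omega>. h (V \<omega>) - F (xi_version (y, V \<omega>)) \<partial>P\<bar>"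
      by (subst Bochner_Integration.integral_diff[OF inth intF]) simp_all
    also have "\<dots> \<le> (\<integral>\<omega>. \<bar>h (V \<omega>) - F (xi_version (y, V \<omega>))\<bar> \<partial>P)" by (rule integral_abs_bound)
    also have "\<dots> \<le> (\<integral>\<omega>. 2 * B * indicat_real bad \<omega> \<partial>P)"
    proof (rule integral_mono_AE)
      show "integrable P (\<lambda>\<omega>. \<bar>h (V \<omega>) - F (xi_version (y, V \<omega>))\<bar>)"
        by (rule integrable_abs[OF Bochner_Integration.integrable_diff[OF inth intF]])
      show "integrable P (\<lambda>\<omega>. 2 * B * indicat_real bad \<omega>)"
        by (intro integrable_mult_right integrable_real_indicator badm) (simp add: P.emeasure_eq_measure)
      show "AE \<omega> in P. \<bar>h (V \<omega>) - F (xi_version (y, V \<omega>))\<bar> \<le> 2 * B * indicat_real bad \<omega>"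
        using Vt P.AE_phase_bound[of U, OF U] AE_space
      proof eventually_elim
        case (elim \<omega>)
        show ?case
        proof (cases "\<omega> \<in> bad")
          case True
          have "\<bar>h (V \<omega>) - F (xi_version (y, V \<omega>))\<bar> \<le> \<bar>h (V \<omega>)\<bar> + \<bar>F (xi_version (y, V \<omega>))\<bar>" by (rule abs_triangle_ineq4)
          also have "\<dots> \<le> B + B" by (rule add_mono[OF hb Fvb])
          finally show ?thesis using True by simp
        next
          case False
          then have "V \<omega> \<in> phase_set K"
            using elim(1,3) unfolding bad_def phase_set_def V_def torus_def by (auto simp: not_less)
          moreover obtain c' where "0 < c'" "\<And>j. c' / wt j \<le> norm (1 - V \<omega> j)" using elim(2) unfolding V_def by blast
          then have "xi_version (y, V \<omega>) = xi_infinity y (V \<omega>)"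
            by (intro xi_version_eq[OF decay]) (use y01 in auto)
          ultimately show ?thesis using h(2) B0 by simp
        qed
      qed
    qed
    also have "\<dots> = 2 * B * P.prob bad" using badm by simp
    also have "\<dots> \<le> 2 * B * (T / real K)" using pbad B0 by (intro mult_left_mono) auto
    finally show ?thesis .
  qed
  have conv: "(\<lambda>n. measure_pmf.expectation (draws n) (\<lambda>xs. h (large_phase n xs))) \<longlonglongrightarrow> (\<integral>\<omega>. h (V \<omega>) \<partial>P)"
  proof (rule torus_moments_imp_weak[OF P V Vt large_phase_torus _ h(1) hb])
    fix a b J
    show "(\<lambda>n. measure_pmf.expectation (draws n) (\<lambda>xs. torus_monom a b J (large_phase n xs))) \<longlonglongrightarrow> (\<integral>\<omega>. torus_monom a b J (V \<omega>) \<partial>P)"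
      using large_phase_moments[of a b J] P.torus_monom_uniform[OF iid, of a b J] by (simp add: V_def)
  qed
  obtain N1 where N1: "\<And>n. N1 \<le> n \<Longrightarrow> \<bar>measure_pmf.expectation (draws n) (\<lambda>xs. h (large_phase n xs)) - (\<integral>\<omega>. h (V \<omega>) \<partial>P)\<bar> < e / 4"
    using LIMSEQ_D[OF conv, of "e / 4"] e by auto
  obtain N2 where N2: "\<And>n xs. N2 \<le> n \<Longrightarrow> xs \<in> good_lists K n \<Longrightarrow> length xs = n \<Longrightarrow>
      \<bar>F (xi_list \<alpha> n xs) - h (large_phase n xs)\<bar> < e / 4"
    using eventually_close_on_good[OF K0 F h(1,2), of "e / 4"] e unfolding eventually_sequentially by fastforce
  have "(\<lambda>n. 2 * B * bad_bound K n) \<longlonglongrightarrow> 0" by (rule tendsto_mult_right_zero[OF bad_bound_tendsto])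
  then obtain N3 where N3: "\<And>n. N3 \<le> n \<Longrightarrow> \<bar>2 * B * bad_bound K n\<bar> < e / 8"
    using LIMSEQ_D[of _ 0 "e / 8"] e by fastforce
  show "\<exists>no. \<forall>n\<ge>no. norm (measure_pmf.expectation (draws n) (\<lambda>xs. F (xi_list \<alpha> n xs))
      - (\<integral>\<omega>. F (xi_version (y, \<lambda>j. U j \<omega>)) \<partial>P)) < e"
  proof (intro exI allI impI)
    fix n assume n: "Suc (max N1 (max N2 N3)) \<le> n"
    then have n0: "0 < n" and nN: "N1 \<le> n" "N2 \<le> n" "N3 \<le> n" by auto
    define X where "X = (\<lambda>xs. F (xi_list \<alpha> n xs))"
    define Z where "Z = (\<lambda>xs. h (large_phase n xs))"
    have Xb: "\<bar>X xs\<bar> \<le> B" if "length xs = n" for xs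
      unfolding X_def using B continuous_on_xi_infinity[OF xi_params_freq[OF that circle_phase_ne_1[OF \<alpha>]]]
      by (simp add: topspace_compact_convergence_topology)
    have len: "AE xs in draws n. length xs = n" by (simp add: AE_measure_pmf_iff set_replicate_pmf)
    have intX: "integrable (draws n) X"
      by (rule measure_pmf.integrable_const_bound[where B=B]) (use len in \<open>auto elim!: eventually_mono simp: Xb\<close>)
    have intZ: "integrable (draws n) Z"
      by (rule measure_pmf.integrable_const_bound[where B=B]) (simp_all add: Z_def hb)
    have "\<bar>measure_pmf.expectation (draws n) X - measure_pmf.expectation (draws n) Z\<bar> = \<bar>measure_pmf.expectation (draws n) (\<lambda>xs. X xs - Z xs)\<bar>"
      by (subst Bochner_Integration.integral_diff[OF intX intZ]) simp_all
    also have "\<dots> \<le> measure_pmf.expectation (draws n) (\<lambda>xs. \<bar>X xs - Z xs\<bar>)" by (rule integral_abs_bound)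
    also have "\<dots> \<le> measure_pmf.expectation (draws n) (\<lambda>xs. e / 4 + 2 * B * indicat_real (- good_lists K n) xs)"
    proof (rule integral_mono_AE)
      show "integrable (draws n) (\<lambda>xs. \<bar>X xs - Z xs\<bar>)"
        by (rule integrable_abs[OF Bochner_Integration.integrable_diff[OF intX intZ]])
      show "integrable (draws n) (\<lambda>xs. e / 4 + 2 * B * indicat_real (- good_lists K n) xs)"
        by (intro Bochner_Integration.integrable_add integrable_mult_right integrable_real_indicator)
          (simp_all add: measure_pmf.emeasure_eq_measure)
      show "AE xs in draws n. \<bar>X xs - Z xs\<bar> \<le> e / 4 + 2 * B * indicat_real (- good_lists K n) xs"
        using len
      proof eventually_elim
        case (elim xs)
        show ?case
        proof (cases "xs \<in> good_lists K n")
          case True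
          then show ?thesis using N2[OF nN(2) True elim] by (simp add: X_def Z_def)
        next
          case False
          have "\<bar>X xs - Z xs\<bar> \<le> \<bar>X xs\<bar> + \<bar>Z xs\<bar>" by (rule abs_triangle_ineq4)
          also have "\<dots> \<le> B + B" by (rule add_mono[OF Xb[OF elim]]) (simp add: Z_def hb)
          finally show ?thesis using False e by simp
        qed
      qed
    qed
    also have "\<dots> = e / 4 + 2 * B * measure_pmf.prob (draws n) (- good_lists K n)"
      by (subst Bochner_Integration.integral_add)
        (simp_all add: measure_pmf.prob_space integrable_real_indicator measure_pmf.emeasure_eq_measure)
    also have "\<dots> \<le> e / 4 + 2 * B * (1 / real K * T + bad_bound K n)"
      unfolding T_def using prob_not_good[OF K0 n0] B0 by (intro add_left_mono mult_left_mono) auto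
    also have "\<dots> = e / 4 + 2 * B * (T / real K) + 2 * B * bad_bound K n" by (simp add: ring_distribs)
    finally have "\<bar>measure_pmf.expectation (draws n) X - measure_pmf.expectation (draws n) Z\<bar>
      \<le> e / 4 + 2 * B * (T / real K) + 2 * B * bad_bound K n" .
    moreover have "(\<lambda>j. U j \<omega>) = V \<omega>" for \<omega> by (simp add: V_def)
    ultimately show "norm (measure_pmf.expectation (draws n) (\<lambda>xs. F (xi_list \<alpha> n xs))
      - (\<integral>\<omega>. F (xi_version (y, \<lambda>j. U j \<omega>)) \<partial>P)) < e"
      using diffU N1[OF nN(1)] N3[OF nN(3)] KT
      unfolding X_def[symmetric] Z_def[symmetric] real_norm_def by (simp only:)
  qed
qed

end

section \<open>Averaging over the perimeters\<close>

context circle_points begin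

lemma integral_circle_list:
  fixes f :: "nat list \<Rightarrow> real"
  assumes f: "\<And>xs. \<bar>f xs\<bar> \<le> B"
  shows "(\<lambda>\<omega>. measure_pmf.expectation (replicate_pmf n (circle_pmf (Y \<omega>))) f) \<in> borel_measurable P"
    and "(\<integral>\<omega>. f (circle_list n \<omega>) \<partial>P) = (\<integral>\<omega>. measure_pmf.expectation (replicate_pmf n (circle_pmf (Y \<omega>))) f \<partial>P)"
proof -
  define D where "D = (\<lambda>\<omega>. replicate_pmf n (circle_pmf (Y \<omega>)))"
  have fB: "0 \<le> f xs + B" for xs using f[of xs] by (simp add: abs_le_iff)
  have int: "integrable (D \<omega>) (\<lambda>xs. f xs)" for \<omega>
    by (rule measure_pmf.integrable_const_bound[where B=B]) (simp_all add: f)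
  have inner: "(\<integral>\<^sup>+xs. ennreal (f xs + B) \<partial>D \<omega>) = ennreal (measure_pmf.expectation (D \<omega>) f + B)" for \<omega>
  proof -
    have "(\<integral>\<^sup>+xs. ennreal (f xs + B) \<partial>D \<omega>) = ennreal (measure_pmf.expectation (D \<omega>) (\<lambda>xs. f xs + B))"
      by (rule nn_integral_eq_integral) (use int fB in auto)
    also have "measure_pmf.expectation (D \<omega>) (\<lambda>xs. f xs + B) = measure_pmf.expectation (D \<omega>) f + B"
      by (subst Bochner_Integration.integral_add[OF int]) simp_all
    finally show ?thesis .
  qed
  have EB: "\<bar>measure_pmf.expectation (D \<omega>) f\<bar> \<le> B" for \<omega>
  proof -
    have "\<bar>measure_pmf.expectation (D \<omega>) f\<bar> \<le> measure_pmf.expectation (D \<omega>) (\<lambda>xs. \<bar>f xs\<bar>)" by (rule integral_abs_bound)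
    also have "\<dots> \<le> measure_pmf.expectation (D \<omega>) (\<lambda>_. B)" by (rule integral_mono) (use int f in auto)
    finally show ?thesis by simp
  qed
  have EB0: "0 \<le> measure_pmf.expectation (D \<omega>) f + B" for \<omega> using EB[of \<omega>] by (simp add: abs_le_iff)
  note nn = nn_integral_circle_list[of "\<lambda>_ xs. ennreal (f xs + B)" n, OF borel_measurable_const]
  have "(\<lambda>\<omega>. enn2real (\<integral>\<^sup>+xs. ennreal (f xs + B) \<partial>D \<omega>) - B) \<in> borel_measurable P"
    unfolding D_def by (intro borel_measurable_diff borel_measurable_enn2real nn(2) borel_measurable_const)
  then show m: "(\<lambda>\<omega>. measure_pmf.expectation (replicate_pmf n (circle_pmf (Y \<omega>))) f) \<in> borel_measurable P"
    unfolding inner using EB0 by (simp add: D_def)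
  have fm: "(\<lambda>\<omega>. f (circle_list n \<omega>)) \<in> borel_measurable P"
    by (rule measurable_compose[OF measurable_circle_list]) simp
  have i1: "integrable P (\<lambda>\<omega>. f (circle_list n \<omega>))"
    by (rule integrable_const_bound[where B=B]) (use fm f in auto)
  have i2: "integrable P (\<lambda>\<omega>. measure_pmf.expectation (D \<omega>) f)"
    by (rule integrable_const_bound[where B=B]) (use m EB in \<open>auto simp: D_def\<close>)
  have "ennreal (\<integral>\<omega>. f (circle_list n \<omega>) + B \<partial>P) = (\<integral>\<^sup>+\<omega>. ennreal (f (circle_list n \<omega>) + B) \<partial>P)"
    by (rule nn_integral_eq_integral[symmetric]) (use i1 fB in auto)
  also have "\<dots> = (\<integral>\<^sup>+\<omega>. ennreal (measure_pmf.expectation (D \<omega>) f + B) \<partial>P)"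
    by (simp only: nn(1) inner[unfolded D_def] D_def)
  also have "\<dots> = ennreal (\<integral>\<omega>. measure_pmf.expectation (D \<omega>) f + B \<partial>P)"
    by (rule nn_integral_eq_integral) (use i2 EB0 in auto)
  finally have "(\<integral>\<omega>. f (circle_list n \<omega>) + B \<partial>P) = (\<integral>\<omega>. measure_pmf.expectation (D \<omega>) f + B \<partial>P)"
    by (subst (asm) ennreal_inj) (auto intro!: integral_nonneg simp: fB EB0)
  moreover have "(\<integral>\<omega>. f (circle_list n \<omega>) + B \<partial>P) = (\<integral>\<omega>. f (circle_list n \<omega>) \<partial>P) + B"
    by (subst Bochner_Integration.integral_add[OF i1]) (simp_all add: prob_space)
  moreover have "(\<integral>\<omega>. measure_pmf.expectation (D \<omega>) f + B \<partial>P) = (\<integral>\<omega>. measure_pmf.expectation (D \<omega>) f \<partial>P) + B"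
    by (subst Bochner_Integration.integral_add[OF i2]) (simp_all add: prob_space)
  ultimately show "(\<integral>\<omega>. f (circle_list n \<omega>) \<partial>P) = (\<integral>\<omega>. measure_pmf.expectation (replicate_pmf n (circle_pmf (Y \<omega>))) f \<partial>P)"
    by (simp add: D_def)
qed

text \<open>The successor is a function of the finite set of minimisers, chosen from it by Hilbert's operator. As
  this set is a measurable discrete random variable, so is the successor, also when there are ties.\<close>

lemma measurable_gen_perm: "(\<lambda>\<omega>. gen_perm (Y \<omega>) (\<lambda>k. X k \<omega>) n k) \<in> P \<rightarrow>\<^sub>M count_space UNIV"
proof -
  define d where "d = (\<lambda>\<omega> l. ccw_dist (Y \<omega> (fst (X k \<omega>))) (snd (X k \<omega>)) (snd (X l \<omega>)))"
  define inS where "inS = (\<lambda>\<omega> l. l \<noteq> k \<and> fst (X l \<omega>) = fst (X k \<omega>))"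
  define isM where "isM = (\<lambda>\<omega> l. inS \<omega> l \<and> (\<forall>l'\<in>{..<n}. inS \<omega> l' \<longrightarrow> d \<omega> l \<le> d \<omega> l'))"
  define G where "G = (\<lambda>T. if T = {} then k else SOME l. l \<in> T)"
  define code where "code = (\<lambda>\<omega>. {l\<in>{..<n}. isM \<omega> l})"
  have fstm: "(\<lambda>\<omega>. fst (X l \<omega>)) \<in> P \<rightarrow>\<^sub>M count_space UNIV" for l
    by (rule measurable_compose[OF measurable_X measurable_fst])
  have sndm: "(\<lambda>\<omega>. snd (X l \<omega>)) \<in> borel_measurable P" for l
    by (rule measurable_compose[OF measurable_X measurable_snd])
  have Ym: "(\<lambda>\<omega>. Y \<omega> (fst (X k \<omega>))) \<in> borel_measurable P"
    by (rule measurable_compose_countable[OF measurable_Y_coord fstm])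
  have dm: "(\<lambda>\<omega>. d \<omega> l) \<in> borel_measurable P" for l
    unfolding d_def ccw_dist_def
    by (intro measurable_If borel_measurable_diff borel_measurable_add Ym sndm borel_measurable_less)
  have eqm: "{\<omega>\<in>space P. inS \<omega> l} \<in> sets P" for l
  proof (cases "l = k")
    case False
    have "(\<lambda>\<omega>. (fst (X l \<omega>), fst (X k \<omega>))) \<in> P \<rightarrow>\<^sub>M count_space UNIV \<Otimes>\<^sub>M count_space UNIV"
      by (intro measurable_Pair fstm)
    then have "(\<lambda>\<omega>. (fst (X l \<omega>), fst (X k \<omega>))) \<in> P \<rightarrow>\<^sub>M count_space UNIV"
      by (simp add: pair_measure_countable)
    from measurable_sets[OF this, of "{p. fst p = snd p}"] show ?thesis
      using False by (simp add: inS_def vimage_def Int_def conj_commute)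
  qed (simp add: inS_def)
  have Mm: "{\<omega>\<in>space P. isM \<omega> l} \<in> sets P" for l
  proof -
    have "{\<omega>\<in>space P. \<forall>l'\<in>{..<n}. inS \<omega> l' \<longrightarrow> d \<omega> l \<le> d \<omega> l'} \<in> sets P"
    proof (rule sets.sets_Collect_finite_All)
      fix l'
      show "{\<omega>\<in>space P. inS \<omega> l' \<longrightarrow> d \<omega> l \<le> d \<omega> l'} \<in> sets P"
        by (rule sets.sets_Collect_imp[OF borel_measurable_le[OF dm dm] eqm])
    qed simp
    then show ?thesis unfolding isM_def using eqm[of l] by (rule sets.sets_Collect_conj)
  qed
  have codem: "code \<in> P \<rightarrow>\<^sub>M count_space (Pow {..<n})"
  proof (rule measurable_count_space_eq2[THEN iffD2])
    show "finite (Pow {..<n})" by simp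
    show "code \<in> space P \<rightarrow> Pow {..<n} \<and> (\<forall>T\<in>Pow {..<n}. code -` {T} \<inter> space P \<in> sets P)"
    proof (intro conjI ballI)
      show "code \<in> space P \<rightarrow> Pow {..<n}" by (auto simp: code_def)
      fix T assume T: "T \<in> Pow {..<n}"
      have "code -` {T} \<inter> space P = {\<omega>\<in>space P. \<forall>l\<in>{..<n}. (isM \<omega> l \<longrightarrow> l \<in> T) \<and> (l \<in> T \<longrightarrow> isM \<omega> l)}"
        using T unfolding code_def by blast
      also have "\<dots> \<in> sets P"
      proof (rule sets.sets_Collect_finite_All)
        fix l
        show "{\<omega>\<in>space P. (isM \<omega> l \<longrightarrow> l \<in> T) \<and> (l \<in> T \<longrightarrow> isM \<omega> l)} \<in> sets P"
          by (rule sets.sets_Collect_conj) (cases "l \<in> T"; simp add: Mm sets.sets_Collect_neg[OF Mm])+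
      qed simp
      finally show "code -` {T} \<inter> space P \<in> sets P" .
    qed
  qed
  have "gen_perm (Y \<omega>) (\<lambda>k. X k \<omega>) n k = G (code \<omega>)" for \<omega>
  proof -
    define S where "S = {l. l < n \<and> l \<noteq> k \<and> fst (X l \<omega>) = fst (X k \<omega>)}"
    have S: "S = {l\<in>{..<n}. inS \<omega> l}" by (auto simp: S_def inS_def)
    have c: "is_arg_min (d \<omega>) (\<lambda>x. x \<in> S) l \<longleftrightarrow> l \<in> code \<omega>" for l
      unfolding is_arg_min_def code_def isM_def S by (auto simp: not_less)
    have ne: "S = {} \<longleftrightarrow> code \<omega> = {}"
    proof
      assume "code \<omega> = {}"
      show "S = {}"
      proof (rule ccontr)
        assume ne: "S \<noteq> {}"
        have "finite S" by (simp add: S)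
        from arg_min_if_finite[OF this ne, of "d \<omega>"] have "is_arg_min (d \<omega>) (\<lambda>x. x \<in> S) (arg_min_on (d \<omega>) S)"
          unfolding is_arg_min_def by blast
        then show False using c \<open>code \<omega> = {}\<close> by simp
      qed
    qed (auto simp: code_def isM_def S)
    have e: "is_arg_min (d \<omega>) (\<lambda>x. x \<in> S) = (\<lambda>l. l \<in> code \<omega>)" by (rule ext) (rule c)
    show ?thesis
      unfolding gen_perm_def Let_def S_def[symmetric] G_def ne arg_min_on_def arg_min_def
      unfolding e[unfolded d_def] ..
  qed
  then show ?thesis
    using measurable_compose[OF codem, of G "count_space UNIV"] by simp
qed

lemma measurable_of_gen_perm:
  assumes \<psi>: "\<And>\<sigma> \<sigma>'. (\<And>k. k < n \<Longrightarrow> \<sigma> k = \<sigma>' k) \<Longrightarrow> \<psi> \<sigma> = \<psi> \<sigma>'" and sp: "\<And>\<sigma>. \<psi> \<sigma> \<in> space N"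
  shows "(\<lambda>\<omega>. \<psi> (gen_perm (Y \<omega>) (\<lambda>k. X k \<omega>) n)) \<in> P \<rightarrow>\<^sub>M N"
proof -
  define L where "L = (\<lambda>\<omega>. map (gen_perm (Y \<omega>) (\<lambda>k. X k \<omega>) n) [0..<n])"
  have "L \<in> P \<rightarrow>\<^sub>M count_space UNIV"
  proof -
    have "L -` {xs} \<inter> space P \<in> sets P" for xs
    proof (cases "length xs = n")
      case True
      have "{\<omega>\<in>space P. \<forall>k\<in>{..<n}. gen_perm (Y \<omega>) (\<lambda>k. X k \<omega>) n k = xs ! k} \<in> sets P"
      proof (rule sets.sets_Collect_finite_All)
        fix k
        show "{\<omega>\<in>space P. gen_perm (Y \<omega>) (\<lambda>k. X k \<omega>) n k = xs ! k} \<in> sets P"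
          using measurable_sets[OF measurable_gen_perm, of "{xs ! k}" n k]
          by (simp add: vimage_def Int_def conj_commute)
      qed simp
      also have "{\<omega>\<in>space P. \<forall>k\<in>{..<n}. gen_perm (Y \<omega>) (\<lambda>k. X k \<omega>) n k = xs ! k} = L -` {xs} \<inter> space P"
        using True unfolding L_def vimage_def Int_def by (simp add: list_eq_iff_nth_eq Ball_def conj_commute)
      finally show ?thesis .
    next
      case False
      then have "L -` {xs} \<inter> space P = {}" by (auto simp: L_def)
      then show ?thesis by simp
    qed
    then show ?thesis by (subst measurable_count_space_eq2_countable) simp_all
  qed
  then have "(\<lambda>\<omega>. \<psi> (\<lambda>k. if k < n then L \<omega> ! k else 0)) \<in> P \<rightarrow>\<^sub>M N"
    by (rule measurable_compose) (simp add: sp)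
  moreover have "\<psi> (\<lambda>k. if k < n then L \<omega> ! k else 0) = \<psi> (gen_perm (Y \<omega>) (\<lambda>k. X k \<omega>) n)" for \<omega>
    by (rule \<psi>) (simp add: L_def)
  ultimately show ?thesis by simp
qed

end

text \<open>The denominator is constant in \<open>z\<close>, so this also holds when it vanishes.\<close>

lemma continuous_on_xi_alpha: "continuous_on UNIV (xi_alpha n \<alpha> A)" if "A \<in> carrier_mat n n"
proof -
  have det: "Determinant.det (t \<cdot>\<^sub>m 1\<^sub>m n - A) = (\<Sum>p | p permutes {0..<n}. signof p * (\<Prod>i = 0..<n. (if i = p i then t else 0) - A $$ (i, p i)))" for t
  proof -
    have "t \<cdot>\<^sub>m 1\<^sub>m n - A \<in> carrier_mat n n" using that by auto
    then have "Determinant.det (t \<cdot>\<^sub>m 1\<^sub>m n - A) = (\<Sum>p | p permutes {0..<n}. signof p * (\<Prod>i = 0..<n. (t \<cdot>\<^sub>m 1\<^sub>m n - A) $$ (i, p i)))"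
      by (rule det_def')
    also have "\<dots> = (\<Sum>p | p permutes {0..<n}. signof p * (\<Prod>i = 0..<n. (if i = p i then t else 0) - A $$ (i, p i)))"
    proof (intro sum.cong refl arg_cong2[where f="(*)"] prod.cong)
      fix p i assume "p \<in> {p. p permutes {0..<n}}" "i \<in> {0..<n}"
      then have "i < n" "p i < n" using permutes_in_image[of p "{0..<n}" i] by auto
      then show "(t \<cdot>\<^sub>m 1\<^sub>m n - A) $$ (i, p i) = (if i = p i then t else 0) - A $$ (i, p i)"
        using that by auto
    qed
    finally show ?thesis .
  qed
  have "continuous_on UNIV (\<lambda>t. Determinant.det (t \<cdot>\<^sub>m 1\<^sub>m n - A))"
  proof -
    have "continuous_on UNIV (\<lambda>t. (if i = p i then t else 0) - A $$ (i, p i))" for i p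
      by (cases "i = p i") (simp_all add: continuous_on_diff continuous_on_id)
    then show ?thesis
      unfolding det
      by (intro continuous_on_sum continuous_on_mult continuous_on_const continuous_on_prod)
  qed
  then have "continuous_on UNIV (\<lambda>z. Determinant.det (exp (2 * \<i> * of_real pi * (z / of_nat n + of_real \<alpha>)) \<cdot>\<^sub>m 1\<^sub>m n - A))"
    by (rule continuous_on_compose2) (auto simp: divide_inverse intro!: continuous_intros)
  then show ?thesis unfolding xi_alpha_def divide_inverse by (intro continuous_on_mult continuous_on_const)
qed

lemma distr_pair_independent:
  fixes U :: "nat \<Rightarrow> 'a \<Rightarrow> complex" and Y :: "'a \<Rightarrow> nat \<Rightarrow> real"
  assumes P: "prob_space P" and Ym: "Y \<in> P \<rightarrow>\<^sub>M borel" and Vm: "(\<lambda>\<omega> j. U j \<omega>) \<in> P \<rightarrow>\<^sub>M borel"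
    and ind: "independent_rvs P (\<Pi>\<^sub>M j\<in>UNIV. borel) (\<lambda>\<omega> j. U j \<omega>) (seq_borel \<Otimes>\<^sub>M N) (\<lambda>\<omega>. (Y \<omega>, Z \<omega>))"
  shows "distr P borel Y \<Otimes>\<^sub>M distr P borel (\<lambda>\<omega> j. U j \<omega>) = distr P (borel \<Otimes>\<^sub>M borel) (\<lambda>\<omega>. (Y \<omega>, \<lambda>j. U j \<omega>))"
proof (rule pair_measure_eqI)
  interpret P: prob_space P by (rule P)
  interpret PY: prob_space "distr P borel Y" by (rule P.prob_space_distr[OF Ym])
  interpret PV: prob_space "distr P borel (\<lambda>\<omega> j. U j \<omega>)" by (rule P.prob_space_distr[OF Vm])
  show "sigma_finite_measure (distr P borel Y)" "sigma_finite_measure (distr P borel (\<lambda>\<omega> j. U j \<omega>))"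
    by unfold_locales
  show "sets (distr P borel Y \<Otimes>\<^sub>M distr P borel (\<lambda>\<omega> j. U j \<omega>)) = sets (distr P (borel \<Otimes>\<^sub>M borel) (\<lambda>\<omega>. (Y \<omega>, \<lambda>j. U j \<omega>)))"
    by (simp cong: sets_pair_measure_cong)
  fix A B assume "A \<in> sets (distr P borel Y)" "B \<in> sets (distr P borel (\<lambda>\<omega> j. U j \<omega>))"
  then have A: "A \<in> sets borel" and B: "B \<in> sets borel" by simp_all
  have pm: "(\<lambda>\<omega>. (Y \<omega>, \<lambda>j. U j \<omega>)) \<in> P \<rightarrow>\<^sub>M borel \<Otimes>\<^sub>M borel" by (rule measurable_Pair[OF Ym Vm])
  define EA where "EA = Y -` A \<inter> space P"
  define EB where "EB = (\<lambda>\<omega> j. U j \<omega>) -` B \<inter> space P"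
  have "EB \<in> sets (vimage_algebra (space P) (\<lambda>\<omega> j. U j \<omega>) (\<Pi>\<^sub>M j\<in>UNIV. borel))"
    unfolding EB_def by (rule in_vimage_algebra) (use B sets_PiM_equal_borel in blast)
  moreover have "EA \<in> sets (vimage_algebra (space P) (\<lambda>\<omega>. (Y \<omega>, Z \<omega>)) (seq_borel \<Otimes>\<^sub>M N))"
  proof -
    have "A \<times> space N \<in> sets (seq_borel \<Otimes>\<^sub>M N)" using A by (intro pair_measureI) (simp_all add: sets_seq_borel)
    from in_vimage_algebra[OF this, of "\<lambda>\<omega>. (Y \<omega>, Z \<omega>)" "space P"]
    have "(\<lambda>\<omega>. (Y \<omega>, Z \<omega>)) -` (A \<times> space N) \<inter> space P \<in> sets (vimage_algebra (space P) (\<lambda>\<omega>. (Y \<omega>, Z \<omega>)) (seq_borel \<Otimes>\<^sub>M N))" .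
    moreover have "Z \<omega> \<in> space N" if "\<omega> \<in> space P" for \<omega>
    proof -
      have "(Y \<omega>, Z \<omega>) \<in> space (seq_borel \<Otimes>\<^sub>M N)"
        using ind that unfolding independent_rvs_def by (blast dest: measurable_space)
      then show ?thesis by (simp add: space_pair_measure)
    qed
    then have "(\<lambda>\<omega>. (Y \<omega>, Z \<omega>)) -` (A \<times> space N) \<inter> space P = EA" by (auto simp: EA_def)
    ultimately show ?thesis by simp
  qed
  ultimately have "P.prob (EB \<inter> EA) = P.prob EB * P.prob EA"
    using ind P.indep_setD unfolding independent_rvs_def by blast
  moreover have "(\<lambda>\<omega>. (Y \<omega>, \<lambda>j. U j \<omega>)) -` (A \<times> B) \<inter> space P = EB \<inter> EA" by (auto simp: EA_def EB_def)
  moreover have "emeasure (distr P borel Y) A = ennreal (P.prob EA)" "emeasure (distr P borel (\<lambda>\<omega> j. U j \<omega>)) B = ennreal (P.prob EB)"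
    unfolding EA_def EB_def using A B Ym Vm by (simp_all add: emeasure_distr P.emeasure_eq_measure)
  moreover have "emeasure (distr P (borel \<Otimes>\<^sub>M borel) (\<lambda>\<omega>. (Y \<omega>, \<lambda>j. U j \<omega>))) (A \<times> B)
    = emeasure P ((\<lambda>\<omega>. (Y \<omega>, \<lambda>j. U j \<omega>)) -` (A \<times> B) \<inter> space P)"
    by (rule emeasure_distr[OF pm]) (use A B in auto)
  ultimately show "emeasure (distr P borel Y) A * emeasure (distr P borel (\<lambda>\<omega> j. U j \<omega>)) B
    = emeasure (distr P (borel \<Otimes>\<^sub>M borel) (\<lambda>\<omega>. (Y \<omega>, \<lambda>j. U j \<omega>))) (A \<times> B)"
    by (simp add: P.emeasure_eq_measure ennreal_mult mult.commute)
qed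

section \<open>Convergence of the characteristic polynomials\<close>

lemma xi_params_of_bounds:
  assumes y: "y \<in> nabla'" "geometric_decay y" and u: "\<And>j. u j \<noteq> 1"
    and c: "0 < c" "\<And>j. c / wt j \<le> norm (1 - u j)"
  shows "xi_params y u"
  unfolding xi_params_def
proof (intro conjI allI)
  note y01 = nabla'_props(1,2)[OF y(1)]
  show "y j \<in> {0..1}" "u j \<noteq> 1" for j using y01[of j] u by auto
  show "summable (xi_mass y u)"
  proof (rule summable_comparison_test')
    show "summable (\<lambda>j. 1 / c * (wt j * y j))" by (intro summable_mult summable_wt y y01)
    fix j
    have "y j / norm (1 - u j) \<le> y j / (c / wt j)" using y01(1)[of j] c by (intro divide_left_mono mult_pos_pos) (auto simp: u)
    then show "norm (xi_mass y u j) \<le> 1 / c * (wt j * y j)"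
      using y01(1)[of j] c(1) by (simp add: xi_mass_def field_simps del: of_nat_Suc)
  qed
qed

text \<open>With equal phases the gap is the error of the frequencies over \<open>|1 - u j|\<close>, which the weights
  dominate.\<close>

lemma uniform_limit_xi_infinity_freq:
  assumes y: "y \<in> nabla'" "geometric_decay y" and u: "\<And>j. u j \<noteq> 1"
    and c: "0 < c" "\<And>j. c / wt j \<le> norm (1 - u j)" and len: "\<And>n. length (xs n) = n"
    and lim: "(\<lambda>n. \<Sum>j. freq_error y n (xs n) j) \<longlonglongrightarrow> 0" and K: "compact K"
  shows "uniform_limit K (\<lambda>n. xi_infinity (circle_freq n (xs n)) u) (xi_infinity y u) sequentially"
proof (rule uniform_limitI)
  fix e :: real assume e: "0 < e"
  note y01 = nabla'_props(1,2)[OF y(1)]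
  have par: "xi_params y u" by (rule xi_params_of_bounds[OF y u c])
  have se: "summable (\<lambda>j. 1 / c * freq_error y n (xs n) j)" for n
    by (intro summable_mult summable_freq_error summable_wt y y01)
  have gap: "0 \<le> xi_gap (circle_freq n (xs n)) u y u j" "xi_gap (circle_freq n (xs n)) u y u j \<le> 1 / c * freq_error y n (xs n) j" for n j
  proof -
    have "\<bar>circle_freq n (xs n) j - y j\<bar> / norm (1 - u j) \<le> \<bar>circle_freq n (xs n) j - y j\<bar> / (c / wt j)"
      using c by (intro divide_left_mono mult_pos_pos) (auto simp: u)
    then show "0 \<le> xi_gap (circle_freq n (xs n)) u y u j" "xi_gap (circle_freq n (xs n)) u y u j \<le> 1 / c * freq_error y n (xs n) j"
      using c(1) by (simp_all add: xi_gap_def freq_error_def mult_ac del: of_nat_Suc)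
  qed
  have sg: "summable (xi_gap (circle_freq n (xs n)) u y u)" for n
    by (rule summable_comparison_test'[OF se, where N=0]) (use gap in auto)
  have "(\<lambda>n. \<Sum>j. xi_gap (circle_freq n (xs n)) u y u j) \<longlonglongrightarrow> 0"
  proof (rule real_tendsto_sandwich[of "\<lambda>_. 0"])
    show "(\<lambda>n. 1 / c * (\<Sum>j. freq_error y n (xs n) j)) \<longlonglongrightarrow> 0" using tendsto_mult_right[OF lim, of "1 / c"] by simp
    have "(\<Sum>j. xi_gap (circle_freq n (xs n)) u y u j) \<le> 1 / c * (\<Sum>j. freq_error y n (xs n) j)" for n
    proof -
      have "(\<Sum>j. xi_gap (circle_freq n (xs n)) u y u j) \<le> (\<Sum>j. 1 / c * freq_error y n (xs n) j)"
        by (rule suminf_le[OF gap(2) sg se])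
      also have "\<dots> = 1 / c * (\<Sum>j. freq_error y n (xs n) j)"
        by (rule suminf_mult) (intro summable_freq_error summable_wt y y01)
      finally show ?thesis .
    qed
    then show "eventually (\<lambda>n. (\<Sum>j. xi_gap (circle_freq n (xs n)) u y u j) \<le> 1 / c * (\<Sum>j. freq_error y n (xs n) j)) sequentially"
      by simp
  qed (simp_all add: suminf_nonneg[OF sg gap(1)])
  note close = xi_infinity_dist_tendsto[of "\<lambda>_. y" "\<lambda>_. u" _ "\<lambda>n. circle_freq n (xs n)" "\<lambda>_. u", OF par order_refl sg circle_freq_unit[OF len] u this e]
  obtain R where "K \<subseteq> cball 0 R" using compact_imp_bounded[OF K] by (auto simp: bounded_iff subset_eq)
  with close[of R] show "eventually (\<lambda>n. \<forall>z\<in>K. dist (xi_infinity (circle_freq n (xs n)) u z) (xi_infinity y u z) < e) sequentially"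
    by (auto elim!: eventually_mono)
qed

context circle_points begin

lemma AE_modified_limit:
  assumes dec: "AE \<omega> in P. geometric_decay (Y \<omega>)" and U: "iid_uniform_unit_circle P U UNIV"
    and Mt: "modified_virtual_permutation P Y X U Mt"
  shows "AE \<omega> in P. (\<forall>z. convergent_prod (xi_factor (Y \<omega>) (\<lambda>j. U j \<omega>) z)) \<and>
           xi_infinity (Y \<omega>) (\<lambda>j. U j \<omega>) holomorphic_on UNIV \<and>
           (\<forall>K. compact K \<longrightarrow>
              uniform_limit K (\<lambda>n. xi_tilde n (Mt n \<omega>)) (xi_infinity (Y \<omega>) (\<lambda>j. U j \<omega>)) sequentially)"
proof -
  have Um: "U j \<in> borel_measurable P" "distr P borel (U j) = uniform_unit_circle" for j
    using U by (auto simp: iid_uniform_unit_circle_def indep_vars_def)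
  have M: "AE \<omega> in P. \<forall>n\<ge>1. Mt n \<omega> \<in> T_set n \<and>
      (\<forall>i<n. \<forall>j<n. Mt n \<omega> $$ (i, j) \<noteq> 0 \<longleftrightarrow> perm_matrix n (gen_perm (Y \<omega>) (\<lambda>k. X k \<omega>) n) $$ (i, j) \<noteq> 0) \<and>
      vec_space.rank (Suc n) (Mt (Suc n) \<omega> - diag_one n (Mt n \<omega>)) = 1 \<and>
      (\<forall>j. on_circle (\<lambda>k. X k \<omega>) n j \<noteq> {} \<longrightarrow>
        (\<Prod>k\<in>on_circle (\<lambda>k. X k \<omega>) n j. Mt n \<omega> $$ (gen_perm (Y \<omega>) (\<lambda>k. X k \<omega>) n k, k)) = U j \<omega>)"
    using Mt unfolding modified_virtual_permutation_def Let_def by (elim conjE)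
  from AE_freq_error_tendsto_0[OF dec] AE_phase_bound[of U, OF Um] AE_distinct_points Y_nabla' dec M
  show ?thesis
  proof eventually_elim
    case (elim \<omega>)
    obtain c where c: "0 < c" "\<And>j. c / wt j \<le> norm (1 - U j \<omega>)" using elim(2) by blast
    have u: "U j \<omega> \<noteq> 1" for j using elim(2) by blast
    have par: "xi_params (Y \<omega>) (\<lambda>j. U j \<omega>)" by (rule xi_params_of_bounds[OF elim(4,5) u c])
    have len: "length (circle_list n \<omega>) = n" for n by (simp add: circle_list_def)
    have eq: "xi_tilde n (Mt n \<omega>) z = xi_infinity (circle_freq n (circle_list n \<omega>)) (\<lambda>j. U j \<omega>) z" if n: "1 \<le> n" for n z
    proof -
      note M = elim(6)[THEN spec, THEN mp, OF n]
      note T = M[THEN conjunct1] and nz = M[THEN conjunct2, THEN conjunct1]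
        and pr = M[THEN conjunct2, THEN conjunct2, THEN conjunct2]
      have "0 < n" using n by simp
      from xi_tilde_eq_xi_infinity[OF this elim(3) u T nz pr]
      show ?thesis by (simp add: circle_labels_def circle_list_def)
    qed
    show ?case
    proof (intro conjI allI impI)
      show "convergent_prod (xi_factor (Y \<omega>) (\<lambda>j. U j \<omega>) z)" for z by (rule convergent_prod_xi_factor[OF par])
      show "xi_infinity (Y \<omega>) (\<lambda>j. U j \<omega>) holomorphic_on UNIV" by (rule xi_infinity_holomorphic[OF par])
      fix K :: "complex set" assume K: "compact K"
      have "uniform_limit K (\<lambda>n. xi_infinity (circle_freq n (circle_list n \<omega>)) (\<lambda>j. U j \<omega>)) (xi_infinity (Y \<omega>) (\<lambda>j. U j \<omega>)) sequentially"
        by (rule uniform_limit_xi_infinity_freq[OF elim(4,5) u c len elim(1) K])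
      then show "uniform_limit K (\<lambda>n. xi_tilde n (Mt n \<omega>)) (xi_infinity (Y \<omega>) (\<lambda>j. U j \<omega>)) sequentially"
        by (rule uniform_limit_cong[THEN iffD2, rotated -1])
          (auto simp: eq eventually_sequentially intro!: exI[of _ 1])
    qed
  qed
qed

text \<open>The limit for fixed perimeters is averaged by dominated convergence. Since the phases are
  independent of the perimeters, the average of the limits is the mean of \<open>F\<close> at the random parameters.\<close>

lemma xi_alpha_converges_in_law:
  assumes dec: "AE \<omega> in P. geometric_decay (Y \<omega>)" and pos: "AE \<omega> in P. \<forall>j. 0 < Y \<omega> j"
    and U: "iid_uniform_unit_circle P U UNIV"
    and ind: "independent_rvs P (\<Pi>\<^sub>M j\<in>UNIV. borel) (\<lambda>\<omega> j. U j \<omega>) (seq_borel \<Otimes>\<^sub>M N) (\<lambda>\<omega>. (Y \<omega>, Z \<omega>))"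
    and \<alpha>: "\<alpha> \<notin> \<rat>" "finite_type \<alpha>"
  defines "\<Xi> \<equiv> \<lambda>\<omega>. xi_version (Y \<omega>, \<lambda>j. U j \<omega>)"
  shows "AE \<omega> in P. \<Xi> \<omega> = xi_infinity (Y \<omega>) (\<lambda>j. U j \<omega>)"
    and "converges_in_law compact_convergence_topology P
           (\<lambda>n \<omega>. xi_alpha n \<alpha> (perm_matrix n (gen_perm (Y \<omega>) (\<lambda>k. X k \<omega>) n))) \<Xi>"
proof -
  have Um: "U j \<in> borel_measurable P" "distr P borel (U j) = uniform_unit_circle" for j
    using U by (auto simp: iid_uniform_unit_circle_def indep_vars_def)
  from AE_phase_bound[of U, OF Um] Y_nabla' dec
  show "AE \<omega> in P. \<Xi> \<omega> = xi_infinity (Y \<omega>) (\<lambda>j. U j \<omega>)"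
  proof eventually_elim
    case (elim \<omega>)
    then obtain c where c: "0 < c" "\<And>j. c / wt j \<le> norm (1 - U j \<omega>)" by blast
    show ?case unfolding \<Xi>_def
      by (rule xi_version_eq[OF elim(3) _ c]) (use nabla'_props(1,2)[OF elim(2)] in simp)
  qed
  define V where "V = (\<lambda>\<omega> j. U j \<omega>)"
  have Ym: "Y \<in> P \<rightarrow>\<^sub>M borel" using measurable_Y measurable_cong_sets[OF refl sets_seq_borel] by blast
  have Vm: "V \<in> P \<rightarrow>\<^sub>M borel" unfolding V_def
    using ind measurable_cong_sets[OF refl sets_PiM_equal_borel] unfolding independent_rvs_def by blast
  have YVm: "(\<lambda>\<omega>. (Y \<omega>, V \<omega>)) \<in> P \<rightarrow>\<^sub>M borel \<Otimes>\<^sub>M borel" by (rule measurable_Pair[OF Ym Vm])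
  have xim: "xi_version \<in> borel \<Otimes>\<^sub>M borel \<rightarrow>\<^sub>M borel_of compact_convergence_topology"
    unfolding borel_prod by (rule measurable_xi_version)
  have sp: "space (borel_of compact_convergence_topology) = {f. continuous_on UNIV f}"
    by (simp add: borel_of_def space_measure_of_conv topspace_compact_convergence_topology)
  define \<psi> where "\<psi> = (\<lambda>n \<sigma>. xi_alpha n \<alpha> (perm_matrix n \<sigma>))"
  have \<psi>c: "continuous_on UNIV (\<psi> n \<sigma>)" for n \<sigma>
    unfolding \<psi>_def by (rule continuous_on_xi_alpha) (simp add: perm_matrix_def)
  have \<psi>m: "(\<lambda>\<omega>. \<psi> n (gen_perm (Y \<omega>) (\<lambda>k. X k \<omega>) n)) \<in> P \<rightarrow>\<^sub>M borel_of compact_convergence_topology" for n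
  proof (rule measurable_of_gen_perm)
    fix \<sigma> \<sigma>' :: "nat \<Rightarrow> nat" assume "\<And>k. k < n \<Longrightarrow> \<sigma> k = \<sigma>' k"
    then have "perm_matrix n \<sigma> = perm_matrix n \<sigma>'" unfolding perm_matrix_def by (intro eq_matI) simp_all
    then show "\<psi> n \<sigma> = \<psi> n \<sigma>'" by (simp add: \<psi>_def)
  qed (simp add: sp \<psi>c)
  have \<Xi>m: "\<Xi> \<in> P \<rightarrow>\<^sub>M borel_of compact_convergence_topology"
    unfolding \<Xi>_def V_def[symmetric] using measurable_compose[OF YVm[unfolded V_def] xim] by simp
  obtain m c where mc: "1 \<le> m" "0 < c" "c \<le> 1" "\<And>n. n \<noteq> 0 \<Longrightarrow> c / real n ^ m \<le> dist_nearest_int (real n * \<alpha>)"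
    using finite_type_lower_bound[OF \<alpha>] by blast
  have lim: "(\<lambda>n. \<integral>\<omega>. F (\<psi> n (gen_perm (Y \<omega>) (\<lambda>k. X k \<omega>) n)) \<partial>P) \<longlonglongrightarrow> (\<integral>\<omega>. F (\<Xi> \<omega>) \<partial>P)"
    if F: "continuous_map compact_convergence_topology euclideanreal F"
      and bd: "bounded (F ` topspace compact_convergence_topology)" for F
  proof -
    obtain B where B': "\<forall>x\<in>F ` topspace compact_convergence_topology. norm x \<le> B" using bd by (auto simp: bounded_iff)
    have B: "\<bar>F f\<bar> \<le> B" if "f \<in> topspace compact_convergence_topology" for f using B' that by auto
    have B0: "0 \<le> B" using B[of "\<lambda>_. 0"] by (simp add: topspace_compact_convergence_topology)
    have Fm: "F \<in> borel_of compact_convergence_topology \<rightarrow>\<^sub>M borel" by (rule borel_measurable_continuous_map_real[OF F])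
    \<comment> \<open>Lists of another length have probability zero; the value 0 makes f n bounded on all lists.\<close>
    define f where "f = (\<lambda>n xs. if length xs = n then F (\<lambda>z. xi_list \<alpha> n xs z) else 0)"
    have ae: "AE \<omega> in P. F (\<psi> n (gen_perm (Y \<omega>) (\<lambda>k. X k \<omega>) n)) = f n (circle_list n \<omega>)" if n: "0 < n" for n
      using AE_distinct_points
    proof eventually_elim
      case (elim \<omega>)
      have "\<psi> n (gen_perm (Y \<omega>) (\<lambda>k. X k \<omega>) n) = xi_list \<alpha> n (circle_list n \<omega>)"
        unfolding \<psi>_def by (rule ext) (use xi_alpha_eq_xi_infinity[OF n elim \<alpha>(1)] in \<open>simp add: circle_labels_def circle_list_def\<close>)
      then show ?case by (simp add: f_def circle_list_def)
    qed
    have fB: "\<bar>f n xs\<bar> \<le> B" for n xs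
    proof (cases "length xs = n")
      case True
      have "xi_params (circle_freq n xs) (circle_phase \<alpha> xs)"
        by (rule xi_params_freq[OF True circle_phase_ne_1[OF \<alpha>(1)]])
      then have "continuous_on UNIV (xi_list \<alpha> n xs)" by (rule continuous_on_xi_infinity)
      then show ?thesis using B True by (simp add: f_def topspace_compact_convergence_topology)
    qed (simp add: f_def B0)
    define E where "E = (\<lambda>n \<omega>. measure_pmf.expectation (replicate_pmf n (circle_pmf (Y \<omega>))) (f n))"
    have icl: "E n \<in> borel_measurable P" "(\<integral>\<omega>. f n (circle_list n \<omega>) \<partial>P) = (\<integral>\<omega>. E n \<omega> \<partial>P)" for n
      unfolding E_def by (rule integral_circle_list[where f="f n" and B=B], rule fB)+
    have left: "(\<integral>\<omega>. F (\<psi> n (gen_perm (Y \<omega>) (\<lambda>k. X k \<omega>) n)) \<partial>P) = (\<integral>\<omega>. E n \<omega> \<partial>P)" if n: "0 < n" for n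
    proof -
      have "(\<integral>\<omega>. F (\<psi> n (gen_perm (Y \<omega>) (\<lambda>k. X k \<omega>) n)) \<partial>P) = (\<integral>\<omega>. f n (circle_list n \<omega>) \<partial>P)"
        by (rule integral_cong_AE[OF measurable_compose[OF \<psi>m Fm] measurable_compose[OF measurable_circle_list] ae[OF n]]) simp
      then show ?thesis using icl(2) by simp
    qed
    have EB: "\<bar>E n \<omega>\<bar> \<le> B" for n \<omega>
    proof -
      have i: "integrable (replicate_pmf n (circle_pmf (Y \<omega>))) (f n)"
        by (rule measure_pmf.integrable_const_bound[where B=B]) (simp_all add: fB)
      have "\<bar>E n \<omega>\<bar> \<le> measure_pmf.expectation (replicate_pmf n (circle_pmf (Y \<omega>))) (\<lambda>xs. \<bar>f n xs\<bar>)"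
        unfolding E_def by (rule integral_abs_bound)
      also have "\<dots> \<le> measure_pmf.expectation (replicate_pmf n (circle_pmf (Y \<omega>))) (\<lambda>_. B)"
        by (rule integral_mono) (use i fB in auto)
      finally show ?thesis by simp
    qed
    define g where "g = (\<lambda>y. \<integral>\<omega>. F (xi_version (y, V \<omega>)) \<partial>P)"
    have Elim: "AE \<omega> in P. (\<lambda>n. E n \<omega>) \<longlonglongrightarrow> g (Y \<omega>)"
      using Y_nabla' dec pos
    proof eventually_elim
      case (elim \<omega>)
      interpret fixed_perimeters "Y \<omega>" \<alpha> c m
        by unfold_locales (use elim \<alpha>(1) mc in auto)
      have "E n \<omega> = measure_pmf.expectation (draws n) (\<lambda>xs. F (xi_list \<alpha> n xs))" for n
        unfolding E_def by (rule integral_cong_AE) (auto simp: AE_measure_pmf_iff f_def set_replicate_pmf)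
      then show ?case unfolding g_def V_def using quenched_limit[OF prob_space_axioms U F B] by simp
    qed
    have Fx: "(\<lambda>p. F (xi_version p)) \<in> borel_measurable (borel \<Otimes>\<^sub>M borel)" by (rule measurable_compose[OF xim Fm])
    have Fxb: "\<bar>F (xi_version p)\<bar> \<le> B" for p
      by (rule B) (simp add: topspace_compact_convergence_topology continuous_on_xi_version)
    define \<mu> where "\<mu> = distr P borel Y"
    define \<nu> where "\<nu> = distr P borel V"
    interpret \<mu>: prob_space \<mu> unfolding \<mu>_def by (rule prob_space_distr[OF Ym])
    interpret \<nu>: prob_space \<nu> unfolding \<nu>_def by (rule prob_space_distr[OF Vm])
    interpret pair: pair_prob_space \<mu> \<nu> by unfold_locales
    have prod: "\<mu> \<Otimes>\<^sub>M \<nu> = distr P (borel \<Otimes>\<^sub>M borel) (\<lambda>\<omega>. (Y \<omega>, V \<omega>))"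
      unfolding \<mu>_def \<nu>_def V_def
      by (rule distr_pair_independent[OF prob_space_axioms Ym Vm[unfolded V_def] ind])
    have Fx': "(\<lambda>p. F (xi_version p)) \<in> borel_measurable (\<mu> \<Otimes>\<^sub>M \<nu>)"
      unfolding prod using Fx by simp
    have int: "integrable (\<mu> \<Otimes>\<^sub>M \<nu>) (\<lambda>p. F (xi_version p))"
      by (rule pair.integrable_const_bound[where B=B]) (use Fx' Fxb in auto)
    have g: "g y = (\<integral>v. F (xi_version (y, v)) \<partial>\<nu>)" for y
    proof -
      have "(\<lambda>v. F (xi_version (y, v))) \<in> borel_measurable borel"
        by (rule measurable_compose[OF measurable_Pair1' Fx]) simp
      then show ?thesis unfolding g_def \<nu>_def by (rule integral_distr[OF Vm, symmetric])
    qed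
    have gm: "g \<in> borel_measurable borel"
    proof -
      have "(\<lambda>y. \<integral>v. F (xi_version (y, v)) \<partial>\<nu>) \<in> borel_measurable \<mu>"
        by (rule \<nu>.borel_measurable_lebesgue_integral) (use Fx' in \<open>simp add: case_prod_unfold\<close>)
      then show ?thesis unfolding g[symmetric] \<mu>_def by simp
    qed
    have "(\<integral>\<omega>. g (Y \<omega>) \<partial>P) = (\<integral>y. g y \<partial>\<mu>)" unfolding \<mu>_def by (rule integral_distr[OF Ym gm, symmetric])
    also have "\<dots> = (\<integral>p. F (xi_version p) \<partial>(\<mu> \<Otimes>\<^sub>M \<nu>))" unfolding g by (rule pair.integral_fst'[OF int])
    also have "\<dots> = (\<integral>\<omega>. F (xi_version (Y \<omega>, V \<omega>)) \<partial>P)" unfolding prod by (rule integral_distr[OF YVm Fx])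
    finally have right: "(\<integral>\<omega>. g (Y \<omega>) \<partial>P) = (\<integral>\<omega>. F (\<Xi> \<omega>) \<partial>P)" by (simp add: \<Xi>_def V_def)
    have "(\<lambda>n. \<integral>\<omega>. E n \<omega> \<partial>P) \<longlonglongrightarrow> (\<integral>\<omega>. g (Y \<omega>) \<partial>P)"
    proof (rule integral_dominated_convergence[where w="\<lambda>_. B"])
      show "(\<lambda>\<omega>. g (Y \<omega>)) \<in> borel_measurable P" by (rule measurable_compose[OF Ym gm])
      show "E n \<in> borel_measurable P" for n by (rule icl(1))
      show "AE \<omega> in P. (\<lambda>n. E n \<omega>) \<longlonglongrightarrow> g (Y \<omega>)" by (rule Elim)
      show "AE \<omega> in P. norm (E n \<omega>) \<le> B" for n using EB by simp
    qed simp
    then have "(\<lambda>n. \<integral>\<omega>. E n \<omega> \<partial>P) \<longlonglongrightarrow> (\<integral>\<omega>. F (\<Xi> \<omega>) \<partial>P)" unfolding right .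
    moreover have "eventually (\<lambda>n. (\<integral>\<omega>. E n \<omega> \<partial>P) = (\<integral>\<omega>. F (\<psi> n (gen_perm (Y \<omega>) (\<lambda>k. X k \<omega>) n)) \<partial>P)) sequentially"
      using eventually_gt_at_top[of 0] by eventually_elim (simp only: left)
    ultimately show ?thesis by (rule Lim_transform_eventually)
  qed
  show "converges_in_law compact_convergence_topology P
           (\<lambda>n \<omega>. xi_alpha n \<alpha> (perm_matrix n (gen_perm (Y \<omega>) (\<lambda>k. X k \<omega>) n))) \<Xi>"
    unfolding converges_in_law_def using \<psi>m \<Xi>m lim unfolding \<psi>_def by blast
qed

end

theorem theorem1:
  fixes P :: "'a measure"
    and p :: "(nat \<Rightarrow> real) measure"
    and Y :: "'a \<Rightarrow> nat \<Rightarrow> real"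
    and X :: "nat \<Rightarrow> 'a \<Rightarrow> nat \<times> real"
    and U :: "nat \<Rightarrow> 'a \<Rightarrow> complex"
    and Mt :: "nat \<Rightarrow> 'a \<Rightarrow> complex mat"
  assumes "prob_space P"
    and "law_on_nabla' p" and "exponential_decay p"
    and "Y \<in> P \<rightarrow>\<^sub>M seq_borel" and "distr P seq_borel Y = p"
    and "cond_iid_uniform P Y X"
    and "iid_uniform_unit_circle P U UNIV"
    and "independent_rvs P
           (\<Pi>\<^sub>M j\<in>UNIV. borel) (\<lambda>\<omega> j. U j \<omega>)
           (seq_borel \<Otimes>\<^sub>M (\<Pi>\<^sub>M k\<in>UNIV. count_space UNIV \<Otimes>\<^sub>M borel)) (\<lambda>\<omega>. (Y \<omega>, \<lambda>k. X k \<omega>))"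
    and "modified_virtual_permutation P Y X U Mt"
  shows "(AE \<omega> in P.
           (\<forall>z. convergent_prod (xi_factor (Y \<omega>) (\<lambda>j. U j \<omega>) z)) \<and>
           xi_infinity (Y \<omega>) (\<lambda>j. U j \<omega>) holomorphic_on UNIV \<and>
           (\<forall>K. compact K \<longrightarrow>
              uniform_limit K (\<lambda>n. xi_tilde n (Mt n \<omega>)) (xi_infinity (Y \<omega>) (\<lambda>j. U j \<omega>)) sequentially))
       \<and> (\<forall>\<alpha>\<in>{0<..<1}. \<alpha> \<notin> \<rat> \<longrightarrow> finite_type \<alpha> \<longrightarrow> (AE l in p. \<forall>j. 0 < l j) \<longrightarrow>
           (\<exists>\<Xi>. (AE \<omega> in P. \<Xi> \<omega> = xi_infinity (Y \<omega>) (\<lambda>j. U j \<omega>)) \<and>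
                converges_in_law compact_convergence_topology P
                  (\<lambda>n \<omega>. xi_alpha n \<alpha> (perm_matrix n (gen_perm (Y \<omega>) (\<lambda>k. X k \<omega>) n))) \<Xi>))"
proof -
  interpret P: prob_space P by (rule assms(1))
  have pull: "AE \<omega> in P. Q (Y \<omega>)" if "AE l in p. Q l" for Q
    using that[folded assms(5)] by (rule AE_distrD[OF assms(4)])
  have "AE l in p. l \<in> nabla'" using assms(2) by (simp add: law_on_nabla'_def)
  then have nab: "AE \<omega> in P. Y \<omega> \<in> nabla'" by (rule pull)
  interpret circle_points P Y X
    by unfold_locales (use assms(4) nab assms(6) in auto)
  have dec: "AE \<omega> in P. geometric_decay (Y \<omega>)"
  proof (rule pull)
    interpret p: prob_space p using assms(2) by (simp add: law_on_nabla'_def)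
    obtain r N where r: "r \<in> {0<..<1}" and N: "N \<in> sets p" "measure p N = 1" "\<And>l. l \<in> N \<Longrightarrow> \<exists>C>0. \<forall>j. l j \<le> C * r ^ Suc j"
      using assms(3) unfolding exponential_decay_def by blast
    have "AE l in p. l \<in> N" by (rule p.AE_prob_1[OF N(2)])
    then show "AE l in p. geometric_decay l"
    proof eventually_elim
      case (elim l)
      from N(3)[OF elim] r show ?case unfolding geometric_decay_def by blast
    qed
  qed
  show ?thesis
  proof (intro conjI ballI impI)
    show "AE \<omega> in P.
           (\<forall>z. convergent_prod (xi_factor (Y \<omega>) (\<lambda>j. U j \<omega>) z)) \<and>
           xi_infinity (Y \<omega>) (\<lambda>j. U j \<omega>) holomorphic_on UNIV \<and>
           (\<forall>K. compact K \<longrightarrow>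
              uniform_limit K (\<lambda>n. xi_tilde n (Mt n \<omega>)) (xi_infinity (Y \<omega>) (\<lambda>j. U j \<omega>)) sequentially)"
      by (rule AE_modified_limit[OF dec assms(7,9)])
    fix \<alpha> assume \<alpha>: "\<alpha> \<notin> \<rat>" "finite_type \<alpha>" and pos: "AE l in p. \<forall>j. 0 < l j"
    note law = xi_alpha_converges_in_law[OF dec pull[OF pos] assms(7,8) \<alpha>]
    show "\<exists>\<Xi>. (AE \<omega> in P. \<Xi> \<omega> = xi_infinity (Y \<omega>) (\<lambda>j. U j \<omega>)) \<and>
                converges_in_law compact_convergence_topology P
                  (\<lambda>n \<omega>. xi_alpha n \<alpha> (perm_matrix n (gen_perm (Y \<omega>) (\<lambda>k. X k \<omega>) n))) \<Xi>"
      by (intro exI conjI) (rule law)+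
  qed
qed

end
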